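(* There is a randomized algorithm that, given a nice $k$-expression $\mu$ for a graph $G=(V,E)$, solves \textsc{Connected Vertex Cover} in time $\mathcal{O}^*(6^k)$. The algorithm does not return false positives and returns false negatives with probability at most $1/2$.
   Context: $\mathcal{O}^*$ hides polynomial factors in the input size. Clique-expressions use operations introduce $\ell(v)$, disjoint union, relabel $\rho_{i\to j}$, join $\eta_{i,j}$ ($i\neq j$, adds all edges between label-$i$ and label-$j$ vertices); a $k$-expression uses only labels $1,\dots,k$ throughout. For a node $t$ of the syntax tree, $G_t$ is the graph built by the subexpression at $t$ and $V_t^\ell$ its vertices of label $\ell$. An expression is irredundant if at every join node $t=\eta_{i,j}(G_{t'})$ no edge between $V_{t'}^i$ and $V_{t'}^j$ already exists in $G_{t'}$. It is nice if it is irredundant, every join node $\eta_{i,j}(G_{t'})$ adds at least one edge and has $V_{t'}^i\neq\emptyset\neq V_{t'}^j$, and every relabel node $\rho_{i\to j}(G_{t'})$ has $V_{t'}^i\ne\emptyset\ne V_{t'}^j$. \textsc{Connected Vertex Cover}: given $G=(V,E)$, costs $\mathbf{c}\colon V\to\mathbb{Z}_{>0}$ (polynomially bounded in the input size) and budget $\overline{b}\ge0$, decide whether there exists $X\subseteq V$ such that $G-X$ has no edges, $G[X]$ is connected and $\mathbf{c}(X)\le\overline{b}$. Standing assumption: $G$ is connected with at least two vertices. *)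

theory Defs
  imports
    "HOL-Probability.SPMF"
    "HOL-Computational_Algebra.Polynomial"
    "Graph_Theory.Pair_Digraph"
    "Graph_Theory.Digraph_Component"
begin

section \<open>Clique-expressions\<close>

datatype 'v cexpr =
    Intro nat 'v
  | DUnion "'v cexpr" "'v cexpr"
  | Relabel nat nat "'v cexpr"
  | Join nat nat "'v cexpr"

primrec cverts :: "'v cexpr \<Rightarrow> 'v set" where
  "cverts (Intro l v) = {v}"
| "cverts (DUnion e1 e2) = cverts e1 \<union> cverts e2"
| "cverts (Relabel i j e) = cverts e"
| "cverts (Join i j e) = cverts e"

text \<open>\<open>lverts e l\<close> is the set of vertices that carry label \<open>l\<close> in the graph built by \<open>e\<close>.\<close>

primrec lverts :: "'v cexpr \<Rightarrow> nat \<Rightarrow> 'v set" where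
  "lverts (Intro l' v) l = (if l = l' then {v} else {})"
| "lverts (DUnion e1 e2) l = lverts e1 l \<union> lverts e2 l"
| "lverts (Relabel i j e) l =
    (if l = j then lverts e i \<union> lverts e j else if l = i then {} else lverts e l)"
| "lverts (Join i j e) l = lverts e l"

text \<open>An undirected edge is represented by its two opposite arcs.\<close>

primrec cedges :: "'v cexpr \<Rightarrow> 'v rel" where
  "cedges (Intro l v) = {}"
| "cedges (DUnion e1 e2) = cedges e1 \<union> cedges e2"
| "cedges (Relabel i j e) = cedges e"
| "cedges (Join i j e) = cedges e \<union> lverts e i \<times> lverts e j \<union> lverts e j \<times> lverts e i"

definition graph_of :: "'v cexpr \<Rightarrow> 'v pair_pre_digraph" where
  "graph_of e = \<lparr> pverts = cverts e, parcs = cedges e \<rparr>"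

primrec clabels :: "'v cexpr \<Rightarrow> nat set" where
  "clabels (Intro l v) = {l}"
| "clabels (DUnion e1 e2) = clabels e1 \<union> clabels e2"
| "clabels (Relabel i j e) = {i, j} \<union> clabels e"
| "clabels (Join i j e) = {i, j} \<union> clabels e"

primrec wf_cexpr :: "'v cexpr \<Rightarrow> bool" where
  "wf_cexpr (Intro l v) = True"
| "wf_cexpr (DUnion e1 e2) = (wf_cexpr e1 \<and> wf_cexpr e2 \<and> cverts e1 \<inter> cverts e2 = {})"
| "wf_cexpr (Relabel i j e) = wf_cexpr e"
| "wf_cexpr (Join i j e) = (wf_cexpr e \<and> i \<noteq> j)"

definition k_expression :: "nat \<Rightarrow> 'v cexpr \<Rightarrow> bool" where
  "k_expression k e \<longleftrightarrow> wf_cexpr e \<and> clabels e \<subseteq> {1..k}"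

primrec subexprs :: "'v cexpr \<Rightarrow> 'v cexpr set" where
  "subexprs (Intro l v) = {Intro l v}"
| "subexprs (DUnion e1 e2) = insert (DUnion e1 e2) (subexprs e1 \<union> subexprs e2)"
| "subexprs (Relabel i j e) = insert (Relabel i j e) (subexprs e)"
| "subexprs (Join i j e) = insert (Join i j e) (subexprs e)"

definition irredundant :: "'v cexpr \<Rightarrow> bool" where
  "irredundant \<mu> \<longleftrightarrow>
    (\<forall>i j e. Join i j e \<in> subexprs \<mu> \<longrightarrow> cedges e \<inter> lverts e i \<times> lverts e j = {})"

definition nice :: "'v cexpr \<Rightarrow> bool" where
  "nice \<mu> \<longleftrightarrow> irredundant \<mu> \<and>
    (\<forall>i j e. Join i j e \<in> subexprs \<mu> \<longrightarrow>
       cedges (Join i j e) \<noteq> cedges e \<and> lverts e i \<noteq> {} \<and> lverts e j \<noteq> {}) \<and>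
    (\<forall>i j e. Relabel i j e \<in> subexprs \<mu> \<longrightarrow> lverts e i \<noteq> {} \<and> lverts e j \<noteq> {})"

lemma lverts_subset: "lverts e l \<subseteq> cverts e"
  by (induction e arbitrary: l) auto

lemma lverts_disjoint: "wf_cexpr e \<Longrightarrow> l \<noteq> l' \<Longrightarrow> lverts e l \<inter> lverts e l' = {}"
proof (induction e arbitrary: l l')
  case (DUnion e1 e2)
  then show ?case
    using lverts_subset[of e1] lverts_subset[of e2] by simp blast
qed (auto split: if_splits)

lemma cedges_subset: "cedges e \<subseteq> cverts e \<times> cverts e"
  using lverts_subset by (induction e) fastforce+

lemma finite_cverts: "finite (cverts e)"
  by (induction e) auto

lemma pair_graph_graph_of:
  assumes "wf_cexpr e"
  shows "pair_graph (graph_of e)"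
proof -
  have loops: "(v, v) \<notin> cedges e" for v
    using assms by (induction e) (auto dest: lverts_disjoint)
  have sym: "sym (cedges e)"
    by (induction e) (auto simp: sym_def)
  show ?thesis
  proof unfold_locales
    show "symmetric (with_proj (graph_of e))"
      using sym by (simp add: symmetric_def graph_of_def)
    show "finite (parcs (graph_of e))"
      using finite_subset[OF cedges_subset[of e]] finite_cverts[of e] by (simp add: graph_of_def)
  qed (use loops cedges_subset finite_cverts in \<open>force simp: graph_of_def\<close>)+
qed


section \<open>Connected vertex covers\<close>

definition connected_vertex_cover :: "'v pair_pre_digraph \<Rightarrow> 'v set \<Rightarrow> bool" where
  "connected_vertex_cover G X \<longleftrightarrow>
    X \<subseteq> pverts G \<and>
    arcs (induce_subgraph (with_proj G) (pverts G - X)) = {} \<and>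
    Digraph_Component.connected (induce_subgraph (with_proj G) X)"

definition CVC :: "'v pair_pre_digraph \<Rightarrow> ('v \<Rightarrow> nat) \<Rightarrow> nat \<Rightarrow> bool" where
  "CVC G c b \<longleftrightarrow> (\<exists>X. connected_vertex_cover G X \<and> (\<Sum>v\<in>X. c v) \<le> b)"


section \<open>Randomized algorithms\<close>

text \<open>
  Randomized algorithms are programs of a first-order call-by-value functional language over
  unlabelled binary trees, with a coin toss. Evaluating an expression costs one step for each
  operator that is executed. No primitive inspects or builds more than one tree node, so a step
  takes constant time on a pointer machine (trees are shared, and the length of the environment
  is bounded by a constant of the program). The model and the logarithmic-cost RAM simulate each
  other with an overhead factor polynomial in the logarithm of the running time. Since only the
  labels that occur in an expression matter, so that \<open>k\<close> may be taken to be at most linear in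
  the input size, this overhead is absorbed by the polynomial factor of a bound \<open>O\<^sup>*(6\<^sup>k)\<close>.

  Variables are de Bruijn indices; every function has exactly one argument.
\<close>

datatype tree = Leaf | Node tree tree

datatype tm =
    Var nat
  | LeafT
  | NodeT tm tm
  | Left tm
  | Right tm
  | IfLeaf tm tm tm
  | LetIn tm tm
  | Call nat tm
  | Coin

type_synonym program = "tm list"

primrec left :: "tree \<Rightarrow> tree" where
  "left Leaf = Leaf"
| "left (Node x y) = x"

primrec right :: "tree \<Rightarrow> tree" where
  "right Leaf = Leaf"
| "right (Node x y) = y"

definition lookup :: "tree list \<Rightarrow> nat \<Rightarrow> tree" where
  "lookup \<rho> i = (if i < length \<rho> then \<rho> ! i else Leaf)"

definition body :: "program \<Rightarrow> nat \<Rightarrow> tm" where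
  "body P f = (if f < length P then P ! f else LeafT)"

primrec enc_bool :: "bool \<Rightarrow> tree" where
  "enc_bool False = Leaf"
| "enc_bool True = Node Leaf Leaf"

text \<open>
  The joint distribution of the value and of the number of steps. Nontermination is the missing
  probability mass of the subprobability distribution.
\<close>

partial_function (spmf) eval :: "program \<Rightarrow> tree list \<Rightarrow> tm \<Rightarrow> (tree \<times> nat) spmf" where
  "eval P \<rho> e = (case e of
      Var i \<Rightarrow> return_spmf (lookup \<rho> i, 1)
    | LeafT \<Rightarrow> return_spmf (Leaf, 1)
    | NodeT e1 e2 \<Rightarrow>
        bind_spmf (eval P \<rho> e1) (\<lambda>(x, s).
        bind_spmf (eval P \<rho> e2) (\<lambda>(y, t).
        return_spmf (Node x y, s + t + 1)))
    | Left e1 \<Rightarrow> bind_spmf (eval P \<rho> e1) (\<lambda>(x, s). return_spmf (left x, s + 1))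
    | Right e1 \<Rightarrow> bind_spmf (eval P \<rho> e1) (\<lambda>(x, s). return_spmf (right x, s + 1))
    | IfLeaf e1 e2 e3 \<Rightarrow>
        bind_spmf (eval P \<rho> e1) (\<lambda>(x, s).
        bind_spmf (eval P \<rho> (if x = Leaf then e2 else e3)) (\<lambda>(y, t).
        return_spmf (y, s + t + 1)))
    | LetIn e1 e2 \<Rightarrow>
        bind_spmf (eval P \<rho> e1) (\<lambda>(x, s).
        bind_spmf (eval P (x # \<rho>) e2) (\<lambda>(y, t).
        return_spmf (y, s + t + 1)))
    | Call f e1 \<Rightarrow>
        bind_spmf (eval P \<rho> e1) (\<lambda>(x, s).
        bind_spmf (eval P [x] (body P f)) (\<lambda>(y, t).
        return_spmf (y, s + t + 1)))
    | Coin \<Rightarrow> bind_spmf coin_spmf (\<lambda>r. return_spmf (enc_bool r, 1)))"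

definition run :: "program \<Rightarrow> tree \<Rightarrow> (tree \<times> nat) spmf" where
  "run P x = eval P [x] (body P 0)"

text \<open>Every run halts within \<open>T\<close> steps, whatever the outcomes of the coin tosses.\<close>

definition halts_within :: "program \<Rightarrow> tree \<Rightarrow> nat \<Rightarrow> bool" where
  "halts_within P x T \<longleftrightarrow>
    lossless_spmf (run P x) \<and> (\<forall>(y, t) \<in> set_spmf (run P x). t \<le> T)"

definition prob_output :: "program \<Rightarrow> tree \<Rightarrow> tree \<Rightarrow> real" where
  "prob_output P x y = measure (measure_spmf (run P x)) {(y', t). y' = y}"


section \<open>Encoding of instances\<close>

text \<open>All numbers are encoded in binary, least significant bit first.\<close>

fun enc_nat :: "nat \<Rightarrow> tree" where
  "enc_nat n = (if n = 0 then Leaf else Node (enc_bool (odd n)) (enc_nat (n div 2)))"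

declare enc_nat.simps [simp del]

primrec enc_list :: "('a \<Rightarrow> tree) \<Rightarrow> 'a list \<Rightarrow> tree" where
  "enc_list f [] = Leaf"
| "enc_list f (x # xs) = Node (f x) (enc_list f xs)"

primrec enc_cexpr :: "nat cexpr \<Rightarrow> tree" where
  "enc_cexpr (Intro l v) = Node (enc_nat 0) (Node (enc_nat l) (enc_nat v))"
| "enc_cexpr (DUnion e1 e2) = Node (enc_nat 1) (Node (enc_cexpr e1) (enc_cexpr e2))"
| "enc_cexpr (Relabel i j e) =
    Node (enc_nat 2) (Node (Node (enc_nat i) (enc_nat j)) (enc_cexpr e))"
| "enc_cexpr (Join i j e) =
    Node (enc_nat 3) (Node (Node (enc_nat i) (enc_nat j)) (enc_cexpr e))"

text \<open>
  The costs are given as the list of all pairs of a vertex and its cost. The size of an input is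
  the number of inner nodes of its encoding, which is what \<open>size\<close> counts on \<open>tree\<close>.
\<close>

definition enc_instance :: "nat cexpr \<Rightarrow> (nat \<Rightarrow> nat) \<Rightarrow> nat \<Rightarrow> tree" where
  "enc_instance \<mu> c b =
    Node (enc_cexpr \<mu>)
      (Node (enc_list (\<lambda>v. Node (enc_nat v) (enc_nat (c v))) (sorted_list_of_set (cverts \<mu>)))
        (enc_nat b))"

end

theory Submission
  imports Defs "HOL-Library.Z2"
begin

text \<open>
  The algorithm is Cut and Count over the field with two elements. For a vertex \<open>r\<close> it counts, modulo
  two and by weight, the pairs of a vertex cover \<open>X\<close> through \<open>r\<close> and a cut of \<open>X\<close> into two sides with
  no edge in between and \<open>r\<close> on the left. A connected \<open>X\<close> has one such cut; otherwise swapping the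
  sides on the part of \<open>X\<close> that cannot be reached from \<open>r\<close> pairs the cuts up. So only connected
  covers survive, and random vertex weights make the lightest of them unique with probability at
  least one half. The weights are scaled such that the cost dominates the random part; the exponents
  of the generating polynomial therefore reveal the cost.

  The polynomial is computed bottom-up for all assignments of states to labels, where a state is the
  set of colors (outside of \<open>X\<close>, left, right) that the vertices of the label may use. Both classes of
  a join are nonempty, hence neither uses all three colors. So a label that is still to be joined has
  six possible states, and any other label needs none. As states are upper bounds, a union is
  a pointwise product, and a join is a sum over pairs of states by inclusion and exclusion.
\<close>


section \<open>The machine\<close>

text \<open>Storing upper bounds instead of exact color sets amounts to storing the zeta transform
  of the table: the convolution that exact states would require at a union becomes a product. The
  obstacle is then the join, where only compatible color sets may meet. Compatibility, seen as a
  bipartite graph between two copies of the three colors, is a cycle of length six. Its maximal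
  bicliques are the six paths with two edges, and two of them share at most one edge. So a join
  entry is a sum of twelve lookups, however many labels there are. Without the vertex
  \<open>r\<close>, exchanging the two sides would make the count of every nonempty cover even. As
  no vertex of the lightest cover is known in advance, all vertices are tried. For n vertices and
  \<open>a = bitlen n\<close> the random weights have \<open>a + 1\<close> bits. This gives at least
  2 n values, as isolation needs, and the random parts of a cover add up to at most 2 ^ (2 a + 1),
  half of the factor by which costs are scaled. Costs are polynomially bounded, so lists of
  coefficients stay short enough.\<close>

lemma eval_simps:
  "eval P \<rho> (Var i) = return_spmf (lookup \<rho> i, 1)"
  "eval P \<rho> LeafT = return_spmf (Leaf, 1)"
  "eval P \<rho> (NodeT e1 e2) = bind_spmf (eval P \<rho> e1) (\<lambda>(x, s).
     bind_spmf (eval P \<rho> e2) (\<lambda>(y, t). return_spmf (Node x y, s + t + 1)))"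
  "eval P \<rho> (Left e1) = bind_spmf (eval P \<rho> e1) (\<lambda>(x, s). return_spmf (left x, s + 1))"
  "eval P \<rho> (Right e1) = bind_spmf (eval P \<rho> e1) (\<lambda>(x, s). return_spmf (right x, s + 1))"
  "eval P \<rho> (IfLeaf e1 e2 e3) = bind_spmf (eval P \<rho> e1) (\<lambda>(x, s).
     bind_spmf (eval P \<rho> (if x = Leaf then e2 else e3)) (\<lambda>(y, t). return_spmf (y, s + t + 1)))"
  "eval P \<rho> (LetIn e1 e2) = bind_spmf (eval P \<rho> e1) (\<lambda>(x, s).
     bind_spmf (eval P (x # \<rho>) e2) (\<lambda>(y, t). return_spmf (y, s + t + 1)))"
  "eval P \<rho> (Call f e1) = bind_spmf (eval P \<rho> e1) (\<lambda>(x, s).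
     bind_spmf (eval P [x] (body P f)) (\<lambda>(y, t). return_spmf (y, s + t + 1)))"
  "eval P \<rho> Coin = bind_spmf coin_spmf (\<lambda>r. return_spmf (enc_bool r, 1))"
  by (subst eval.simps, simp)+

lemma eval_if: "eval P \<rho> (if c then e1 else e2) = (if c then eval P \<rho> e1 else eval P \<rho> e2)"
  by simp

lemma lookup_simps:
  "lookup (x # \<rho>) 0 = x"
  "lookup (x # y # \<rho>) 1 = y"
  "lookup (x # y # \<rho>) (Suc 0) = y"
  "lookup (x # y # z # \<rho>) 2 = z"
  by (simp_all add: lookup_def numeral_2_eq_2)

lemma enc_bool_eq_Leaf [simp]: "enc_bool b = Leaf \<longleftrightarrow> \<not> b"
  by (cases b) auto

primrec quote :: "tree \<Rightarrow> tm" where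
  "quote Leaf = LeafT"
| "quote (Node x y) = NodeT (quote x) (quote y)"

lemma eval_quote: "eval P \<rho> (quote x) = return_spmf (x, 2 * size x + 1)"
  by (induction x) (auto simp: eval_simps)

abbreviation true_tm :: tm where "true_tm \<equiv> NodeT LeafT LeafT"


section \<open>The program\<close>

text \<open>
  \<open>Out\<close> is the color of the vertices outside of the cover, \<open>Lft\<close> and \<open>Rgt\<close> are those of the two
  sides of the cut.
\<close>

datatype color = Out | Lft | Rgt

lemma UNIV_color: "UNIV = {Out, Lft, Rgt}"
  using color.exhaust by auto

instance color :: finite
  by standard (simp add: UNIV_color)

definition enc_cols :: "color set \<Rightarrow> tree" where
  "enc_cols A = Node (enc_bool (Out \<in> A)) (Node (enc_bool (Lft \<in> A)) (enc_bool (Rgt \<in> A)))"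

text \<open>
  Two colors are compatible on the ends of an edge unless both are \<open>Out\<close> or they are the two sides
  of the cut. The list consists of the six maximal bicliques of this relation on colors and of their
  nonempty pairwise intersections, the latter being the six compatible pairs of colors.
\<close>

definition concepts :: "(color set \<times> color set) list" where
  "concepts =
    [({Out}, {Lft, Rgt}), ({Lft, Rgt}, {Out}), ({Lft}, {Out, Lft}), ({Out, Lft}, {Lft}),
     ({Rgt}, {Out, Rgt}), ({Out, Rgt}, {Rgt}), ({Out}, {Lft}), ({Out}, {Rgt}),
     ({Lft}, {Out}), ({Lft}, {Lft}), ({Rgt}, {Out}), ({Rgt}, {Rgt})]"

definition enc_pair :: "color set \<times> color set \<Rightarrow> tree" where
  "enc_pair p = Node (enc_cols (fst p)) (enc_cols (snd p))"


text \<open>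
  Arguments are right-nested pairs: \<open>main\<close> takes the instance, \<open>weights\<close> (costs, coin tosses,
  zeros), \<open>look\<close> (table, labels, states), \<open>joinsum\<close> (concepts, states, (i, j), table, labels),
  \<open>entry\<close> (states, expression, (labels, tables of the operands), weights, r), \<open>build\<close> (labels,
  states, ...), where \<open>...\<close> are all but the first component for \<open>entry\<close>, \<open>solve\<close> (expression,
  labels, weights, r) and \<open>search\<close> (costs, expression, weights, budget).
\<close>


definition f_main :: nat where "f_main = 0"
definition f_equal :: nat where "f_equal = 1"
definition f_assoc :: nat where "f_assoc = 2"
definition f_member :: nat where "f_member = 3"
definition f_remove :: nat where "f_remove = 4"
definition f_append :: nat where "f_append = 5"
definition f_half :: nat where "f_half = 6"
definition f_lg :: nat where "f_lg = 7"
definition f_bits :: nat where "f_bits = 8"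
definition f_tape :: nat where "f_tape = 9"
definition f_add :: nat where "f_add = 10"
definition f_mul :: nat where "f_mul = 11"
definition f_square :: nat where "f_square = 12"
definition f_mono :: nat where "f_mono = 13"
definition f_weights :: nat where "f_weights = 14"
definition f_dec :: nat where "f_dec = 15"
definition f_check :: nat where "f_check = 16"
definition f_inter :: nat where "f_inter = 17"
definition f_look :: nat where "f_look = 18"
definition f_joinsum :: nat where "f_joinsum = 19"
definition f_entry :: nat where "f_entry = 20"
definition f_build :: nat where "f_build = 21"
definition f_solve :: nat where "f_solve = 22"
definition f_search :: nat where "f_search = 23"

text \<open>The last argument of \<open>c_search\<close> consists of \<open>2 a\<close> zeros, the
  digits 0 and 1, and the digits of the budget \<open>b\<close>, where \<open>a\<close> is the
  length of the list returned by \<open>c_lg\<close>. Least significant digit first, its value is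
  \<open>bound a b\<close>.\<close>

definition c_main :: tm where
  "c_main =
    LetIn (Call f_lg (Left (Right (Var 0)))) (LetIn (Call f_tape (NodeT (Left (Right (Var 1)))
    (Var 0))) (Call f_search (NodeT (Left (Right (Var 2))) (NodeT (Left (Var 2)) (NodeT (Call
    f_weights (NodeT (Left (Right (Var 2))) (NodeT (Var 0) (Var 1)))) (Call f_append (NodeT (Var
    1) (Call f_append (NodeT (Var 1) (NodeT LeafT (NodeT true_tm (Right (Right (Var
    2))))))))))))))"

definition c_equal :: tm where
  "c_equal =
    IfLeaf (Left (Var 0)) (IfLeaf (Right (Var 0)) true_tm LeafT) (IfLeaf (Right (Var 0)) LeafT
    (IfLeaf (Call f_equal (NodeT (Left (Left (Var 0))) (Left (Right (Var 0))))) LeafT (Call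
    f_equal (NodeT (Right (Left (Var 0))) (Right (Right (Var 0)))))))"

text \<open>A missing label is unrestricted, hence the default \<open>enc_cols UNIV\<close>. The
  same function looks up the weights of vertices, where no key is missing.\<close>

definition c_assoc :: tm where
  "c_assoc =
    IfLeaf (Right (Var 0)) (quote (enc_cols UNIV)) (IfLeaf (Call f_equal (NodeT (Left (Var 0))
    (Left (Left (Right (Var 0)))))) (Call f_assoc (NodeT (Left (Var 0)) (Right (Right (Var
    0))))) (Right (Left (Right (Var 0)))))"

definition c_member :: tm where
  "c_member =
    IfLeaf (Right (Var 0)) LeafT (IfLeaf (Call f_equal (NodeT (Left (Var 0)) (Left (Right (Var
    0))))) (Call f_member (NodeT (Left (Var 0)) (Right (Right (Var 0))))) true_tm)"

definition c_remove :: tm where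
  "c_remove =
    IfLeaf (Right (Var 0)) LeafT (IfLeaf (Call f_equal (NodeT (Left (Var 0)) (Left (Right (Var
    0))))) (NodeT (Left (Right (Var 0))) (Call f_remove (NodeT (Left (Var 0)) (Right (Right (Var
    0)))))) (Call f_remove (NodeT (Left (Var 0)) (Right (Right (Var 0))))))"

definition c_append :: tm where
  "c_append =
    IfLeaf (Left (Var 0)) (Right (Var 0)) (NodeT (Left (Left (Var 0))) (Call f_append (NodeT
    (Right (Left (Var 0))) (Right (Var 0)))))"

definition c_half :: tm where
  "c_half =
    IfLeaf (Var 0) LeafT (NodeT LeafT (Call f_half (Right (Right (Var 0)))))"

definition c_lg :: tm where
  "c_lg =
    IfLeaf (Var 0) LeafT (NodeT LeafT (Call f_lg (Call f_half (Right (Var 0)))))"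

text \<open>The base case tosses a coin as well: a counter of length n yields n + 1 bits.\<close>

definition c_bits :: tm where
  "c_bits =
    IfLeaf (Var 0) (NodeT Coin LeafT) (NodeT Coin (Call f_bits (Right (Var 0))))"

definition c_tape :: tm where
  "c_tape =
    IfLeaf (Left (Var 0)) LeafT (NodeT (Call f_bits (Right (Var 0))) (Call f_tape (NodeT (Right
    (Left (Var 0))) (Right (Var 0)))))"

definition c_add :: tm where
  "c_add =
    IfLeaf (Left (Var 0)) (Right (Var 0)) (IfLeaf (Right (Var 0)) (Left (Var 0)) (NodeT (IfLeaf
    (Left (Left (Var 0))) (Left (Right (Var 0))) (IfLeaf (Left (Right (Var 0))) (Left (Left (Var
    0))) LeafT)) (Call f_add (NodeT (Right (Left (Var 0))) (Right (Right (Var 0)))))))"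

definition c_mul :: tm where
  "c_mul =
    IfLeaf (Left (Var 0)) LeafT (Call f_add (NodeT (IfLeaf (Left (Left (Var 0))) LeafT (Right
    (Var 0))) (NodeT LeafT (Call f_mul (NodeT (Right (Left (Var 0))) (Right (Var 0)))))))"

definition c_square :: tm where
  "c_square =
    IfLeaf (Var 0) LeafT (NodeT (Left (Var 0)) (NodeT LeafT (Call f_square (Right (Var 0)))))"

definition c_mono :: tm where
  "c_mono =
    IfLeaf (Var 0) (NodeT true_tm LeafT) (LetIn (Call f_square (Call f_mono (Right (Var 0))))
    (IfLeaf (Left (Var 1)) (Var 0) (NodeT LeafT (Var 0))))"

definition c_weights :: tm where
  "c_weights =
    IfLeaf (Left (Var 0)) LeafT (NodeT (NodeT (Left (Left (Left (Var 0)))) (Call f_mono (Call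
    f_append (NodeT (Left (Left (Right (Var 0)))) (Call f_append (NodeT (Right (Right (Var 0)))
    (NodeT LeafT (Right (Left (Left (Var 0))))))))))) (Call f_weights (NodeT (Right (Left (Var
    0))) (NodeT (Right (Left (Right (Var 0)))) (Right (Right (Var 0)))))))"

definition c_dec :: tm where
  "c_dec =
    IfLeaf (Var 0) LeafT (IfLeaf (Left (Var 0)) (LetIn (Call f_dec (Right (Var 0))) (IfLeaf (Var
    0) LeafT (NodeT true_tm (Var 0)))) (NodeT LeafT (Right (Var 0))))"

definition c_check :: tm where
  "c_check =
    IfLeaf (Left (Var 0)) LeafT (IfLeaf (Left (Left (Var 0))) (LetIn (Call f_dec (Right (Var
    0))) (IfLeaf (Var 0) LeafT (Call f_check (NodeT (Right (Left (Var 1))) (Var 0))))) true_tm)"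

definition c_inter :: tm where
  "c_inter =
    NodeT (IfLeaf (Left (Left (Var 0))) LeafT (Left (Right (Var 0)))) (NodeT (IfLeaf (Left
    (Right (Left (Var 0)))) LeafT (Left (Right (Right (Var 0))))) (IfLeaf (Right (Right (Left
    (Var 0)))) LeafT (Right (Right (Right (Var 0))))))"

definition c_look :: tm where
  "c_look =
    IfLeaf (Left (Right (Var 0))) (Left (Var 0)) (LetIn (Call f_assoc (NodeT (Left (Left (Right
    (Var 0)))) (Right (Right (Var 0))))) (Call f_look (NodeT (LetIn (LetIn (IfLeaf (Left (Var
    0)) (Left (Left (Var 1))) (Right (Left (Var 1)))) (IfLeaf (Left (Right (Var 1))) (Left (Var
    0)) (Right (Var 0)))) (IfLeaf (Right (Right (Var 1))) (Left (Var 0)) (Right (Var 0))))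
    (NodeT (Right (Left (Right (Var 1)))) (Right (Right (Var 1)))))))"

definition c_joinsum :: tm where
  "c_joinsum =
    IfLeaf (Left (Var 0)) LeafT (Call f_add (NodeT (Call f_look (NodeT (Left (Right (Right
    (Right (Var 0))))) (NodeT (Right (Right (Right (Right (Var 0))))) (NodeT (NodeT (Left (Left
    (Right (Right (Var 0))))) (Call f_inter (NodeT (Left (Left (Left (Var 0)))) (Call f_assoc
    (NodeT (Left (Left (Right (Right (Var 0))))) (Left (Right (Var 0)))))))) (NodeT (NodeT
    (Right (Left (Right (Right (Var 0))))) (Call f_inter (NodeT (Right (Left (Left (Var 0))))
    (Call f_assoc (NodeT (Right (Left (Right (Right (Var 0))))) (Left (Right (Var 0))))))))
    (Left (Right (Var 0)))))))) (Call f_joinsum (NodeT (Right (Left (Var 0))) (Right (Var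
    0))))))"

definition c_entry :: tm where
  "c_entry =
    IfLeaf (Left (Left (Right (Var 0)))) (LetIn (Call f_assoc (NodeT (Left (Right (Left (Right
    (Var 0))))) (Left (Var 0)))) (LetIn (Call f_assoc (NodeT (Right (Right (Left (Right (Var
    1))))) (Left (Right (Right (Right (Var 1))))))) (IfLeaf (Call f_equal (NodeT (Right (Right
    (Left (Right (Var 2))))) (Right (Right (Right (Right (Var 2))))))) (Call f_add (NodeT
    (IfLeaf (Left (Var 1)) LeafT (NodeT true_tm LeafT)) (Call f_add (NodeT (IfLeaf (Left (Right
    (Var 1))) LeafT (Var 0)) (IfLeaf (Right (Right (Var 1))) LeafT (Var 0)))))) (IfLeaf (Left
    (Right (Var 1))) LeafT (Var 0))))) (IfLeaf (Right (Left (Left (Right (Var 0))))) (Call f_mul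
    (NodeT (Call f_look (NodeT (Left (Right (Left (Right (Right (Var 0)))))) (NodeT (Left (Left
    (Right (Right (Var 0))))) (Left (Var 0))))) (Call f_look (NodeT (Right (Right (Left (Right
    (Right (Var 0)))))) (NodeT (Left (Left (Right (Right (Var 0))))) (Left (Var 0))))))) (IfLeaf
    (Left (Left (Left (Right (Var 0))))) (Call f_look (NodeT (Right (Left (Right (Right (Var
    0))))) (NodeT (Left (Left (Right (Right (Var 0))))) (NodeT (NodeT (Left (Left (Right (Left
    (Right (Var 0)))))) (Call f_assoc (NodeT (Right (Left (Right (Left (Right (Var 0)))))) (Left
    (Var 0))))) (Left (Var 0)))))) (Call f_joinsum (NodeT (quote (enc_list enc_pair concepts))
    (NodeT (Left (Var 0)) (NodeT (NodeT (Left (Left (Right (Left (Right (Var 0)))))) (Right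
    (Left (Right (Left (Right (Var 0))))))) (NodeT (Right (Left (Right (Right (Var 0))))) (Left
    (Left (Right (Right (Var 0))))))))))))"

definition c_build :: tm where
  "c_build =
    IfLeaf (Left (Var 0)) (Call f_entry (NodeT (Left (Right (Var 0))) (Right (Right (Var 0)))))
    (NodeT (NodeT (NodeT LeafT (Call f_build (NodeT (Right (Left (Var 0))) (NodeT (NodeT (NodeT
    (Left (Left (Var 0))) (quote (enc_cols {Rgt}))) (Left (Right (Var 0)))) (Right (Right (Var
    0))))))) (NodeT (Call f_build (NodeT (Right (Left (Var 0))) (NodeT (NodeT (NodeT (Left (Left
    (Var 0))) (quote (enc_cols {Lft}))) (Left (Right (Var 0)))) (Right (Right (Var 0)))))) (Call
    f_build (NodeT (Right (Left (Var 0))) (NodeT (NodeT (NodeT (Left (Left (Var 0))) (quote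
    (enc_cols {Lft, Rgt}))) (Left (Right (Var 0)))) (Right (Right (Var 0)))))))) (NodeT (NodeT
    (Call f_build (NodeT (Right (Left (Var 0))) (NodeT (NodeT (NodeT (Left (Left (Var 0)))
    (quote (enc_cols {Out}))) (Left (Right (Var 0)))) (Right (Right (Var 0)))))) (Call f_build
    (NodeT (Right (Left (Var 0))) (NodeT (NodeT (NodeT (Left (Left (Var 0))) (quote (enc_cols
    {Out, Rgt}))) (Left (Right (Var 0)))) (Right (Right (Var 0))))))) (NodeT (Call f_build
    (NodeT (Right (Left (Var 0))) (NodeT (NodeT (NodeT (Left (Left (Var 0))) (quote (enc_cols
    {Out, Lft}))) (Left (Right (Var 0)))) (Right (Right (Var 0)))))) LeafT)))"

text \<open>The tables of the operands are computed before \<open>c_build\<close> branches over the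
  states, so each subexpression is solved only once.\<close>

definition c_solve :: tm where
  "c_solve =
    IfLeaf (Left (Left (Var 0))) (Call f_build (NodeT (Left (Right (Var 0))) (NodeT LeafT (NodeT
    (Left (Var 0)) (NodeT true_tm (Right (Right (Var 0)))))))) (IfLeaf (Right (Left (Left (Var
    0)))) (Call f_build (NodeT (Left (Right (Var 0))) (NodeT LeafT (NodeT (Left (Var 0)) (NodeT
    (NodeT (Left (Right (Var 0))) (NodeT (Call f_solve (NodeT (Left (Right (Left (Var 0))))
    (Right (Var 0)))) (Call f_solve (NodeT (Right (Right (Left (Var 0)))) (Right (Var 0))))))
    (Right (Right (Var 0)))))))) (LetIn (IfLeaf (Left (Left (Left (Var 0)))) (IfLeaf (Call
    f_member (NodeT (Right (Left (Right (Left (Var 0))))) (Left (Right (Var 0))))) (Call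
    f_remove (NodeT (Left (Left (Right (Left (Var 0))))) (Left (Right (Var 0))))) (NodeT (Left
    (Left (Right (Left (Var 0))))) (Call f_remove (NodeT (Left (Left (Right (Left (Var 0)))))
    (Left (Right (Var 0))))))) (NodeT (Left (Left (Right (Left (Var 0))))) (Call f_remove (NodeT
    (Left (Left (Right (Left (Var 0))))) (NodeT (Right (Left (Right (Left (Var 0))))) (Call
    f_remove (NodeT (Right (Left (Right (Left (Var 0))))) (Left (Right (Var 0)))))))))) (Call
    f_build (NodeT (Left (Right (Var 1))) (NodeT LeafT (NodeT (Left (Var 1)) (NodeT (NodeT (Var
    0) (Call f_solve (NodeT (Right (Right (Left (Var 1)))) (NodeT (Var 0) (Right (Right (Var
    1))))))) (Right (Right (Var 1))))))))))"

definition c_search :: tm where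
  "c_search =
    IfLeaf (Left (Var 0)) LeafT (IfLeaf (Call f_check (NodeT (Call f_solve (NodeT (Left (Right
    (Var 0))) (NodeT LeafT (NodeT (Left (Right (Right (Var 0)))) (Left (Left (Left (Var
    0)))))))) (Right (Right (Right (Var 0)))))) (Call f_search (NodeT (Right (Left (Var 0)))
    (Right (Var 0)))) true_tm)"

definition prog :: program where
  "prog = [c_main, c_equal, c_assoc, c_member, c_remove, c_append, c_half, c_lg, c_bits, c_tape,
    c_add, c_mul, c_square, c_mono, c_weights, c_dec, c_check, c_inter, c_look, c_joinsum,
    c_entry, c_build, c_solve, c_search]"

lemma body_prog:
  "body prog f_main = c_main"
  "body prog f_equal = c_equal"
  "body prog f_assoc = c_assoc"
  "body prog f_member = c_member"
  "body prog f_remove = c_remove"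
  "body prog f_append = c_append"
  "body prog f_half = c_half"
  "body prog f_lg = c_lg"
  "body prog f_bits = c_bits"
  "body prog f_tape = c_tape"
  "body prog f_add = c_add"
  "body prog f_mul = c_mul"
  "body prog f_square = c_square"
  "body prog f_mono = c_mono"
  "body prog f_weights = c_weights"
  "body prog f_dec = c_dec"
  "body prog f_check = c_check"
  "body prog f_inter = c_inter"
  "body prog f_look = c_look"
  "body prog f_joinsum = c_joinsum"
  "body prog f_entry = c_entry"
  "body prog f_build = c_build"
  "body prog f_solve = c_solve"
  "body prog f_search = c_search"
  by (simp_all add: body_def prog_def f_main_def f_equal_def f_assoc_def f_member_def f_remove_def f_append_def f_half_def
    f_lg_def f_bits_def f_tape_def f_add_def f_mul_def f_square_def f_mono_def f_weights_def
    f_dec_def f_check_def f_inter_def f_look_def f_joinsum_def f_entry_def f_build_def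
    f_solve_def f_search_def)

text \<open>For a deterministic call this is the exact number of steps: \<open>return_spmf\<close>
  is injective, so the choice is unique.\<close>

definition cost :: "nat \<Rightarrow> tree \<Rightarrow> nat" where
  "cost f x = (SOME t. \<exists>y. eval prog [x] (body prog f) = return_spmf (y, t))"

definition runs :: "nat \<Rightarrow> tree \<Rightarrow> tree \<Rightarrow> nat \<Rightarrow> bool" where
  "runs f x y B \<longleftrightarrow> (\<exists>t\<le>B. eval prog [x] (body prog f) = return_spmf (y, t))"

lemma runs_eval: "runs f x y B \<Longrightarrow> eval prog [x] (body prog f) = return_spmf (y, cost f x)"
  unfolding runs_def cost_def
  by (smt (verit, best) Pair_inject option.inject return_pmf_inj someI_ex)

lemma runs_cost: "runs f x y B \<Longrightarrow> cost f x \<le> B"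
  unfolding runs_def cost_def
  by (smt (verit, best) Pair_inject option.inject return_pmf_inj someI_ex)

lemma runs_mono: "runs f x y B \<Longrightarrow> B \<le> B' \<Longrightarrow> runs f x y B'"
  unfolding runs_def by (meson le_trans)

lemmas step = eval_simps eval_if lookup_simps eval_quote

subsection \<open>Lists and numbers\<close>

text \<open>The comparison never goes deeper than the first argument, so the second one needs no
  size bound.\<close>

lemma runs_equal: "runs f_equal (Node x y) (enc_bool (x = y)) (80 * size x + 40)"
proof (induction x arbitrary: y)
  case Leaf
  show ?case
    unfolding runs_def body_prog c_equal_def by (cases y) (auto simp: step)
next
  case (Node a b)
  show ?case
  proof (cases y)
    case Leaf
    then show ?thesis unfolding runs_def body_prog c_equal_def
        by (auto simp: step)
  next
    case [simp]: (Node c d)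
    note [simp] = Node.IH(1)[of c, THEN runs_eval] Node.IH(2)[of d, THEN runs_eval]
    show ?thesis
      using Node.IH(1)[of c, THEN runs_cost] Node.IH(2)[of d, THEN runs_cost]
      unfolding runs_def body_prog c_equal_def
        by (auto simp: step)
  qed
qed

lemma inj_enc_nat: "enc_nat m = enc_nat n \<longleftrightarrow> m = n"
proof (induction m arbitrary: n rule: less_induct)
  case (less m)
  have "odd m = odd n \<Longrightarrow> m div 2 = n div 2 \<Longrightarrow> m = n"
    by (metis even_two_times_div_two odd_two_times_div_two_succ)
  moreover have "enc_bool x = enc_bool y \<longleftrightarrow> x = y" for x y
    by (cases x; cases y) auto
  ultimately show ?case
    using less[of "m div 2" "n div 2"]
    by (cases "m = 0"; cases "n = 0") (auto simp: enc_nat.simps[of m] enc_nat.simps[of n] enc_nat.simps[of 0])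
qed

lemma runs_equal_nat: "runs f_equal (Node (enc_nat m) (enc_nat n)) (enc_bool (m = n))
    (80 * size (enc_nat m) + 40)"
  using runs_equal[of "enc_nat m" "enc_nat n"] by (simp add: inj_enc_nat)

definition enc_env :: "('a \<Rightarrow> tree) \<Rightarrow> (nat \<times> 'a) list \<Rightarrow> tree" where
  "enc_env h = enc_list (\<lambda>(l, s). Node (enc_nat l) (h s))"

lemma enc_env_simps [simp]:
  "enc_env h [] = Leaf"
  "enc_env h ((l, s) # A) = Node (Node (enc_nat l) (h s)) (enc_env h A)"
  by (simp_all add: enc_env_def)

text \<open>Comparing with a key of size at most \<open>Z\<close> costs at most
  \<open>80 * Z + 40\<close>; the remaining 100 steps handle the list cell. The bound serves lookup,
  membership and removal alike.\<close>

definition t_assoc :: "nat \<Rightarrow> nat \<Rightarrow> nat" where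
  "t_assoc Z n = (n + 1) * (80 * Z + 140)"

lemma runs_assoc:
  assumes "size (enc_nat l) \<le> Z"
  shows "runs f_assoc (Node (enc_nat l) (enc_env h A))
    (case map_of A l of None \<Rightarrow> enc_cols UNIV | Some s \<Rightarrow> h s) (t_assoc Z (length A))"
proof (induction A)
  case Nil
  show ?case unfolding runs_def body_prog c_assoc_def
        by (auto simp: step enc_cols_def t_assoc_def)
next
  case (Cons p A)
  obtain k s where [simp]: "p = (k, s)" by force
  note [simp] = Cons.IH[THEN runs_eval] runs_equal_nat[of l k, THEN runs_eval]
  show ?case
    using Cons.IH[THEN runs_cost] runs_equal_nat[of l k, THEN runs_cost] assms
    unfolding runs_def body_prog c_assoc_def
        by (auto simp: step t_assoc_def algebra_simps)
qed

definition states :: "(nat \<times> color set) list \<Rightarrow> nat \<Rightarrow> color set" where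
  "states A l = (case map_of A l of None \<Rightarrow> UNIV | Some s \<Rightarrow> s)"

lemma states_simps [simp]: "states [] = (\<lambda>_. UNIV)" "states ((l, s) # A) = (states A)(l := s)"
  by (auto simp: states_def fun_eq_iff)

lemma runs_states:
  assumes "size (enc_nat l) \<le> Z"
  shows "runs f_assoc (Node (enc_nat l) (enc_env enc_cols A)) (enc_cols (states A l))
    (t_assoc Z (length A))"
  using runs_assoc[OF assms, of enc_cols A] by (simp add: states_def split: option.splits)

lemma runs_member:
  assumes "size (enc_nat l) \<le> Z"
  shows "runs f_member (Node (enc_nat l) (enc_list enc_nat D)) (enc_bool (l \<in> set D))
    (t_assoc Z (length D))"
proof (induction D)
  case Nil
  show ?case unfolding runs_def body_prog c_member_def
        by (auto simp: step t_assoc_def)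
next
  case (Cons k D)
  note [simp] = Cons.IH[THEN runs_eval] runs_equal_nat[of l k, THEN runs_eval]
  show ?case
    using Cons.IH[THEN runs_cost] runs_equal_nat[of l k, THEN runs_cost] assms
    unfolding runs_def body_prog c_member_def
        by (auto simp: step t_assoc_def algebra_simps)
qed

lemma runs_remove:
  assumes "size (enc_nat l) \<le> Z"
  shows "runs f_remove (Node (enc_nat l) (enc_list enc_nat D)) (enc_list enc_nat (removeAll l D))
    (t_assoc Z (length D))"
proof (induction D)
  case Nil
  show ?case unfolding runs_def body_prog c_remove_def
        by (auto simp: step t_assoc_def)
next
  case (Cons k D)
  note [simp] = Cons.IH[THEN runs_eval] runs_equal_nat[of l, THEN runs_eval]
  show ?case
    using Cons.IH[THEN runs_cost] runs_equal_nat[of l k, THEN runs_cost] assms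
    unfolding runs_def body_prog c_remove_def
    by (cases "k = l") (simp_all add: step t_assoc_def algebra_simps)
qed

lemma runs_inter: "runs f_inter (Node (enc_cols A) (enc_cols B)) (enc_cols (A \<inter> B)) 100"
  unfolding runs_def body_prog c_inter_def
        by (auto simp: step enc_cols_def split: if_splits)

abbreviation enc_bits :: "bool list \<Rightarrow> tree" where "enc_bits \<equiv> enc_list enc_bool"

lemma runs_append:
  "runs f_append (Node (enc_list h xs) (enc_list h ys)) (enc_list h (xs @ ys)) (30 * length xs + 30)"
proof (induction xs)
  case Nil
  show ?case unfolding runs_def body_prog c_append_def
        by (auto simp: step)
next
  case (Cons x xs)
  note [simp] = Cons.IH[THEN runs_eval]
  show ?case using Cons.IH[THEN runs_cost] unfolding runs_def body_prog c_append_def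
        by (auto simp: step)
qed

primrec len :: "tree \<Rightarrow> nat" where
  "len Leaf = 0"
| "len (Node a x) = Suc (len x)"

lemma len_enc_list [simp]: "len (enc_list h xs) = length xs"
  by (induction xs) auto

lemma len_eq_0 [simp]: "len x = 0 \<longleftrightarrow> x = Leaf"
  by (cases x) auto

abbreviation zeros :: "nat \<Rightarrow> tree" where "zeros n \<equiv> enc_bits (replicate n False)"

lemma runs_half: "runs f_half x (zeros (Suc (len x) div 2)) (30 * len x + 30)"
proof (induction "len x" arbitrary: x rule: less_induct)
  case less
  show ?case
  proof (cases x)
    case Leaf
    then show ?thesis unfolding runs_def body_prog c_half_def
        by (auto simp: step)
  next
    case [simp]: (Node a y)
    have "len (right y) < len x" by (cases y) auto
    note IH = less[OF this]
    note [simp] = IH[THEN runs_eval]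
    have "replicate (Suc (len x) div 2) False = False # replicate (Suc (len (right y)) div 2) False"
      by (cases y) auto
    then show ?thesis using IH[THEN runs_cost] \<open>len (right y) < len x\<close>
      unfolding runs_def body_prog c_half_def
        by (simp add: step)
  qed
qed

text \<open>The number of binary digits, which exceeds the logarithm of a positive number by at most
  one.\<close>

fun bitlen :: "nat \<Rightarrow> nat" where
  "bitlen n = (if n = 0 then 0 else Suc (bitlen (n div 2)))"

declare bitlen.simps [simp del]

lemma bitlen_bounds: "n < 2 ^ bitlen n" "n > 0 \<Longrightarrow> 2 ^ bitlen n \<le> 2 * n"
proof (induction n rule: bitlen.induct)
  case (1 n)
  { case 1 then show ?case using "1.IH" by (cases "n = 0") (auto simp: bitlen.simps[of n]) }
  { case 2 then show ?case using "1.IH" by (cases "n div 2 = 0") (auto simp: bitlen.simps[of n] bitlen.simps[of 0]) }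
qed

lemma runs_lg: "runs f_lg x (zeros (bitlen (len x))) (60 * (len x + 1) ^ 2)"
proof (induction "len x" arbitrary: x rule: less_induct)
  case less
  show ?case
  proof (cases x)
    case Leaf
    then show ?thesis unfolding runs_def body_prog c_lg_def
        by (auto simp: step bitlen.simps)
  next
    case [simp]: (Node a y)
    let ?z = "zeros (Suc (len y) div 2)"
    \<comment> \<open>\<open>f_half\<close> rounds up, but it is applied to the tail: half of
      \<open>len x - 1\<close> rounded up is half of \<open>len x\<close> rounded down.\<close>
    have *: "len ?z = len x div 2" by simp
    then have "len ?z < len x" by simp
    note IH = less[OF this]
    note [simp] = IH[THEN runs_eval] runs_half[of y, THEN runs_eval]
    have "(len ?z + 1)^2 \<le> (len y + 1)^2"
      using * by (intro power_mono) auto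
    then have "cost f_lg ?z \<le> 60 * (len y + 1)^2"
      using IH[THEN runs_cost] by linarith
    then show ?thesis using runs_half[of y, THEN runs_cost]
      unfolding runs_def body_prog c_lg_def
      by (simp add: step bitlen.simps[of "Suc _"] power2_eq_square algebra_simps)
  qed
qed

subsection \<open>Polynomials over the field with two elements\<close>

text \<open>
  A polynomial is the list of its coefficients in ascending order, where \<open>Leaf\<close> is zero and every
  other tree is one.
\<close>

fun padd :: "tree \<Rightarrow> tree \<Rightarrow> tree" where
  "padd Leaf q = q"
| "padd p Leaf = p"
| "padd (Node a p) (Node b q) = Node (if a = Leaf then b else if b = Leaf then a else Leaf) (padd p q)"

primrec pmul :: "tree \<Rightarrow> tree \<Rightarrow> tree" where
  "pmul Leaf q = Leaf"
| "pmul (Node a p) q = padd (if a = Leaf then Leaf else q) (Node Leaf (pmul p q))"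

text \<open>Spreading the coefficients substitutes x ^ 2 for x, which is squaring over the field
  with two elements.\<close>

primrec psquare :: "tree \<Rightarrow> tree" where
  "psquare Leaf = Leaf"
| "psquare (Node a p) = Node a (Node Leaf (psquare p))"

primrec pmono :: "bool list \<Rightarrow> tree" where
  "pmono [] = Node (Node Leaf Leaf) Leaf"
| "pmono (b # bs) = (if b then Node Leaf (psquare (pmono bs)) else psquare (pmono bs))"

primrec pol :: "tree \<Rightarrow> bit poly" where
  "pol Leaf = 0"
| "pol (Node a p) = pCons (if a = Leaf then 0 else 1) (pol p)"

primrec val :: "bool list \<Rightarrow> nat" where
  "val [] = 0"
| "val (b # bs) = of_bool b + 2 * val bs"

lemma pol_padd: "pol (padd p q) = pol p + pol q"
  by (induction p q rule: padd.induct) auto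

lemma pol_pmul: "pol (pmul p q) = pol p * pol q"
  by (induction p) (auto simp: pol_padd)

lemma pol_psquare: "pol p = monom 1 n \<Longrightarrow> pol (psquare p) = monom 1 (2 * n)"
proof (induction p arbitrary: n)
  case (Node a p)
  show ?case
  proof (cases n)
    case 0
    with Node.prems have "pol p = 0" "a \<noteq> Leaf"
      by (auto simp: monom_0 split: if_splits)
    \<comment> \<open>Representations are not normalised: a nonempty list of zeros also stands for
      the zero polynomial.\<close>
    moreover have "pol p = 0 \<Longrightarrow> pol (psquare p) = 0" for p
      by (induction p) (auto split: if_splits)
    ultimately show ?thesis using 0 by (simp add: monom_0)
  next
    case (Suc m)
    with Node.prems have "pol p = monom 1 m" "a = Leaf"
      by (auto simp: monom_Suc split: if_splits)
    then show ?thesis using Suc Node.IH(2)[of m] by (simp add: monom_Suc)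
  qed
qed auto

lemma pol_pmono: "pol (pmono bs) = monom 1 (val bs)"
  by (induction bs) (auto simp: pol_psquare monom_0 monom_Suc one_pCons)

lemma len_padd: "len (padd p q) = max (len p) (len q)"
  by (induction p q rule: padd.induct) auto

lemma len_pmul: "len (pmul p q) \<le> len p + len q"
  by (induction p) (auto simp: len_padd)

lemma len_psquare: "len (psquare p) = 2 * len p"
  by (induction p) auto

lemma len_pmono: "len (pmono bs) < 2 ^ (length bs + 1)"
  by (induction bs) (auto simp: len_psquare)

text \<open>Addition stops at the end of the shorter list. Hence the length of the first summand
  bounds the cost, and every caller puts the summand of known length first.\<close>

lemma runs_padd: "runs f_add (Node p q) (padd p q) (60 * len p + 60)"
proof (induction p q rule: padd.induct)
  case (3 a p b q)
  note [simp] = 3[THEN runs_eval]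
  show ?case using 3[THEN runs_cost]
    unfolding runs_def body_prog c_add_def by (auto simp: step)
qed (unfold runs_def body_prog c_add_def, auto simp: step)

lemma runs_pmul: "runs f_mul (Node p q) (pmul p q) ((len p + 1) * (60 * len q + 120))"
proof (induction p)
  case Leaf
  show ?case unfolding runs_def body_prog c_mul_def by (auto simp: step)
next
  case (Node a p)
  note IH = Node.IH(2)
  note [simp] = IH[THEN runs_eval] runs_padd[THEN runs_eval]
  show ?case
    using IH[THEN runs_cost] runs_padd[of q "Node Leaf (pmul p q)", THEN runs_cost]
      runs_padd[of Leaf "Node Leaf (pmul p q)", THEN runs_cost]
    unfolding runs_def body_prog c_mul_def by (auto simp: step algebra_simps)
qed

lemma runs_psquare: "runs f_square p (psquare p) (30 * len p + 30)"
proof (induction p)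
  case Leaf
  show ?case unfolding runs_def body_prog c_square_def by (auto simp: step)
next
  case (Node a p)
  note IH = Node.IH(2)
  note [simp] = IH[THEN runs_eval]
  show ?case
    using IH[THEN runs_cost] unfolding runs_def body_prog c_square_def by (auto simp: step)
qed

text \<open>Each squaring doubles the length, so the costs form a geometric series that is dominated
  by the last squaring.\<close>

lemma runs_pmono: "runs f_mono (enc_bits bs) (pmono bs) (100 * 2 ^ (length bs + 1))"
proof (induction bs)
  case Nil
  show ?case unfolding runs_def body_prog c_mono_def by (auto simp: step)
next
  case (Cons b bs)
  note [simp] = Cons.IH[THEN runs_eval] runs_psquare[THEN runs_eval]
  show ?case
    using Cons.IH[THEN runs_cost] runs_psquare[of "pmono bs", THEN runs_cost] len_pmono[of bs]
    unfolding runs_def body_prog c_mono_def by (auto simp: step)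
qed

lemma enc_nat_bits: "\<exists>bs. enc_nat n = enc_bits bs \<and> val bs = n \<and> length bs = bitlen n"
proof (induction n rule: bitlen.induct)
  case (1 n)
  show ?case
  proof (cases "n = 0")
    case True
    then show ?thesis by (intro exI[of _ "[]"]) (simp add: enc_nat.simps bitlen.simps)
  next
    case False
    then obtain bs where "enc_nat (n div 2) = enc_bits bs" "val bs = n div 2" "length bs = bitlen (n div 2)"
      using 1 by blast
    with False show ?thesis
      by (intro exI[of _ "odd n # bs"]) (auto simp: enc_nat.simps[of n] bitlen.simps[of n])
  qed
qed

definition bits :: "nat \<Rightarrow> bool list" where
  "bits n = (SOME bs. enc_nat n = enc_bits bs \<and> val bs = n \<and> length bs = bitlen n)"

lemma bits: "enc_nat n = enc_bits (bits n)" "val (bits n) = n" "length (bits n) = bitlen n"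
  using someI_ex[OF enc_nat_bits[of n]] unfolding bits_def by auto

text \<open>Since \<open>dec\<close> keeps leading zeros, the empty list can signal an underflow.\<close>

fun dec :: "bool list \<Rightarrow> bool list" where
  "dec [] = []"
| "dec (True # bs) = False # bs"
| "dec (False # bs) = (if dec bs = [] then [] else True # dec bs)"

lemma dec_eq_Nil: "dec bs = [] \<longleftrightarrow> val bs = 0"
  by (induction bs rule: dec.induct) auto

lemma val_dec: "val (dec bs) = val bs - 1"
  by (induction bs rule: dec.induct) (auto simp: dec_eq_Nil)

lemma length_dec: "length (dec bs) \<le> length bs"
  by (induction bs rule: dec.induct) auto

lemma enc_list_eq_Leaf [simp]: "enc_list h xs = Leaf \<longleftrightarrow> xs = []"
  by (cases xs) auto

lemma runs_dec: "runs f_dec (enc_bits bs) (enc_bits (dec bs)) (30 * length bs + 30)"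
proof (induction bs rule: dec.induct)
  case (3 bs)
  note [simp] = 3[THEN runs_eval]
  show ?case using 3[THEN runs_cost]
    unfolding runs_def body_prog c_dec_def by (auto simp: step)
qed (unfold runs_def body_prog c_dec_def, auto simp: step)

text \<open>A coefficient is inspected before the budget is decreased, so the exponents up to and
  including \<open>n\<close> are covered.\<close>

primrec pcheck :: "tree \<Rightarrow> nat \<Rightarrow> bool" where
  "pcheck Leaf n = False"
| "pcheck (Node a p) n = (a \<noteq> Leaf \<or> n \<noteq> 0 \<and> pcheck p (n - 1))"

lemma pcheck_iff: "pcheck p n \<longleftrightarrow> (\<exists>e\<le>n. coeff (pol p) e = 1)"
proof (induction p arbitrary: n)
  case (Node a p)
  have "(\<exists>e\<le>n. Q e) \<longleftrightarrow> Q 0 \<or> n \<noteq> 0 \<and> (\<exists>e\<le>n - 1. Q (Suc e))" for Q :: "nat \<Rightarrow> bool"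
    by (cases n) (auto, metis Suc_le_mono not0_implies_Suc)
  then show ?case by (auto simp: Node.IH)
qed auto

lemma runs_check:
  "length bs \<le> N \<Longrightarrow> runs f_check (Node p (enc_bits bs)) (enc_bool (pcheck p (val bs)))
    ((len p + 1) * (30 * N + 80))"
proof (induction p arbitrary: bs)
  case Leaf
  show ?case unfolding runs_def body_prog c_check_def by (auto simp: step)
next
  case (Node a p)
  have "length (dec bs) \<le> N" using Node.prems length_dec[of bs] by simp
  note IH = Node.IH(2)[OF this]
  note [simp] = IH[THEN runs_eval] runs_dec[THEN runs_eval]
  show ?case
    using IH[THEN runs_cost] runs_dec[of bs, THEN runs_cost] Node.prems
    unfolding runs_def body_prog c_check_def
    by (auto simp: step algebra_simps val_dec dec_eq_Nil)
qed

subsection \<open>Tables\<close>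

text \<open>
  A table over a list of labels is a trie. Each label contributes three levels, which are selected
  by the membership of the three colors in the state of the label.
\<close>

definition branch :: "color set \<Rightarrow> tree \<Rightarrow> tree" where
  "branch A T = (let g = (\<lambda>x T. if x \<in> A then right T else left T) in g Rgt (g Lft (g Out T)))"

primrec look :: "tree \<Rightarrow> nat list \<Rightarrow> (nat \<Rightarrow> color set) \<Rightarrow> tree" where
  "look T [] S = T"
| "look T (l # D) S = look (branch (S l) T) D S"

text \<open>Of the eight slots of a label, the one of the empty set may stay \<open>Leaf\<close>, as
  a nonempty class has no coloring without colors, and so may the one of the full set, as a label
  that is still to be joined is never asked for all three colors. The six remaining recursive calls
  are the source of the base 6.\<close>

primrec build :: "nat list \<Rightarrow> (nat \<Rightarrow> color set) \<Rightarrow> ((nat \<Rightarrow> color set) \<Rightarrow> tree) \<Rightarrow> tree" where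
  "build [] S f = f S"
| "build (l # D) S f =
    Node (Node (Node Leaf (build D (S(l := {Rgt})) f))
               (Node (build D (S(l := {Lft})) f) (build D (S(l := {Lft, Rgt})) f)))
         (Node (Node (build D (S(l := {Out})) f) (build D (S(l := {Out, Rgt})) f))
               (Node (build D (S(l := {Out, Lft})) f) Leaf))"

text \<open>The tree \<open>Node (Node Leaf Leaf) Leaf\<close> is the polynomial 1, the contribution
  of a vertex outside of the cover. The root \<open>r\<close> is forced to the left.\<close>

definition intro_entry :: "(nat \<Rightarrow> tree) \<Rightarrow> nat \<Rightarrow> nat \<Rightarrow> color set \<Rightarrow> tree" where
  "intro_entry m r v A =
    (if v = r then (if Lft \<in> A then m v else Leaf)
     else padd (if Out \<in> A then Node (Node Leaf Leaf) Leaf else Leaf)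
       (padd (if Lft \<in> A then m v else Leaf) (if Rgt \<in> A then m v else Leaf)))"

primrec join_entry :: "tree \<Rightarrow> nat list \<Rightarrow> (nat \<Rightarrow> color set) \<Rightarrow> nat \<Rightarrow> nat \<Rightarrow>
    (color set \<times> color set) list \<Rightarrow> tree" where
  "join_entry T D S i j [] = Leaf"
| "join_entry T D S i j (p # R) =
    padd (look T D (S(j := snd p \<inter> S j, i := fst p \<inter> S i))) (join_entry T D S i j R)"

text \<open>The labels that are still to be joined, seen from below a relabel node or a join node.\<close>

definition live_relabel :: "nat \<Rightarrow> nat \<Rightarrow> nat list \<Rightarrow> nat list" where
  "live_relabel i j D = (if j \<in> set D then i # removeAll i D else removeAll i D)"

definition live_join :: "nat \<Rightarrow> nat \<Rightarrow> nat list \<Rightarrow> nat list" where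
  "live_join i j D = i # removeAll i (j # removeAll j D)"

text \<open>At a relabel node the vertices of label \<open>i\<close> end up with label
  \<open>j\<close>, so \<open>i\<close> inherits the state of \<open>j\<close>, and below the node
  \<open>i\<close> is live precisely if \<open>j\<close> is live above it. The initial state
  \<open>UNIV\<close> leaves the labels outside of \<open>D\<close> unrestricted.\<close>

primrec solve :: "(nat \<Rightarrow> tree) \<Rightarrow> nat \<Rightarrow> nat cexpr \<Rightarrow> nat list \<Rightarrow> tree" where
  "solve m r (Intro l v) D = build D (\<lambda>_. UNIV) (\<lambda>S. intro_entry m r v (S l))"
| "solve m r (DUnion e1 e2) D = build D (\<lambda>_. UNIV)
    (\<lambda>S. pmul (look (solve m r e1 D) D S) (look (solve m r e2 D) D S))"
| "solve m r (Relabel i j e) D = build D (\<lambda>_. UNIV)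
    (\<lambda>S. look (solve m r e (live_relabel i j D)) (live_relabel i j D) (S(i := S j)))"
| "solve m r (Join i j e) D = build D (\<lambda>_. UNIV)
    (\<lambda>S. join_entry (solve m r e (live_join i j D)) (live_join i j D) S i j concepts)"

text \<open>This bounds the number of coefficients of every table entry, for all states and live
  labels: lengths add up under products, while sums take the maximum. The extra 1 at a vertex covers
  the constant polynomial 1.\<close>

primrec plen :: "(nat \<Rightarrow> tree) \<Rightarrow> nat cexpr \<Rightarrow> nat" where
  "plen m (Intro l v) = len (m v) + 1"
| "plen m (DUnion e1 e2) = plen m e1 + plen m e2"
| "plen m (Relabel i j e) = plen m e"
| "plen m (Join i j e) = plen m e"

text \<open>An unfilled slot thus reads as the zero polynomial, however many labels remain.\<close>

lemma look_Leaf: "look Leaf D S = Leaf"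
  by (induction D) (auto simp: branch_def Let_def)

lemma len_look_build: "(\<And>S. len (f S) \<le> B) \<Longrightarrow> len (look (build D S0 f) D S) \<le> B"
proof (induction D arbitrary: S0)
  case (Cons l D)
  then show ?case by (auto simp: branch_def look_Leaf Let_def)
qed auto

lemma len_join_entry: "(\<And>S. len (look T D S) \<le> B) \<Longrightarrow> len (join_entry T D S i j R) \<le> B"
  by (induction R) (auto simp: len_padd)

lemma len_look_solve: "len (look (solve m r e D) D S) \<le> plen m e"
proof (induction e arbitrary: D S)
  case (Intro l v)
  show ?case by (simp, rule len_look_build) (simp add: intro_entry_def len_padd)
next
  case (DUnion e1 e2)
  show ?case
    by (simp, rule len_look_build) (meson DUnion.IH add_mono le_trans len_pmul)
next
  case (Relabel i j e)
  show ?case by (simp, rule len_look_build) (rule Relabel.IH)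
next
  case (Join i j e)
  show ?case by (simp, rule len_look_build, rule len_join_entry) (rule Join.IH)
qed

text \<open>The list of states may have two entries more than \<open>Z\<close> allows, since a join
  pushes new states for its two labels.\<close>

definition t_look :: "nat \<Rightarrow> nat" where
  "t_look Z = (Z + 1) * (t_assoc Z (Z + 2) + 100)"

lemma t_assoc_mono: "n \<le> n' \<Longrightarrow> t_assoc Z n \<le> t_assoc Z n'"
  by (simp add: t_assoc_def)

lemma runs_look_aux:
  assumes "\<forall>l \<in> set D. size (enc_nat l) \<le> Z"
  shows "runs f_look (Node T (Node (enc_list enc_nat D) (enc_env enc_cols A)))
    (look T D (states A)) ((length D + 1) * (t_assoc Z (length A) + 100))"
  using assms
proof (induction D arbitrary: T)
  case Nil
  show ?case unfolding runs_def body_prog c_look_def by (auto simp: step)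
next
  case (Cons l D)
  let ?T = "branch (states A l) T"
  have IH: "runs f_look (Node T (Node (enc_list enc_nat D) (enc_env enc_cols A)))
    (look T D (states A)) ((length D + 1) * (t_assoc Z (length A) + 100))" for T
    using Cons by simp
  have l: "runs f_assoc (Node (enc_nat l) (enc_env enc_cols A)) (enc_cols (states A l))
    (t_assoc Z (length A))"
    using Cons.prems by (intro runs_states) simp
  note l' = l[THEN runs_eval]
  note [simp] = IH[THEN runs_eval]
  show ?case
    using IH[of ?T, THEN runs_cost] l[THEN runs_cost]
    unfolding runs_def body_prog c_look_def
    by (cases "Out \<in> states A l"; cases "Lft \<in> states A l"; cases "Rgt \<in> states A l")
      (simp_all add: step l', simp_all add: step enc_cols_def branch_def)
qed

lemma runs_look:
  assumes "\<forall>l \<in> set D. size (enc_nat l) \<le> Z" "length D \<le> Z" "length A \<le> Z + 2"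
  shows "runs f_look (Node T (Node (enc_list enc_nat D) (enc_env enc_cols A)))
    (look T D (states A)) (t_look Z)"
proof -
  have "(length D + 1) * (t_assoc Z (length A) + 100) \<le> t_look Z"
    unfolding t_look_def using t_assoc_mono[OF assms(3), of Z] assms(2)
    by (intro mult_le_mono) auto
  with runs_look_aux[OF assms(1)] show ?thesis
    by (rule runs_mono)
qed

lemma size_enc_cols:
  "size (enc_cols A) = 2 + of_bool (Out \<in> A) + of_bool (Lft \<in> A) + of_bool (Rgt \<in> A)"
  by (auto simp: enc_cols_def)

text \<open>The recurrence is T(n + 1) \<le> 6 T(n) + d with a constant d. Subtracting 400 in the
  claim leaves 6 * 400 - 400 steps at each level to pay for d. The list of states grows as the list
  of labels shrinks, so the sum of their lengths is invariant.\<close>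

lemma runs_build_aux:
  assumes "\<And>A. length A \<le> N \<Longrightarrow> runs f_entry (Node (enc_env enc_cols A) ctx) (f (states A)) X"
  shows "length A + length D \<le> N \<Longrightarrow>
    runs f_build (Node (enc_list enc_nat D) (Node (enc_env enc_cols A) ctx))
      (build D (states A) f) (6 ^ length D * (X + 800) - 400)"
proof (induction D arbitrary: A)
  case Nil
  then have *: "runs f_entry (Node (enc_env enc_cols A) ctx) (f (states A)) X"
    by (intro assms) simp
  note [simp] = *[THEN runs_eval]
  show ?case using *[THEN runs_cost]
    unfolding runs_def body_prog c_build_def by (auto simp: step)
next
  case (Cons l D)
  have IH: "runs f_build (Node (enc_list enc_nat D)
      (Node (Node (Node (enc_nat l) (enc_cols s)) (enc_env enc_cols A)) ctx))
      (build D ((states A)(l := s)) f) (6 ^ length D * (X + 800) - 400)" for s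
    using Cons.IH[of "(l, s) # A"] Cons.prems by (simp add: fun_upd_def)
  note [simp] = IH[THEN runs_eval]
  \<comment> \<open>This keeps the truncated subtraction in the bounds exact.\<close>
  have "800 \<le> 6 ^ length D * (X + 800)"
    by (metis le_add2 le_trans mult_le_mono1 nat_mult_1 one_le_numeral one_le_power)
  then show ?case
    using IH[of "{Rgt}", THEN runs_cost] IH[of "{Lft}", THEN runs_cost]
      IH[of "{Lft, Rgt}", THEN runs_cost] IH[of "{Out}", THEN runs_cost]
      IH[of "{Out, Rgt}", THEN runs_cost] IH[of "{Out, Lft}", THEN runs_cost]
    unfolding runs_def body_prog c_build_def by (simp add: step size_enc_cols)
qed

lemma runs_build:
  assumes "\<And>A. length A \<le> Z \<Longrightarrow> runs f_entry (Node (enc_env enc_cols A) ctx) (f (states A)) X"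
    and "length D \<le> Z"
  shows "runs f_build (Node (enc_list enc_nat D) (Node Leaf ctx)) (build D (\<lambda>_. UNIV) f)
    (6 ^ length D * (X + 800))"
  using runs_build_aux[OF assms(1), of Z "[]" D] assms(2) by (auto elim: runs_mono)

text \<open>The case distinctions of \<open>c_entry\<close> and \<open>c_solve\<close> rest on these
  shapes: the tag 0 is \<open>Leaf\<close>, the tag 1 is a node without right subtree, and among the
  others only the tag 2 has no left subtree.\<close>

lemma enc_tags:
  "enc_nat 0 = Leaf"
  "enc_nat 1 = Node (Node Leaf Leaf) Leaf"
  "enc_nat (Suc 0) = Node (Node Leaf Leaf) Leaf"
  "enc_nat 2 = Node Leaf (Node (Node Leaf Leaf) Leaf)"
  "enc_nat 3 = Node (Node Leaf Leaf) (Node (Node Leaf Leaf) Leaf)"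
  by (simp_all add: enc_nat.simps)

text \<open>One bound for all four kinds of nodes. The factor 13 is one more than the number of
  concepts and pays for a join; the last summand pays for the multiplication at a union.\<close>

definition t_entry :: "nat \<Rightarrow> nat" where
  "t_entry Z = 13 * (t_look Z + 2 * t_assoc Z Z + 60 * Z + 1000) + (Z + 1) * (60 * Z + 1200)"

lemma runs_joinsum:
  assumes "\<forall>l \<in> set D. size (enc_nat l) \<le> Z" "length D \<le> Z" "length A \<le> Z"
    and "size (enc_nat i) \<le> Z" "size (enc_nat j) \<le> Z"
    and "\<And>S. len (look T D S) \<le> Z"
  shows "runs f_joinsum (Node (enc_list enc_pair R) (Node (enc_env enc_cols A)
      (Node (Node (enc_nat i) (enc_nat j)) (Node T (enc_list enc_nat D)))))
      (join_entry T D (states A) i j R)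
      ((length R + 1) * (t_look Z + 2 * t_assoc Z Z + 60 * Z + 800))"
proof (induction R)
  case Nil
  show ?case unfolding runs_def body_prog c_joinsum_def by (auto simp: step)
next
  case (Cons p R)
  let ?A = "\<lambda>U V. (i, U \<inter> states A i) # (j, V \<inter> states A j) # A"
  have look: "runs f_look (Node T (Node (enc_list enc_nat D)
      (Node (Node (enc_nat i) (enc_cols U)) (Node (Node (enc_nat j) (enc_cols V)) (enc_env enc_cols A)))))
      (look T D ((states A)(j := V, i := U))) (t_look Z)" for U V
    using runs_look[of D Z "(i, U) # (j, V) # A" T] assms by simp
  have st: "runs f_assoc (Node (enc_nat l) (enc_env enc_cols A)) (enc_cols (states A l))
      (t_assoc Z Z)" if "l = i \<or> l = j" for l
    using runs_states[of l Z A] that assms t_assoc_mono[of "length A" Z Z]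
    by (auto elim: runs_mono)
  note [simp] = look[THEN runs_eval] st[THEN runs_eval] Cons.IH[THEN runs_eval]
    runs_padd[THEN runs_eval] runs_inter[THEN runs_eval]
  let ?L = "look T D ((states A)(j := snd p \<inter> states A j, i := fst p \<inter> states A i))"
  have "cost f_add (Node ?L (join_entry T D (states A) i j R)) \<le> 60 * Z + 60"
    using runs_padd[THEN runs_cost, of ?L "join_entry T D (states A) i j R"]
      assms(6)[of "(states A)(j := snd p \<inter> states A j, i := fst p \<inter> states A i)"]
    by simp
  then show ?case
    using look[of "fst p \<inter> states A i" "snd p \<inter> states A j", THEN runs_cost]
      st[of i, THEN runs_cost] st[of j, THEN runs_cost] Cons.IH[THEN runs_cost]
      runs_inter[of "fst p" "states A i", THEN runs_cost]
      runs_inter[of "snd p" "states A j", THEN runs_cost]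
    unfolding runs_def body_prog c_joinsum_def
    by (simp add: step enc_pair_def)
qed

definition weight_of :: "(nat \<times> tree) list \<Rightarrow> nat \<Rightarrow> tree" where
  "weight_of W v = (case map_of W v of None \<Rightarrow> enc_cols UNIV | Some s \<Rightarrow> s)"

lemma runs_entry_Intro:
  assumes "length A \<le> Z" "length W \<le> Z" "size (enc_nat l) \<le> Z" "size (enc_nat v) \<le> Z"
    and "len (weight_of W v) \<le> Z"
  shows "runs f_entry (Node (enc_env enc_cols A) (Node (enc_cexpr (Intro l v))
      (Node X (Node (enc_env id W) (enc_nat r)))))
    (intro_entry (weight_of W) r v (states A l)) (t_entry Z)"
proof -
  have st: "runs f_assoc (Node (enc_nat l) (enc_env enc_cols A)) (enc_cols (states A l))
      (t_assoc Z Z)"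
    using runs_states[of l Z A] assms t_assoc_mono[of "length A" Z Z] by (auto elim: runs_mono)
  have w: "runs f_assoc (Node (enc_nat v) (enc_env id W)) (weight_of W v) (t_assoc Z Z)"
    using runs_assoc[of v Z id W] assms t_assoc_mono[of "length W" Z Z]
    by (auto elim: runs_mono simp: weight_of_def split: option.splits)
  note e = runs_equal_nat[of v]
  let ?m = "weight_of W v"
  note add = runs_padd[of "if Lft \<in> states A l then ?m else Leaf" "if Rgt \<in> states A l then ?m else Leaf"]
  note add2 = runs_padd[of "if Out \<in> states A l then Node (Node Leaf Leaf) Leaf else Leaf"
      "padd (if Lft \<in> states A l then ?m else Leaf) (if Rgt \<in> states A l then ?m else Leaf)"]
  note [simp] = runs_padd[THEN runs_eval]
  have "cost f_equal (Node (enc_nat v) (enc_nat r)) + 4 * Z \<le> t_assoc Z Z"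
    using e[of r, THEN runs_cost] assms by (simp add: t_assoc_def algebra_simps)
  then show ?thesis
    using st[THEN runs_cost] w[THEN runs_cost] add[THEN runs_cost] add2[THEN runs_cost] assms
    unfolding runs_def body_prog c_entry_def
    by (cases "r = v"; cases "Out \<in> states A l"; cases "Lft \<in> states A l"; cases "Rgt \<in> states A l")
      (simp_all add: step enc_tags w[THEN runs_eval] st[THEN runs_eval] e[THEN runs_eval],
       simp_all add: step enc_cols_def intro_entry_def t_entry_def)
qed

lemma runs_entry_DUnion:
  assumes "\<forall>l \<in> set D. size (enc_nat l) \<le> Z" "length D \<le> Z" "length A \<le> Z"
    and "\<And>S. len (look T1 D S) \<le> Z" "\<And>S. len (look T2 D S) \<le> Z"
  shows "runs f_entry (Node (enc_env enc_cols A) (Node (enc_cexpr (DUnion e1 e2))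
      (Node (Node (enc_list enc_nat D) (Node T1 T2)) wv)))
    (pmul (look T1 D (states A)) (look T2 D (states A))) (t_entry Z)"
proof -
  have look: "runs f_look (Node T (Node (enc_list enc_nat D) (enc_env enc_cols A)))
      (look T D (states A)) (t_look Z)" for T
    using assms by (intro runs_look) auto
  let ?p = "look T1 D (states A)" and ?q = "look T2 D (states A)"
  have mul: "runs f_mul (Node ?p ?q) (pmul ?p ?q) ((Z + 1) * (60 * Z + 120))"
    by (rule runs_mono[OF runs_pmul]) (use assms in \<open>intro mult_le_mono, auto\<close>)
  note [simp] = look[THEN runs_eval] mul[THEN runs_eval]
  have "(Z + 1) * (60 * Z + 120) + 1000 \<le> (Z + 1) * (60 * Z + 1200)"
    by (simp add: algebra_simps)
  then show ?thesis
    using look[of T1, THEN runs_cost] look[of T2, THEN runs_cost] mul[THEN runs_cost]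
    unfolding runs_def body_prog c_entry_def t_entry_def
    by (simp add: step enc_tags)
qed

lemma runs_entry_Relabel:
  assumes "\<forall>l \<in> set D. size (enc_nat l) \<le> Z" "length D \<le> Z" "length A \<le> Z"
    and "size (enc_nat j) \<le> Z"
  shows "runs f_entry (Node (enc_env enc_cols A) (Node (enc_cexpr (Relabel i j e))
      (Node (Node (enc_list enc_nat D) T) wv)))
    (look T D ((states A)(i := states A j))) (t_entry Z)"
proof -
  have look: "runs f_look (Node T (Node (enc_list enc_nat D)
      (Node (Node (enc_nat i) (enc_cols s)) (enc_env enc_cols A))))
      (look T D ((states A)(i := s))) (t_look Z)" for s
    using runs_look[of D Z "(i, s) # A" T] assms by (simp add: fun_upd_def)
  have st: "runs f_assoc (Node (enc_nat j) (enc_env enc_cols A)) (enc_cols (states A j))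
      (t_assoc Z Z)"
    using runs_states[of j Z A] assms t_assoc_mono[of "length A" Z Z] by (auto elim: runs_mono)
  note [simp] = look[THEN runs_eval] st[THEN runs_eval]
  show ?thesis
    using look[of "states A j", THEN runs_cost] st[THEN runs_cost]
    unfolding runs_def body_prog c_entry_def t_entry_def
    by (simp add: step enc_tags)
qed

lemma runs_entry_Join:
  assumes "\<forall>l \<in> set D. size (enc_nat l) \<le> Z" "length D \<le> Z" "length A \<le> Z"
    and "size (enc_nat i) \<le> Z" "size (enc_nat j) \<le> Z"
    and "\<And>S. len (look T D S) \<le> Z"
  shows "runs f_entry (Node (enc_env enc_cols A) (Node (enc_cexpr (Join i j e))
      (Node (Node (enc_list enc_nat D) T) wv)))
    (join_entry T D (states A) i j concepts) (t_entry Z)"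
proof -
  note j = runs_joinsum[OF assms, of concepts]
  note [simp] = j[THEN runs_eval]
  have "size (enc_list enc_pair concepts) + size (enc_list enc_pair concepts) + 100 \<le> 600"
    "length concepts = 12"
    by (simp_all add: concepts_def enc_pair_def size_enc_cols)
  then show ?thesis
    using j[THEN runs_cost]
    unfolding runs_def body_prog c_entry_def t_entry_def
    by (simp add: step enc_tags)
qed

definition t_node :: "nat \<Rightarrow> nat \<Rightarrow> nat" where
  "t_node Z \<kappa> = 6 ^ \<kappa> * (t_entry Z + 800) + 3 * t_assoc Z (Z + 1) + 1000"

text \<open>Every constructor contributes an inner node to the encoding, which pays for the table
  built there. The sets \<open>Lab\<close> and \<open>Ver\<close> stay fixed during the induction,
  because the live labels passed to a subexpression need not occur in it.\<close>

lemma runs_solve: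
  fixes Lab Ver :: "nat set"
  assumes Lab: "finite Lab" "card Lab \<le> \<kappa>" "card Lab \<le> Z" "\<forall>l \<in> Lab. size (enc_nat l) \<le> Z"
    and Ver: "\<forall>v \<in> Ver. size (enc_nat v) \<le> Z"
    and W: "length W \<le> Z"
  shows "clabels e \<subseteq> Lab \<Longrightarrow> cverts e \<subseteq> Ver \<Longrightarrow> set D \<subseteq> Lab \<Longrightarrow> distinct D \<Longrightarrow>
    plen (weight_of W) e \<le> Z \<Longrightarrow>
    runs f_solve (Node (enc_cexpr e) (Node (enc_list enc_nat D) (Node (enc_env id W) (enc_nat r))))
      (solve (weight_of W) r e D) (size (enc_cexpr e) * t_node Z \<kappa>)"
proof -
  have D: "length D \<le> \<kappa>" "length D \<le> Z" "\<forall>l \<in> set D. size (enc_nat l) \<le> Z"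
    if "set D \<subseteq> Lab" "distinct D" for D
    using that Lab card_mono[OF Lab(1), of "set D"] by (auto simp: distinct_card)
  have build: "runs f_build (Node (enc_list enc_nat D) (Node Leaf (Node (enc_cexpr e) (Node X
      (Node (enc_env id W) (enc_nat r)))))) (build D (\<lambda>_. UNIV) f) (6 ^ \<kappa> * (t_entry Z + 800))"
    if "set D \<subseteq> Lab" "distinct D" and
      "\<And>A. length A \<le> Z \<Longrightarrow> runs f_entry (Node (enc_env enc_cols A) (Node (enc_cexpr e) (Node X
      (Node (enc_env id W) (enc_nat r))))) (f (states A)) (t_entry Z)" for D e X f
    by (rule runs_mono[OF runs_build[OF that(3) D(2)]]) (use D that in auto)
  show "clabels e \<subseteq> Lab \<Longrightarrow> cverts e \<subseteq> Ver \<Longrightarrow> set D \<subseteq> Lab \<Longrightarrow> distinct D \<Longrightarrow>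
    plen (weight_of W) e \<le> Z \<Longrightarrow>
    runs f_solve (Node (enc_cexpr e) (Node (enc_list enc_nat D) (Node (enc_env id W) (enc_nat r))))
      (solve (weight_of W) r e D) (size (enc_cexpr e) * t_node Z \<kappa>)"
  proof (induction e arbitrary: D)
    case (Intro l v)
    have b: "runs f_build (Node (enc_list enc_nat D) (Node Leaf (Node (enc_cexpr (Intro l v))
        (Node (Node Leaf Leaf) (Node (enc_env id W) (enc_nat r))))))
        (solve (weight_of W) r (Intro l v) D) (6 ^ \<kappa> * (t_entry Z + 800))"
      unfolding solve.simps
      using Intro.prems Lab Ver W by (intro build runs_entry_Intro) auto
    note [simp] = b[unfolded enc_cexpr.simps enc_tags, THEN runs_eval]
    have "t_node Z \<kappa> \<le> size (enc_cexpr (Intro l v)) * t_node Z \<kappa>"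
      by simp
    then show ?case
      using b[unfolded enc_cexpr.simps enc_tags, THEN runs_cost]
      unfolding runs_def body_prog c_solve_def t_node_def
      by (simp add: step enc_tags del: solve.simps)
  next
    case (DUnion e1 e2)
    let ?T1 = "solve (weight_of W) r e1 D" and ?T2 = "solve (weight_of W) r e2 D"
    have b: "runs f_build (Node (enc_list enc_nat D) (Node Leaf (Node (enc_cexpr (DUnion e1 e2))
        (Node (Node (enc_list enc_nat D) (Node ?T1 ?T2)) (Node (enc_env id W) (enc_nat r))))))
        (solve (weight_of W) r (DUnion e1 e2) D) (6 ^ \<kappa> * (t_entry Z + 800))"
      unfolding solve.simps
      using DUnion.prems D[of D]
      by (intro build runs_entry_DUnion order.trans[OF len_look_solve]) auto
    have 1: "runs f_solve (Node (enc_cexpr e1) (Node (enc_list enc_nat D) (Node (enc_env id W) (enc_nat r))))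
      ?T1 (size (enc_cexpr e1) * t_node Z \<kappa>)"
      using DUnion.prems by (intro DUnion.IH) auto
    have 2: "runs f_solve (Node (enc_cexpr e2) (Node (enc_list enc_nat D) (Node (enc_env id W) (enc_nat r))))
      ?T2 (size (enc_cexpr e2) * t_node Z \<kappa>)"
      using DUnion.prems by (intro DUnion.IH) auto
    note [simp] = b[unfolded enc_cexpr.simps enc_tags, THEN runs_eval] 1[THEN runs_eval] 2[THEN runs_eval]
    have "size (enc_cexpr e1) * t_node Z \<kappa> + size (enc_cexpr e2) * t_node Z \<kappa> + t_node Z \<kappa>
      \<le> size (enc_cexpr (DUnion e1 e2)) * t_node Z \<kappa>"
      by (simp add: algebra_simps)
    moreover have "6 ^ \<kappa> * (t_entry Z + 800) + 1000 \<le> t_node Z \<kappa>"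
      by (simp add: t_node_def)
    ultimately show ?case
      using b[unfolded enc_cexpr.simps enc_tags, THEN runs_cost] 1[THEN runs_cost] 2[THEN runs_cost]
      unfolding runs_def body_prog c_solve_def
      by (simp add: step enc_tags del: solve.simps)
  next
    case (Relabel i j e)
    let ?D = "live_relabel i j D"
    let ?T = "solve (weight_of W) r e ?D"
    have D': "set ?D \<subseteq> Lab" "distinct ?D"
      using Relabel.prems by (auto simp: live_relabel_def distinct_removeAll)
    have b: "runs f_build (Node (enc_list enc_nat D) (Node Leaf (Node (enc_cexpr (Relabel i j e))
        (Node (Node (enc_list enc_nat ?D) ?T) (Node (enc_env id W) (enc_nat r))))))
        (solve (weight_of W) r (Relabel i j e) D) (6 ^ \<kappa> * (t_entry Z + 800))"
      unfolding solve.simps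
      using Relabel.prems D[OF D'] Lab by (intro build runs_entry_Relabel) auto
    have 1: "runs f_solve (Node (enc_cexpr e) (Node (enc_list enc_nat ?D) (Node (enc_env id W) (enc_nat r))))
      ?T (size (enc_cexpr e) * t_node Z \<kappa>)"
      using Relabel.prems D' by (intro Relabel.IH) auto
    have len: "t_assoc Z (length D) \<le> t_assoc Z (Z + 1)"
      using D[of D] Relabel.prems by (intro t_assoc_mono) auto
    have ij: "size (enc_nat i) \<le> Z" "size (enc_nat j) \<le> Z"
      using Relabel.prems Lab by auto
    note m = runs_member[OF ij(2), of D] and rem = runs_remove[OF ij(1), of D]
    have size: "size (enc_cexpr e) * t_node Z \<kappa> + t_node Z \<kappa>
      \<le> size (enc_cexpr (Relabel i j e)) * t_node Z \<kappa>"
      by (simp add: algebra_simps)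
    show ?case
    proof (cases "j \<in> set D")
      case True
      then have live: "?D = i # removeAll i D" by (simp add: live_relabel_def)
      note b = b[unfolded enc_cexpr.simps enc_tags live enc_list.simps]
        and 1 = 1[unfolded live enc_list.simps]
      note [simp] = b[THEN runs_eval] 1[THEN runs_eval] m[THEN runs_eval] rem[THEN runs_eval]
      show ?thesis
        using b[THEN runs_cost] 1[THEN runs_cost] m[THEN runs_cost] rem[THEN runs_cost] len size True
        unfolding runs_def body_prog c_solve_def t_node_def
        by (simp add: step enc_tags del: solve.simps)
    next
      case False
      then have live: "?D = removeAll i D" by (simp add: live_relabel_def)
      note b = b[unfolded enc_cexpr.simps enc_tags live] and 1 = 1[unfolded live]
      note [simp] = b[THEN runs_eval] 1[THEN runs_eval] m[THEN runs_eval] rem[THEN runs_eval]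
      show ?thesis
        using b[THEN runs_cost] 1[THEN runs_cost] m[THEN runs_cost] rem[THEN runs_cost] len size False
        unfolding runs_def body_prog c_solve_def t_node_def
        by (simp add: step enc_tags del: solve.simps)
    qed
  next
    case (Join i j e)
    let ?D = "live_join i j D"
    let ?T = "solve (weight_of W) r e ?D"
    have D': "set ?D \<subseteq> Lab" "distinct ?D"
      using Join.prems by (auto simp: live_join_def distinct_removeAll)
    have b: "runs f_build (Node (enc_list enc_nat D) (Node Leaf (Node (enc_cexpr (Join i j e))
        (Node (Node (enc_list enc_nat ?D) ?T) (Node (enc_env id W) (enc_nat r))))))
        (solve (weight_of W) r (Join i j e) D) (6 ^ \<kappa> * (t_entry Z + 800))"
      unfolding solve.simps
      using Join.prems D[OF D'] Lab
      by (intro build runs_entry_Join order.trans[OF len_look_solve]) auto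
    have 1: "runs f_solve (Node (enc_cexpr e) (Node (enc_list enc_nat ?D) (Node (enc_env id W) (enc_nat r))))
      ?T (size (enc_cexpr e) * t_node Z \<kappa>)"
      using Join.prems D' by (intro Join.IH) auto
    have ij: "size (enc_nat i) \<le> Z" "size (enc_nat j) \<le> Z"
      using Join.prems Lab by auto
    define E where "E = removeAll j D"
    define F where "F = removeAll i (j # E)"
    have live: "?D = i # F" by (simp only: live_join_def E_def F_def)
    have rem1: "runs f_remove (Node (enc_nat j) (enc_list enc_nat D)) (enc_list enc_nat E) (t_assoc Z (Z + 1))"
      unfolding E_def using D[of D] Join.prems
      by (intro runs_mono[OF runs_remove[OF ij(2)]] t_assoc_mono) auto
    have "length E \<le> Z" unfolding E_def using D[of D] Join.prems
      by (meson le_trans length_removeAll_less_eq)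
    then have rem2: "runs f_remove (Node (enc_nat i) (Node (enc_nat j) (enc_list enc_nat E)))
        (enc_list enc_nat F) (t_assoc Z (Z + 1))"
      using runs_mono[OF runs_remove[OF ij(1), of "j # E"] t_assoc_mono, of "Z + 1"]
      by (simp add: F_def)
    note b = b[unfolded enc_cexpr.simps enc_tags live enc_list.simps]
      and 1 = 1[unfolded live enc_list.simps]
    note [simp] = b[THEN runs_eval] 1[THEN runs_eval] rem1[THEN runs_eval] rem2[THEN runs_eval]
    have "size (enc_cexpr e) * t_node Z \<kappa> + t_node Z \<kappa>
      \<le> size (enc_cexpr (Join i j e)) * t_node Z \<kappa>"
      by (simp add: algebra_simps)
    then show ?case
      using b[THEN runs_cost] 1[THEN runs_cost] rem1[THEN runs_cost] rem2[THEN runs_cost]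
      unfolding runs_def body_prog c_solve_def t_node_def
      by (simp add: step enc_tags del: solve.simps)
  qed
qed

subsection \<open>Weights, coin tosses and the main function\<close>

text \<open>Least significant first: the random bits, then \<open>a + 1\<close> zeros, then the
  cost. With \<open>a + 1\<close> random bits the cost is shifted by \<open>2 a + 2\<close> places,
  and the zeros leave room for adding up the random parts of at most 2 ^ a vertices.\<close>

definition weight_bits :: "(nat \<Rightarrow> nat) \<Rightarrow> nat \<Rightarrow> nat \<Rightarrow> bool list \<Rightarrow> bool list" where
  "weight_bits c a v bs = bs @ replicate a False @ False # bits (c v)"

definition weights :: "(nat \<Rightarrow> nat) \<Rightarrow> nat \<Rightarrow> nat list \<Rightarrow> bool list list \<Rightarrow> (nat \<times> tree) list" where
  "weights c a vs \<omega> = map (\<lambda>(v, bs). (v, pmono (weight_bits c a v bs))) (zip vs \<omega>)"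

abbreviation enc_costs :: "(nat \<Rightarrow> nat) \<Rightarrow> nat list \<Rightarrow> tree" where
  "enc_costs c \<equiv> enc_list (\<lambda>v. Node (enc_nat v) (enc_nat (c v)))"

lemma runs_weights:
  assumes "length \<omega> = length vs" "\<And>v bs. v \<in> set vs \<Longrightarrow> bs \<in> set \<omega> \<Longrightarrow> length (weight_bits c a v bs) \<le> H"
  shows "runs f_weights (Node (enc_costs c vs) (Node (enc_list enc_bits \<omega>) (zeros a)))
    (enc_env id (weights c a vs \<omega>)) ((length vs + 1) * (100 * 2 ^ (H + 1) + 60 * H + 300))"
  using assms
proof (induction vs arbitrary: \<omega>)
  case Nil
  then show ?case unfolding runs_def body_prog c_weights_def by (auto simp: step weights_def)
next
  case (Cons v vs)
  then obtain bs \<omega>' where [simp]: "\<omega> = bs # \<omega>'" by (cases \<omega>) auto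
  have IH: "runs f_weights (Node (enc_costs c vs) (Node (enc_list enc_bits \<omega>') (zeros a)))
    (enc_env id (weights c a vs \<omega>')) ((length vs + 1) * (100 * 2 ^ (H + 1) + 60 * H + 300))"
    using Cons.prems by (intro Cons.IH) auto
  have a1: "runs f_append (Node (zeros a) (Node Leaf (enc_nat (c v))))
      (enc_bits (replicate a False @ False # bits (c v))) (30 * a + 30)"
    using runs_append[of enc_bool "replicate a False" "False # bits (c v)"] by (simp add: bits)
  have a2: "runs f_append (Node (enc_bits bs) (enc_bits (replicate a False @ False # bits (c v))))
      (enc_bits (weight_bits c a v bs)) (30 * length bs + 30)"
    unfolding weight_bits_def by (rule runs_append)
  have H: "length (weight_bits c a v bs) \<le> H"
    using Cons.prems by simp
  have m: "runs f_mono (enc_bits (weight_bits c a v bs)) (pmono (weight_bits c a v bs))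
      (100 * 2 ^ (H + 1))"
    by (rule runs_mono[OF runs_pmono]) (use H in \<open>auto intro!: power_increasing\<close>)
  note [simp] = IH[THEN runs_eval] a1[THEN runs_eval] a2[THEN runs_eval] m[THEN runs_eval]
  have "length bs + a \<le> H" using H by (simp add: weight_bits_def)
  then show ?case
    using IH[THEN runs_cost] a1[THEN runs_cost] a2[THEN runs_cost] m[THEN runs_cost]
    unfolding runs_def body_prog c_weights_def by (simp add: step weights_def)
qed

lemma runs_search:
  fixes Lab Ver :: "nat set"
  assumes Lab: "finite Lab" "card Lab \<le> \<kappa>" "card Lab \<le> Z" "\<forall>l \<in> Lab. size (enc_nat l) \<le> Z"
    and Ver: "\<forall>v \<in> Ver. size (enc_nat v) \<le> Z"
    and W: "length W \<le> Z" "plen (weight_of W) \<mu> \<le> Z"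
    and \<mu>: "clabels \<mu> \<subseteq> Lab" "cverts \<mu> \<subseteq> Ver"
    and cnt: "length cnt \<le> Z"
  shows "runs f_search (Node (enc_costs c vs) (Node (enc_cexpr \<mu>) (Node (enc_env id W) (enc_bits cnt))))
    (enc_bool (\<exists>v \<in> set vs. pcheck (solve (weight_of W) v \<mu> []) (val cnt)))
    ((length vs + 1) * (size (enc_cexpr \<mu>) * t_node Z \<kappa> + (Z + 1) * (30 * Z + 80) + 200))"
proof (induction vs)
  case Nil
  then show ?case unfolding runs_def body_prog c_search_def by (auto simp: step)
next
  case (Cons v vs)
  let ?T = "solve (weight_of W) v \<mu> []"
  have s: "runs f_solve (Node (enc_cexpr \<mu>) (Node Leaf (Node (enc_env id W) (enc_nat v))))
      ?T (size (enc_cexpr \<mu>) * t_node Z \<kappa>)"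
    using runs_solve[OF Lab Ver W(1) \<mu>, of "[]"] W by simp
  have "len ?T \<le> Z"
    using len_look_solve[of "weight_of W" v \<mu> "[]"] W by simp
  then have ch: "runs f_check (Node ?T (enc_bits cnt)) (enc_bool (pcheck ?T (val cnt)))
      ((Z + 1) * (30 * Z + 80))"
    by (intro runs_mono[OF runs_check[OF cnt]] mult_le_mono) auto
  note [simp] = Cons.IH[THEN runs_eval] s[THEN runs_eval] ch[THEN runs_eval]
  show ?case
    using Cons.IH[THEN runs_cost] s[THEN runs_cost] ch[THEN runs_cost]
    unfolding runs_def body_prog c_search_def
    by (cases "pcheck ?T (val cnt)") (simp_all add: step)
qed

section \<open>Coin tosses as uniformly distributed lists\<close>

definition nlists :: "nat \<Rightarrow> 'a set \<Rightarrow> 'a list set" where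
  "nlists n A = {xs. set xs \<subseteq> A \<and> length xs = n}"

lemma nlists_0 [simp]: "nlists 0 A = {[]}"
  by (auto simp: nlists_def)

lemma nlists_Suc: "nlists (Suc n) A = (\<lambda>(x, xs). x # xs) ` (A \<times> nlists n A)"
  by (force simp: nlists_def length_Suc_conv)

lemma finite_nlists: "finite A \<Longrightarrow> finite (nlists n A)"
  unfolding nlists_def by (rule finite_lists_length_eq)

lemma card_nlists: "finite A \<Longrightarrow> card (nlists n A) = card A ^ n"
  unfolding nlists_def by (rule card_lists_length_eq)

lemma nlists_ne: "A \<noteq> {} \<Longrightarrow> nlists n A \<noteq> {}"
  by (induction n) (auto simp: nlists_Suc)

lemma pair_spmf_of_set:
  assumes "finite A" "finite B" "A \<noteq> {}" "B \<noteq> {}"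
  shows "pair_spmf (spmf_of_set A) (spmf_of_set B) = spmf_of_set (A \<times> B)"
  by (rule spmf_eqI) (auto simp: spmf_of_set spmf_pair card_cartesian_product indicator_def split: prod.splits)

text \<open>Independent uniform heads and tails form a uniform list. By this rule the single coin
  tosses of a run collapse into one uniform draw.\<close>

lemma bind_uniform_Cons:
  assumes "finite A" "A \<noteq> {}"
  shows "bind_spmf (spmf_of_set A) (\<lambda>x. bind_spmf (spmf_of_set (nlists n A)) (\<lambda>xs. g (x # xs))) =
    bind_spmf (spmf_of_set (nlists (Suc n) A)) g"
proof -
  have "spmf_of_set (nlists (Suc n) A) = map_spmf (\<lambda>(x, xs). x # xs) (spmf_of_set (A \<times> nlists n A))"
    unfolding nlists_Suc by (rule map_spmf_of_set_inj_on[symmetric]) (auto simp: inj_on_def)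
  also have "spmf_of_set (A \<times> nlists n A) = pair_spmf (spmf_of_set A) (spmf_of_set (nlists n A))"
    using assms by (simp add: pair_spmf_of_set finite_nlists nlists_ne)
  finally show ?thesis
    by (simp add: bind_map_spmf pair_spmf_alt_def o_def)
qed

text \<open>The number of steps is the same for all outcomes of the coins, so it can be chosen
  before the draw.\<close>

lemma eval_bits: "\<exists>t. t \<le> 20 * n + 20 \<and> eval prog [zeros n] (body prog f_bits) =
  bind_spmf (spmf_of_set (nlists (Suc n) UNIV)) (\<lambda>bs. return_spmf (enc_bits bs, t))"
proof (induction n)
  case 0
  have "eval prog [zeros 0] (body prog f_bits) =
    bind_spmf (spmf_of_set UNIV) (\<lambda>r. bind_spmf (spmf_of_set (nlists 0 UNIV))
      (\<lambda>bs. return_spmf (enc_bits (r # bs), 5)))"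
    unfolding body_prog c_bits_def by (simp add: step spmf_of_set_singleton eval_nat_numeral)
  also have "\<dots> = bind_spmf (spmf_of_set (nlists (Suc 0) UNIV)) (\<lambda>bs. return_spmf (enc_bits bs, 5))"
    by (rule bind_uniform_Cons) auto
  finally show ?case by (intro exI[of _ 5]) simp
next
  case (Suc n)
  then obtain t where t: "t \<le> 20 * n + 20" and [simp]: "eval prog [zeros n] (body prog f_bits) =
    bind_spmf (spmf_of_set (nlists (Suc n) UNIV)) (\<lambda>bs. return_spmf (enc_bits bs, t))" by blast
  have "eval prog [zeros (Suc n)] (body prog f_bits) =
    bind_spmf (spmf_of_set UNIV) (\<lambda>r. bind_spmf (spmf_of_set (nlists (Suc n) UNIV))
      (\<lambda>bs. return_spmf (enc_bits (r # bs), t + 7)))"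
    unfolding body_prog c_bits_def by (simp add: step eval_nat_numeral)
  also have "\<dots> = bind_spmf (spmf_of_set (nlists (Suc (Suc n)) UNIV)) (\<lambda>bs. return_spmf (enc_bits bs, t + 7))"
    by (rule bind_uniform_Cons) auto
  finally show ?case using t by (intro exI[of _ "t + 7"]) simp
qed

lemma eval_tape: "\<exists>t. t \<le> (len x + 1) * (20 * a + 100) \<and> eval prog [Node x (zeros a)] (body prog f_tape) =
  bind_spmf (spmf_of_set (nlists (len x) (nlists (Suc a) UNIV))) (\<lambda>\<omega>. return_spmf (enc_list enc_bits \<omega>, t))"
proof (induction x)
  case Leaf
  show ?case unfolding body_prog c_tape_def
    by (intro exI[of _ 4]) (simp add: step spmf_of_set_singleton)
next
  case (Node b x)
  then obtain t where t: "t \<le> (len x + 1) * (20 * a + 100)" and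
    [simp]: "eval prog [Node x (zeros a)] (body prog f_tape) =
  bind_spmf (spmf_of_set (nlists (len x) (nlists (Suc a) UNIV))) (\<lambda>\<omega>. return_spmf (enc_list enc_bits \<omega>, t))"
    by blast
  obtain s where s: "s \<le> 20 * a + 20" and [simp]: "eval prog [zeros a] (body prog f_bits) =
    bind_spmf (spmf_of_set (nlists (Suc a) UNIV)) (\<lambda>bs. return_spmf (enc_bits bs, s))"
    using eval_bits by blast
  have "eval prog [Node (Node b x) (zeros a)] (body prog f_tape) =
    bind_spmf (spmf_of_set (nlists (Suc a) UNIV)) (\<lambda>bs.
      bind_spmf (spmf_of_set (nlists (len x) (nlists (Suc a) UNIV)))
      (\<lambda>\<omega>. return_spmf (enc_list enc_bits (bs # \<omega>), s + t + 14)))"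
    unfolding body_prog c_tape_def by (simp add: step eval_nat_numeral)
  then show ?case using s t
    by (subst (asm) bind_uniform_Cons)
      (auto simp: finite_nlists nlists_ne intro!: exI[of _ "s + t + 14"])
qed

text \<open>The answer as a function of the tape, so that error probabilities become ratios of
  cardinalities.\<close>

definition accepts :: "nat cexpr \<Rightarrow> (nat \<Rightarrow> nat) \<Rightarrow> nat \<Rightarrow> nat list \<Rightarrow> bool list list \<Rightarrow> bool" where
  "accepts \<mu> c b vs \<omega> = (let a = bitlen (length vs) in \<exists>v \<in> set vs.
    pcheck (solve (weight_of (weights c a vs \<omega>)) v \<mu> [])
      (val (replicate a False @ replicate a False @ False # True # bits b)))"

definition t_main :: "nat \<Rightarrow> nat \<Rightarrow> nat \<Rightarrow> nat \<Rightarrow> nat" where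
  "t_main H Z \<kappa> I = 60 * (Z + 1)^2 + (Z + 1) * (20 * Z + 100) +
    (Z + 1) * (100 * 2 ^ (H + 1) + 60 * H + 300) +
    (Z + 1) * (I * t_node Z \<kappa> + (Z + 1) * (30 * Z + 80) + 200) + 60 * Z + 1000"

text \<open>All coins are tossed by \<open>c_tape\<close> before anything depends on them. A run is
  therefore a uniform draw of a tape followed by a deterministic computation.\<close>

lemma eval_main:
  fixes Lab :: "nat set" and vs :: "nat list"
  defines "\<Omega> \<equiv> nlists (length vs) (nlists (Suc (bitlen (length vs))) UNIV)"
  defines "a \<equiv> bitlen (length vs)"
  assumes Lab: "finite Lab" "card Lab \<le> \<kappa>" "card Lab \<le> Z" "\<forall>l \<in> Lab. size (enc_nat l) \<le> Z"
    and Ver: "\<forall>v \<in> cverts \<mu>. size (enc_nat v) \<le> Z"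
    and \<mu>: "clabels \<mu> \<subseteq> Lab"
    and vs: "length vs \<le> Z"
    and W: "\<And>\<omega>. \<omega> \<in> \<Omega> \<Longrightarrow> plen (weight_of (weights c a vs \<omega>)) \<mu> \<le> Z"
    and b: "2 * a + 2 + bitlen b \<le> Z"
    and H: "\<And>v. v \<in> set vs \<Longrightarrow> 2 * a + 2 + bitlen (c v) \<le> H"
  shows "\<exists>t. (\<forall>\<omega> \<in> \<Omega>. t \<omega> \<le> t_main H Z \<kappa> (size (enc_cexpr \<mu>))) \<and>
    eval prog [Node (enc_cexpr \<mu>) (Node (enc_costs c vs) (enc_nat b))] (body prog f_main) =
    bind_spmf (spmf_of_set \<Omega>) (\<lambda>\<omega>. return_spmf (enc_bool (accepts \<mu> c b vs \<omega>), t \<omega>))"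
proof -
  have lg: "runs f_lg (enc_costs c vs) (zeros a) (60 * (Z + 1) ^ 2)"
    using runs_lg[of "enc_costs c vs"] vs
    by (auto simp: a_def elim!: runs_mono intro!: power_mono)
  obtain s where s: "s \<le> (length vs + 1) * (20 * a + 100)" and
    tape: "eval prog [Node (enc_costs c vs) (zeros a)] (body prog f_tape) =
      bind_spmf (spmf_of_set \<Omega>) (\<lambda>\<omega>. return_spmf (enc_list enc_bits \<omega>, s))"
    using eval_tape[of "enc_costs c vs" a] by (auto simp: \<Omega>_def a_def)
  have "a \<le> Z" using b by simp
  have "(length vs + 1) * (20 * a + 100) \<le> (Z + 1) * (20 * Z + 100)"
    using vs \<open>a \<le> Z\<close> by (intro mult_le_mono) auto
  with s have s': "s \<le> (Z + 1) * (20 * Z + 100)" by (rule le_trans)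
  let ?cnt = "replicate a False @ replicate a False @ False # True # bits b"
  have a1: "runs f_append (Node (zeros a) (Node Leaf (Node (Node Leaf Leaf) (enc_nat b))))
      (enc_bits (replicate a False @ False # True # bits b)) (30 * a + 30)"
    using runs_append[of enc_bool "replicate a False" "False # True # bits b"] by (simp add: bits)
  have a2: "runs f_append (Node (zeros a) (enc_bits (replicate a False @ False # True # bits b)))
      (enc_bits ?cnt) (30 * a + 30)"
    using runs_append[of enc_bool "replicate a False" "replicate a False @ False # True # bits b"] by simp
  have w: "runs f_weights (Node (enc_costs c vs) (Node (enc_list enc_bits \<omega>) (zeros a)))
    (enc_env id (weights c a vs \<omega>)) ((Z + 1) * (100 * 2 ^ (H + 1) + 60 * H + 300))" if "\<omega> \<in> \<Omega>" for \<omega>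
  proof (rule runs_mono[OF runs_weights])
    show "length \<omega> = length vs" using that by (simp add: \<Omega>_def nlists_def)
    show "length (weight_bits c a v bs) \<le> H" if "v \<in> set vs" "bs \<in> set \<omega>" for v bs
      using that H[of v] \<open>\<omega> \<in> \<Omega>\<close> by (auto simp: weight_bits_def bits \<Omega>_def nlists_def a_def)
  qed (use vs in auto)
  have search: "runs f_search (Node (enc_costs c vs) (Node (enc_cexpr \<mu>)
      (Node (enc_env id (weights c a vs \<omega>)) (enc_bits ?cnt))))
    (enc_bool (accepts \<mu> c b vs \<omega>))
    ((Z + 1) * (size (enc_cexpr \<mu>) * t_node Z \<kappa> + (Z + 1) * (30 * Z + 80) + 200))" if "\<omega> \<in> \<Omega>" for \<omega>
    unfolding accepts_def Let_def a_def[symmetric]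
  proof (rule runs_mono[OF runs_search[where Lab = Lab and Ver = "cverts \<mu>"]])
    show "length (weights c a vs \<omega>) \<le> Z" using vs by (simp add: weights_def)
    show "length ?cnt \<le> Z" using b by (simp add: bits)
  qed (use Lab Ver \<mu> W[OF that] vs in \<open>auto intro!: mult_le_mono\<close>)
  \<comment> \<open>The summand 44 counts the steps of \<open>c_main\<close> itself, outside of the
    calls.\<close>
  define t where "t \<omega> = cost f_lg (enc_costs c vs) + s +
    cost f_weights (Node (enc_costs c vs) (Node (enc_list enc_bits \<omega>) (zeros a))) +
    cost f_append (Node (zeros a) (Node Leaf (Node (Node Leaf Leaf) (enc_nat b)))) +
    cost f_append (Node (zeros a) (enc_bits (replicate a False @ False # True # bits b))) +
    cost f_search (Node (enc_costs c vs) (Node (enc_cexpr \<mu>)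
      (Node (enc_env id (weights c a vs \<omega>)) (enc_bits ?cnt)))) + 44" for \<omega>
  have "t \<omega> \<le> t_main H Z \<kappa> (size (enc_cexpr \<mu>))" if "\<omega> \<in> \<Omega>" for \<omega>
    using lg[THEN runs_cost] s' w[OF that, THEN runs_cost] a1[THEN runs_cost] a2[THEN runs_cost]
      search[OF that, THEN runs_cost] \<open>a \<le> Z\<close>
    unfolding t_def t_main_def by linarith
  moreover have "finite \<Omega>" by (simp add: \<Omega>_def finite_nlists)
  then have "eval prog [Node (enc_cexpr \<mu>) (Node (enc_costs c vs) (enc_nat b))] (body prog f_main) =
    bind_spmf (spmf_of_set \<Omega>) (\<lambda>\<omega>. return_spmf (enc_bool (accepts \<mu> c b vs \<omega>), t \<omega>))"
    unfolding body_prog c_main_def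
    by (simp add: step lg[THEN runs_eval] tape a1[THEN runs_eval] a2[THEN runs_eval])
      (rule bind_spmf_cong[OF refl],
        simp add: w[THEN runs_eval] search[THEN runs_eval] t_def)
  ultimately show ?thesis by blast
qed

section \<open>Counting consistent cuts\<close>

definition compat :: "color \<Rightarrow> color \<Rightarrow> bool" where
  "compat a b \<longleftrightarrow> (a, b) \<in> {(Out, Lft), (Out, Rgt), (Lft, Out), (Rgt, Out), (Lft, Lft), (Rgt, Rgt)}"

lemma compat_sym: "compat a b \<longleftrightarrow> compat b a"
  by (auto simp: compat_def)

text \<open>The condition on \<open>r\<close> is void for subexpressions without \<open>r\<close>,
  which lets the count factor at a union.\<close>

definition colorings :: "nat \<Rightarrow> nat cexpr \<Rightarrow> (nat \<Rightarrow> color set) \<Rightarrow> (nat \<Rightarrow> color) set" where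
  "colorings r e S = {\<phi> \<in> cverts e \<rightarrow>\<^sub>E UNIV. (\<forall>l. \<forall>v \<in> lverts e l. \<phi> v \<in> S l) \<and>
    (\<forall>(u, v) \<in> cedges e. compat (\<phi> u) (\<phi> v)) \<and> (r \<in> cverts e \<longrightarrow> \<phi> r = Lft)}"

definition cut_monom :: "(nat \<Rightarrow> nat) \<Rightarrow> nat set \<Rightarrow> (nat \<Rightarrow> color) \<Rightarrow> bit poly" where
  "cut_monom w V \<phi> = (\<Prod>v\<in>V. if \<phi> v = Out then 1 else monom 1 (w v))"

definition cut_poly :: "(nat \<Rightarrow> nat) \<Rightarrow> nat \<Rightarrow> nat cexpr \<Rightarrow> (nat \<Rightarrow> color set) \<Rightarrow> bit poly" where
  "cut_poly w r e S = (\<Sum>\<phi> \<in> colorings r e S. cut_monom w (cverts e) \<phi>)"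

lemma finite_colorings: "finite (colorings r e S)"
proof (rule finite_subset)
  show "colorings r e S \<subseteq> cverts e \<rightarrow>\<^sub>E UNIV" by (auto simp: colorings_def)
qed (simp add: finite_PiE finite_cverts)

lemma colD:
  assumes "\<phi> \<in> colorings r e S"
  shows "v \<in> lverts e l \<Longrightarrow> \<phi> v \<in> S l" "(u, v) \<in> cedges e \<Longrightarrow> compat (\<phi> u) (\<phi> v)"
    "r \<in> cverts e \<Longrightarrow> \<phi> r = Lft"
  using assms unfolding colorings_def by blast+

section \<open>Recurrences for the cut polynomial along the expression\<close>

lemma cut_poly_Intro:
  assumes "pol (m v) = monom 1 (w v)"
  shows "cut_poly w r (Intro l v) S = pol (intro_entry m r v (S l))"
proof -
  define C where "C = {c. c \<in> S l \<and> (v = r \<longrightarrow> c = Lft)}"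
  have "colorings r (Intro l v) S = (\<lambda>c. \<lambda>x\<in>{v}. c) ` C"
  proof (intro equalityI subsetI)
    fix \<phi> assume "\<phi> \<in> colorings r (Intro l v) S"
    then have "\<phi> = (\<lambda>x\<in>{v}. \<phi> v)" "\<phi> v \<in> C"
      by (auto simp: colorings_def C_def PiE_def extensional_def fun_eq_iff)
    then show "\<phi> \<in> (\<lambda>c. \<lambda>x\<in>{v}. c) ` C" by blast
  qed (auto simp: colorings_def C_def split: if_splits)
  moreover have "inj_on (\<lambda>c. \<lambda>x\<in>{v}. c :: color) C"
    by (rule inj_onI) (metis restrict_apply' singletonI)
  ultimately have "cut_poly w r (Intro l v) S = (\<Sum>c\<in>C. if c = Out then 1 else monom 1 (w v))"
    by (simp add: cut_poly_def sum.reindex cut_monom_def)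
  also have "\<dots> = (\<Sum>c\<in>UNIV. if c \<in> C then if c = Out then 1 else monom 1 (w v) else 0)"
    by (simp add: sum.If_cases)
  also have "\<dots> = pol (intro_entry m r v (S l))"
    using assms by (auto simp: UNIV_color C_def intro_entry_def pol_padd one_pCons)
  finally show ?thesis .
qed

text \<open>Colorings of the union are pairs of colorings of the two parts, by gluing and
  restricting: upper bounds, edges and the condition on \<open>r\<close> all split. The monomials
  multiply as the vertex sets are disjoint.\<close>

lemma cut_poly_DUnion:
  assumes "cverts e1 \<inter> cverts e2 = {}"
  shows "cut_poly w r (DUnion e1 e2) S = cut_poly w r e1 S * cut_poly w r e2 S"
proof -
  let ?A = "cverts e1" and ?B = "cverts e2"
  let ?glue = "\<lambda>(f, g) x. if x \<in> ?A then f x else if x \<in> ?B then g x else (undefined :: color)"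
  have "cut_poly w r e1 S * cut_poly w r e2 S =
    (\<Sum>(f, g) \<in> colorings r e1 S \<times> colorings r e2 S. cut_monom w ?A f * cut_monom w ?B g)"
    by (simp add: cut_poly_def sum_product sum.cartesian_product)
  also have "\<dots> = cut_poly w r (DUnion e1 e2) S"
    unfolding cut_poly_def
  proof (rule sum.reindex_bij_witness[where i = "\<lambda>\<phi>. (restrict \<phi> ?A, restrict \<phi> ?B)" and j = ?glue])
    fix p assume p: "p \<in> colorings r e1 S \<times> colorings r e2 S"
    obtain f g where [simp]: "p = (f, g)" by force
    have fg: "f \<in> colorings r e1 S" "g \<in> colorings r e2 S" using p by auto
    have A: "?glue p x = f x" if "x \<in> ?A" for x using that by simp
    have B: "?glue p x = g x" if "x \<in> ?B" for x using that assms by auto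
    have "restrict (?glue p) ?A = f" "restrict (?glue p) ?B = g"
      using fg A B by (auto simp: colorings_def PiE_def extensional_def fun_eq_iff)
    then show "(restrict (?glue p) ?A, restrict (?glue p) ?B) = p" by simp
    show "?glue p \<in> colorings r (DUnion e1 e2) S"
      unfolding colorings_def mem_Collect_eq
    proof (intro conjI allI ballI)
      show "?glue p \<in> cverts (DUnion e1 e2) \<rightarrow>\<^sub>E UNIV" by (auto simp: PiE_def extensional_def)
      show "?glue p v \<in> S l" if "v \<in> lverts (DUnion e1 e2) l" for l v
      proof (cases "v \<in> lverts e1 l")
        case True
        then have "v \<in> ?A" using lverts_subset[of e1 l] by blast
        then show ?thesis using A[of v] colD(1)[OF fg(1) True] by simp
      next
        case False
        then have "v \<in> lverts e2 l" using that by simp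
        moreover from this have "v \<in> ?B" using lverts_subset[of e2 l] by blast
        ultimately show ?thesis using B[of v] colD(1)[OF fg(2)] by simp
      qed
      show "case uv of (u, v) \<Rightarrow> compat (?glue p u) (?glue p v)" if "uv \<in> cedges (DUnion e1 e2)" for uv
      proof -
        obtain u v where [simp]: "uv = (u, v)" by force
        show ?thesis
        proof (cases "(u, v) \<in> cedges e1")
          case True
          then have "u \<in> ?A" "v \<in> ?A" using cedges_subset by blast+
          then show ?thesis using A[of u] A[of v] colD(2)[OF fg(1) True] by simp
        next
          case False
          then have uv: "(u, v) \<in> cedges e2" using that by simp
          then have "u \<in> ?B" "v \<in> ?B" using cedges_subset by blast+
          then show ?thesis using B[of u] B[of v] colD(2)[OF fg(2) uv] by simp
        qed
      qed
      show "r \<in> cverts (DUnion e1 e2) \<longrightarrow> ?glue p r = Lft"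
        using colD(3)[OF fg(1)] colD(3)[OF fg(2)] A[of r] B[of r] by auto
    qed
    have "cut_monom w (cverts (DUnion e1 e2)) (?glue p) = cut_monom w ?A (?glue p) * cut_monom w ?B (?glue p)"
      using assms by (simp add: cut_monom_def prod.union_disjoint finite_cverts)
    also have "cut_monom w ?A (?glue p) = cut_monom w ?A f"
      unfolding cut_monom_def by (rule prod.cong) (auto simp: A)
    also have "cut_monom w ?B (?glue p) = cut_monom w ?B g"
      unfolding cut_monom_def by (rule prod.cong) (use B in auto)
    finally show "cut_monom w (cverts (DUnion e1 e2)) (?glue p) =
        (case p of (f, g) \<Rightarrow> cut_monom w ?A f * cut_monom w ?B g)" by simp
  next
    fix \<phi> assume \<phi>: "\<phi> \<in> colorings r (DUnion e1 e2) S"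
    then show "?glue (restrict \<phi> ?A, restrict \<phi> ?B) = \<phi>"
      by (auto simp: colorings_def PiE_def extensional_def fun_eq_iff)
    \<comment> \<open>Stated for a general \<open>e\<close> in order to serve both operands.\<close>
    have "restrict \<phi> (cverts e) \<in> colorings r e S"
      if e: "cverts e \<subseteq> ?A \<union> ?B" "\<And>l. lverts e l \<subseteq> lverts e1 l \<union> lverts e2 l"
        "cedges e \<subseteq> cedges e1 \<union> cedges e2" for e
      unfolding colorings_def mem_Collect_eq
    proof (intro conjI allI ballI)
      show "restrict \<phi> (cverts e) v \<in> S l" if "v \<in> lverts e l" for l v
        using that e(2)[of l] colD(1)[OF \<phi>, of v l] lverts_subset[of e l] by auto
      show "case uv of (u, v) \<Rightarrow> compat (restrict \<phi> (cverts e) u) (restrict \<phi> (cverts e) v)"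
        if "uv \<in> cedges e" for uv
      proof -
        obtain u v where [simp]: "uv = (u, v)" by force
        have "u \<in> cverts e" "v \<in> cverts e" using that cedges_subset by fastforce+
        moreover have "compat (\<phi> u) (\<phi> v)" using that e(3) by (intro colD(2)[OF \<phi>]) auto
        ultimately show ?thesis by simp
      qed
      show "r \<in> cverts e \<longrightarrow> restrict \<phi> (cverts e) r = Lft"
        using e(1) colD(3)[OF \<phi>] by auto
    qed simp
    from this[of e1] this[of e2]
    have "restrict \<phi> ?A \<in> colorings r e1 S" "restrict \<phi> ?B \<in> colorings r e2 S" by auto
    then show "(restrict \<phi> ?A, restrict \<phi> ?B) \<in> colorings r e1 S \<times> colorings r e2 S" by simp
  qed
  finally show ?thesis by simp
qed

lemma cut_poly_Relabel: "cut_poly w r (Relabel i j e) S = cut_poly w r e (S(i := S j))"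
proof -
  have "(\<forall>l. \<forall>v \<in> lverts (Relabel i j e) l. \<phi> v \<in> S l) \<longleftrightarrow>
    (\<forall>l. \<forall>v \<in> lverts e l. \<phi> v \<in> (S(i := S j)) l)" for \<phi>
    by (auto split: if_splits)
  then show ?thesis by (simp add: cut_poly_def colorings_def)
qed

lemma color_set_cases:
  fixes A :: "color set"
  obtains "A = {}" | "A = {Rgt}" | "A = {Lft}" | "A = {Lft, Rgt}" | "A = {Out}" | "A = {Out, Rgt}"
    | "A = {Out, Lft}" | "A = {Out, Lft, Rgt}"
proof -
  have eq: "A = B" if "Out \<in> A \<longleftrightarrow> Out \<in> B" "Lft \<in> A \<longleftrightarrow> Lft \<in> B" "Rgt \<in> A \<longleftrightarrow> Rgt \<in> B" for B
  proof (rule set_eqI)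
    show "x \<in> A \<longleftrightarrow> x \<in> B" for x using that by (cases x) auto
  qed
  consider "Out \<notin> A" "Lft \<notin> A" "Rgt \<notin> A" | "Out \<notin> A" "Lft \<notin> A" "Rgt \<in> A"
    | "Out \<notin> A" "Lft \<in> A" "Rgt \<notin> A" | "Out \<notin> A" "Lft \<in> A" "Rgt \<in> A"
    | "Out \<in> A" "Lft \<notin> A" "Rgt \<notin> A" | "Out \<in> A" "Lft \<notin> A" "Rgt \<in> A"
    | "Out \<in> A" "Lft \<in> A" "Rgt \<notin> A" | "Out \<in> A" "Lft \<in> A" "Rgt \<in> A" by argo
  then show thesis by cases (rule that, rule eq, simp_all)+
qed

text \<open>
  Modulo two, the indicator of a union of bicliques is the sum over the nonempty intersections of
  the maximal ones: the six maximal bicliques are arranged in a cycle, in which only neighbours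
  intersect.
\<close>

lemma sum_concepts_bit:
  assumes "P \<noteq> {}" "Q \<noteq> {}"
  shows "(\<Sum>p\<leftarrow>concepts. of_bool (P \<subseteq> fst p \<and> Q \<subseteq> snd p)) =
    (of_bool (\<forall>a\<in>P. \<forall>b\<in>Q. compat a b) :: bit)"
  using assms
  by (cases P rule: color_set_cases; cases Q rule: color_set_cases; simp add: concepts_def compat_def)

lemma sum_concepts:
  assumes "P \<noteq> {}" "Q \<noteq> {}"
  shows "(\<Sum>p\<leftarrow>concepts. of_bool (P \<subseteq> fst p \<and> Q \<subseteq> snd p)) =
    (of_bool (\<forall>a\<in>P. \<forall>b\<in>Q. compat a b) :: bit poly)"
proof -
  have b: "of_bool x = [:of_bool x :: bit:]" for x
    by (simp add: one_pCons)
  have "(\<Sum>p\<leftarrow>xs. of_bool (f p)) = [:\<Sum>p\<leftarrow>xs. of_bool (f p) :: bit:]" for f and xs :: "'x list"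
    by (induction xs) (auto simp: one_pCons)
  then show ?thesis unfolding b[of "\<forall>a\<in>P. \<forall>b\<in>Q. compat a b"] sum_concepts_bit[OF assms, symmetric] .
qed

text \<open>The colorings that survive the join are those in which the color sets of the two classes
  are compatible throughout. Both sets are nonempty, so \<open>sum_concepts\<close> replaces this
  indicator by a sum over bicliques. After exchanging the sums, each biclique merely tightens the
  upper bounds of the two labels.\<close>

lemma cut_poly_Join:
  assumes "i \<noteq> j" "lverts e i \<noteq> {}" "lverts e j \<noteq> {}"
  shows "cut_poly w r (Join i j e) S =
    (\<Sum>p\<leftarrow>concepts. cut_poly w r e (S(j := snd p \<inter> S j, i := fst p \<inter> S i)))"
proof -
  let ?F = "colorings r e S" and ?m = "cut_monom w (cverts e)"
  let ?Q = "\<lambda>\<phi>. \<forall>a \<in> \<phi> ` lverts e i. \<forall>b \<in> \<phi> ` lverts e j. compat a b"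
  let ?R = "\<lambda>p \<phi>. \<phi> ` lverts e i \<subseteq> fst p \<and> \<phi> ` lverts e j \<subseteq> snd p"
  have "colorings r (Join i j e) S = {\<phi> \<in> ?F. ?Q \<phi>}"
    by (auto simp: colorings_def intro: compat_sym[THEN iffD1])
  then have "cut_poly w r (Join i j e) S = (\<Sum>\<phi>\<in>?F. of_bool (?Q \<phi>) * ?m \<phi>)"
    unfolding cut_poly_def
    by (simp add: sum.inter_filter[symmetric] finite_colorings of_bool_def if_distrib[of "\<lambda>x. x * _"] cong: if_cong)
  also have "\<dots> = (\<Sum>\<phi>\<in>?F. (\<Sum>p\<leftarrow>concepts. of_bool (?R p \<phi>)) * ?m \<phi>)"
  proof (rule sum.cong[OF refl])
    fix \<phi>
    show "of_bool (?Q \<phi>) * ?m \<phi> = (\<Sum>p\<leftarrow>concepts. of_bool (?R p \<phi>)) * ?m \<phi>"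
      using assms by (subst sum_concepts) auto
  qed
  also have "\<dots> = (\<Sum>p\<leftarrow>concepts. \<Sum>\<phi>\<in>?F. of_bool (?R p \<phi>) * ?m \<phi>)"
  proof -
    have "(\<Sum>\<phi>\<in>?F. (\<Sum>p\<leftarrow>xs. of_bool (?R p \<phi>)) * ?m \<phi>) =
      (\<Sum>p\<leftarrow>xs. \<Sum>\<phi>\<in>?F. of_bool (?R p \<phi>) * ?m \<phi>)" for xs
      by (induction xs) (simp_all add: sum.distrib distrib_right)
    then show ?thesis .
  qed
  also have "\<dots> = (\<Sum>p\<leftarrow>concepts. cut_poly w r e (S(j := snd p \<inter> S j, i := fst p \<inter> S i)))"
  proof (rule arg_cong[where f = sum_list], rule map_cong[OF refl])
    fix p
    have "colorings r e (S(j := snd p \<inter> S j, i := fst p \<inter> S i)) = {\<phi> \<in> ?F. ?R p \<phi>}"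
      using assms(1) by (auto simp: colorings_def split: if_splits)
    then show "(\<Sum>\<phi>\<in>?F. of_bool (?R p \<phi>) * ?m \<phi>) =
        cut_poly w r e (S(j := snd p \<inter> S j, i := fst p \<inter> S i))"
      unfolding cut_poly_def
      by (simp add: sum.inter_filter[symmetric] finite_colorings of_bool_def if_distrib[of "\<lambda>x. x * _"] cong: if_cong)
  qed
  finally show ?thesis .
qed

section \<open>The tables represent the cut polynomial\<close>

lemma branch_build:
  assumes "A \<noteq> UNIV"
  shows "branch A (build (l # D) S f) = (if A = {} then Leaf else build D (S(l := A)) f)"
  using assms by (cases A rule: color_set_cases) (auto simp: branch_def Let_def UNIV_color)

lemma look_build:
  assumes "distinct D" "\<forall>l \<in> set D. S l \<noteq> UNIV"
  shows "look (build D S0 f) D S =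
    (if \<exists>l \<in> set D. S l = {} then Leaf else f (\<lambda>l. if l \<in> set D then S l else S0 l))"
  using assms
proof (induction D arbitrary: S0)
  case (Cons l D)
  have eq: "(\<lambda>k. if k \<in> set D then S k else (S0(l := S l)) k) =
    (\<lambda>k. if k \<in> set (l # D) then S k else S0 k)"
    using Cons.prems by (auto simp: fun_eq_iff)
  show ?case
  proof (cases "S l = {}")
    case True
    then show ?thesis using Cons.prems by (simp add: branch_build look_Leaf del: build.simps)
  next
    case False
    then have "look (build (l # D) S0 f) (l # D) S = look (build D (S0(l := S l)) f) D S"
      using Cons.prems by (simp add: branch_build del: build.simps)
    also have "\<dots> = (if \<exists>l \<in> set D. S l = {} then Leaf else
        f (\<lambda>k. if k \<in> set D then S k else (S0(l := S l)) k))"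
      using Cons.prems by (intro Cons.IH) auto
    finally show ?thesis unfolding eq using False by simp
  qed
qed auto

lemma pol_join_entry:
  "pol (join_entry T D S i j R) = (\<Sum>p\<leftarrow>R. pol (look T D (S(j := snd p \<inter> S j, i := fst p \<inter> S i))))"
  by (induction R) (simp_all only: join_entry.simps pol.simps pol_padd list.map sum_list.Nil sum_list.Cons)

lemma nice_sub:
  "nice (DUnion e1 e2) \<Longrightarrow> nice e1" "nice (DUnion e1 e2) \<Longrightarrow> nice e2"
  "nice (Relabel i j e) \<Longrightarrow> nice e" "nice (Join i j e) \<Longrightarrow> nice e"
  unfolding nice_def irredundant_def by auto

lemma subexprs_self: "e \<in> subexprs e"
  by (cases e) auto

lemma cut_poly_empty:
  assumes "S l = {}" "lverts e l \<noteq> {}"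
  shows "cut_poly w r e S = 0"
proof -
  have "colorings r e S = {}" using assms by (auto simp: colorings_def)
  then show ?thesis by (simp add: cut_poly_def)
qed

lemma concepts_proper: "p \<in> set concepts \<Longrightarrow> fst p \<noteq> UNIV \<and> snd p \<noteq> UNIV"
  by (auto simp: concepts_def UNIV_color)

theorem pol_look_solve:
  assumes "\<And>v. v \<in> cverts e \<Longrightarrow> pol (m v) = monom 1 (w v)"
    and "nice e" "wf_cexpr e" "distinct D" "\<forall>l \<in> set D. S l \<noteq> UNIV" "\<forall>l. l \<notin> set D \<longrightarrow> S l = UNIV"
    and "\<forall>l. S l = {} \<longrightarrow> lverts e l \<noteq> {}"
  shows "pol (look (solve m r e D) D S) = cut_poly w r e S"
  using assms
proof (induction e arbitrary: D S)
  case (Intro l v)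
  show ?case
  proof (cases "\<exists>l \<in> set D. S l = {}")
    case True
    then show ?thesis using Intro.prems cut_poly_empty[of S] by (auto simp: look_build)
  next
    case False
    have "(\<lambda>l. if l \<in> set D then S l else UNIV) = S" using Intro.prems(6) by (auto simp: fun_eq_iff)
    then show ?thesis using False Intro.prems by (simp add: look_build cut_poly_Intro del: lverts.simps)
  qed
next
  case (DUnion e1 e2)
  show ?case
  proof (cases "\<exists>l \<in> set D. S l = {}")
    case True
    then show ?thesis using DUnion.prems cut_poly_empty[of S]
      by (auto simp: look_build simp del: lverts.simps)
  next
    case False
    have S: "(\<lambda>l. if l \<in> set D then S l else UNIV) = S" using DUnion.prems(6) by (auto simp: fun_eq_iff)
    have ne: "\<forall>l. S l \<noteq> {}" using False DUnion.prems by (metis UNIV_not_empty)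
    have "pol (look (solve m r e1 D) D S) = cut_poly w r e1 S"
      "pol (look (solve m r e2 D) D S) = cut_poly w r e2 S"
      using DUnion.prems nice_sub(1,2) ne by (auto intro!: DUnion.IH)
    then show ?thesis using False DUnion.prems S
      by (simp add: look_build cut_poly_DUnion pol_pmul del: lverts.simps)
  qed
next
  case (Relabel i j e)
  show ?case
  proof (cases "\<exists>l \<in> set D. S l = {}")
    case True
    then show ?thesis using Relabel.prems cut_poly_empty[of S]
      by (auto simp: look_build simp del: lverts.simps)
  next
    case False
    have S: "(\<lambda>l. if l \<in> set D then S l else UNIV) = S" using Relabel.prems(6) by (auto simp: fun_eq_iff)
    have ne: "\<forall>l. S l \<noteq> {}" using False Relabel.prems by (metis UNIV_not_empty)
    let ?D = "live_relabel i j D"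
    have "pol (look (solve m r e ?D) ?D (S(i := S j))) = cut_poly w r e (S(i := S j))"
      using Relabel.prems nice_sub(3) ne
      by (intro Relabel.IH) (auto simp: live_relabel_def distinct_removeAll)
    moreover have "(if j \<in> set D then S j else UNIV) = S j" using Relabel.prems(6) by auto
    ultimately show ?thesis
      by (simp only: solve.simps look_build[OF Relabel.prems(4,5)] False if_False S cut_poly_Relabel)
  qed
next
  case (Join i j e)
  have ij: "lverts e i \<noteq> {}" "lverts e j \<noteq> {}" "i \<noteq> j"
    using Join.prems(2,3) subexprs_self by (auto simp: nice_def)
  show ?case
  proof (cases "\<exists>l \<in> set D. S l = {}")
    case True
    then show ?thesis using Join.prems cut_poly_empty[of S]
      by (auto simp: look_build simp del: lverts.simps)
  next
    case False
    have S: "(\<lambda>l. if l \<in> set D then S l else UNIV) = S" using Join.prems(6) by (auto simp: fun_eq_iff)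
    have ne: "\<forall>l. S l \<noteq> {}" using False Join.prems by (metis UNIV_not_empty)
    let ?D = "live_join i j D" and ?S = "\<lambda>p. S(j := snd p \<inter> S j, i := fst p \<inter> S i)"
    \<comment> \<open>Intersecting with the biclique makes the states of \<open>i\<close> and
      \<open>j\<close> proper, so both labels may be live below. Empty intersections are harmless,
      as both classes are nonempty.\<close>
    have "pol (look (solve m r e ?D) ?D (?S p)) = cut_poly w r e (?S p)" if "p \<in> set concepts" for p
      using Join.prems nice_sub(4)[OF Join.prems(2)] ne ij concepts_proper[OF that]
      by (intro Join.IH) (auto simp: live_join_def distinct_removeAll)
    then have "(\<Sum>p\<leftarrow>concepts. pol (look (solve m r e ?D) ?D (?S p))) =
        (\<Sum>p\<leftarrow>concepts. cut_poly w r e (?S p))"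
      by (intro arg_cong[where f = sum_list] map_cong) auto
    then have "pol (join_entry (solve m r e ?D) ?D S i j concepts) = cut_poly w r (Join i j e) S"
      unfolding pol_join_entry cut_poly_Join[OF ij(3,1,2)] .
    then show ?thesis using False Join.prems S by (simp add: look_build del: lverts.simps)
  qed
qed

section \<open>Isolation\<close>

definition set_weight :: "('v \<Rightarrow> 'b \<Rightarrow> nat) \<Rightarrow> 'v list \<Rightarrow> 'b list \<Rightarrow> 'v set \<Rightarrow> nat" where
  "set_weight h vs \<omega> X = (\<Sum>i | i < length vs \<and> vs ! i \<in> X. h (vs ! i) (\<omega> ! i))"

definition min_weight :: "('v \<Rightarrow> 'b \<Rightarrow> nat) \<Rightarrow> 'v list \<Rightarrow> 'v set set \<Rightarrow> 'b list \<Rightarrow> 'v set \<Rightarrow> bool" where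
  "min_weight h vs \<F> \<omega> X \<longleftrightarrow> X \<in> \<F> \<and> (\<forall>Y \<in> \<F>. set_weight h vs \<omega> X \<le> set_weight h vs \<omega> Y)"

text \<open>The vertex at position \<open>i\<close> is singular in the sense of the isolation lemma:
  the lightest sets disagree on it.\<close>

definition ambiguous :: "('v \<Rightarrow> 'b \<Rightarrow> nat) \<Rightarrow> 'v list \<Rightarrow> 'v set set \<Rightarrow> 'b set \<Rightarrow> nat \<Rightarrow> 'b list set" where
  "ambiguous h vs \<F> B i = {\<omega> \<in> nlists (length vs) B.
    \<exists>X Y. min_weight h vs \<F> \<omega> X \<and> min_weight h vs \<F> \<omega> Y \<and> vs ! i \<in> X \<and> vs ! i \<notin> Y}"

lemma set_weight_update_notin:
  "vs ! i \<notin> X \<Longrightarrow> set_weight h vs (list_update \<omega> i b) X = set_weight h vs \<omega> X"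
  unfolding set_weight_def by (rule sum.cong[OF refl]) (metis (mono_tags, lifting) mem_Collect_eq nth_list_update_neq)

lemma set_weight_update_in:
  assumes "vs ! i \<in> X" "i < length vs" "length \<omega> = length vs"
  shows "set_weight h vs (list_update \<omega> i b) X + h (vs ! i) (\<omega> ! i) = set_weight h vs \<omega> X + h (vs ! i) b"
proof -
  let ?I = "{i. i < length vs \<and> vs ! i \<in> X}"
  have i: "finite ?I" "i \<in> ?I" using assms by auto
  have "(\<Sum>j \<in> ?I - {i}. h (vs ! j) (list_update \<omega> i b ! j)) = (\<Sum>j \<in> ?I - {i}. h (vs ! j) (\<omega> ! j))"
    by (rule sum.cong) auto
  then show ?thesis
    unfolding set_weight_def sum.remove[OF i] using assms by simp
qed

text \<open>Given the other weights, at most one weight of the \<open>i\<close>-th vertex is a threshold value.\<close>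

lemma ambiguous_unique:
  assumes "\<omega> \<in> ambiguous h vs \<F> B i" "list_update \<omega> i b \<in> ambiguous h vs \<F> B i"
    and "i < length vs" "b \<in> B" "inj_on (h (vs ! i)) B"
  shows "\<omega> ! i = b"
proof -
  let ?w = "set_weight h vs \<omega>" and ?w' = "set_weight h vs (list_update \<omega> i b)"
  have \<omega>: "length \<omega> = length vs" "set \<omega> \<subseteq> B" using assms(1) by (auto simp: ambiguous_def nlists_def)
  obtain X Y where X: "min_weight h vs \<F> \<omega> X" "vs ! i \<in> X" and Y: "min_weight h vs \<F> \<omega> Y" "vs ! i \<notin> Y"
    using assms(1) by (auto simp: ambiguous_def)
  obtain X' Y' where X': "min_weight h vs \<F> (list_update \<omega> i b) X'" "vs ! i \<in> X'"
    and Y': "min_weight h vs \<F> (list_update \<omega> i b) Y'" "vs ! i \<notin> Y'"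
    using assms(2) by (auto simp: ambiguous_def)
  note min = X(1) Y(1) X'(1) Y'(1)
  have "?w X = ?w Y" "?w' X' = ?w' Y'" "?w Y \<le> ?w Y'" "?w' Y' \<le> ?w' Y" "?w' X' \<le> ?w' X" "?w X \<le> ?w X'"
    using min by (auto simp: min_weight_def intro: le_antisym)
  \<comment> \<open>Sets that avoid the vertex keep their weight, and sets that contain it all shift
    by the same amount. Both kinds attain the minimum before and after the change, so the shift is
    zero.\<close>
  moreover have "?w' Y = ?w Y" "?w' Y' = ?w Y'"
    using Y Y' by (auto simp: set_weight_update_notin)
  moreover have "?w' X + h (vs ! i) (\<omega> ! i) = ?w X + h (vs ! i) b"
    "?w' X' + h (vs ! i) (\<omega> ! i) = ?w X' + h (vs ! i) b"
    using X X' assms(3) \<omega> by (auto simp: set_weight_update_in)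
  ultimately have "h (vs ! i) (\<omega> ! i) = h (vs ! i) b" by linarith
  moreover have "\<omega> ! i \<in> B" using \<omega> assms(3) by auto
  ultimately show ?thesis using assms(4,5) by (auto dest: inj_onD)
qed

text \<open>By \<open>ambiguous_unique\<close>, overwriting the entry at \<open>i\<close> of an
  ambiguous tape by an arbitrary value loses no information. So the ambiguous tapes are at most one
  in \<open>card B\<close>.\<close>

lemma card_ambiguous:
  assumes "finite B" "i < length vs" "inj_on (h (vs ! i)) B"
  shows "card (ambiguous h vs \<F> B i) * card B \<le> card (nlists (length vs) B)"
proof -
  let ?A = "ambiguous h vs \<F> B i"
  have "inj_on (\<lambda>(\<omega>, b). list_update \<omega> i b) (?A \<times> B)"
  proof (rule inj_onI, clarify)
    fix \<omega> b \<omega>' b'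
    assume \<omega>: "\<omega> \<in> ?A" "b \<in> B" "\<omega>' \<in> ?A" "b' \<in> B" "list_update \<omega> i b = list_update \<omega>' i b'"
    then have len: "length \<omega> = length vs" "length \<omega>' = length vs" by (auto simp: ambiguous_def nlists_def)
    have b: "b = b'" using \<omega>(5) len assms(2) by (metis nth_list_update_eq)
    have eq: "\<omega>' = list_update \<omega> i (\<omega>' ! i)" using \<omega>(5) by (metis list_update_id list_update_overwrite)
    have "\<omega>' ! i \<in> B" using \<omega>(3) assms(2) by (auto simp: ambiguous_def nlists_def)
    then have "\<omega> ! i = \<omega>' ! i"
      using ambiguous_unique[OF \<omega>(1) _ assms(2) _ assms(3), of "\<omega>' ! i"] eq \<omega>(3) by simp
    with eq have "\<omega>' = \<omega>" by (metis list_update_id)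
    with b show "\<omega> = \<omega>' \<and> b = b'" by simp
  qed
  moreover have "(\<lambda>(\<omega>, b). list_update \<omega> i b) ` (?A \<times> B) \<subseteq> nlists (length vs) B"
    using set_update_subset_insert by (fastforce simp: ambiguous_def nlists_def)
  ultimately have "card (?A \<times> B) \<le> card (nlists (length vs) B)"
    using finite_nlists[OF assms(1)] by (metis card_image card_mono)
  then show ?thesis by (simp add: card_cartesian_product)
qed

text \<open>Two different lightest sets differ at some position, which is then ambiguous. The union
  bound over the positions gives at most \<open>length vs / card B\<close>, hence at most one
  half.\<close>

theorem isolation:
  assumes "finite B" "2 * length vs \<le> card B" "\<And>v. v \<in> set vs \<Longrightarrow> inj_on (h v) B"
    and "finite \<F>" "\<F> \<noteq> {}" "\<F> \<subseteq> Pow (set vs)"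
  shows "2 * card {\<omega> \<in> nlists (length vs) B. \<not> (\<exists>!X. min_weight h vs \<F> \<omega> X)} \<le> card (nlists (length vs) B)"
proof -
  let ?n = "length vs" and ?\<Omega> = "nlists (length vs) B"
  let ?bad = "{\<omega> \<in> ?\<Omega>. \<not> (\<exists>!X. min_weight h vs \<F> \<omega> X)}"
  have "?bad \<subseteq> (\<Union>i<?n. ambiguous h vs \<F> B i)"
  proof
    fix \<omega> assume \<omega>: "\<omega> \<in> ?bad"
    obtain X where X: "min_weight h vs \<F> \<omega> X"
      using ex_is_arg_min_if_finite[OF assms(4,5), of "set_weight h vs \<omega>"]
      by (auto simp: min_weight_def is_arg_min_def not_less)
    with \<omega> obtain Y where Y: "min_weight h vs \<F> \<omega> Y" "X \<noteq> Y" by auto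
    have "X \<subseteq> set vs" "Y \<subseteq> set vs" using X Y assms(6) by (auto simp: min_weight_def)
    then obtain v where "v \<in> set vs" "v \<in> X \<longleftrightarrow> v \<notin> Y" using Y(2) by blast
    then obtain i where "i < ?n" "vs ! i \<in> X \<longleftrightarrow> vs ! i \<notin> Y" by (metis in_set_conv_nth)
    then show "\<omega> \<in> (\<Union>i<?n. ambiguous h vs \<F> B i)"
      using X Y \<omega> by (auto simp: ambiguous_def)
  qed
  then have "card ?bad \<le> card (\<Union>i<?n. ambiguous h vs \<F> B i)"
    by (rule card_mono[rotated]) (auto simp: ambiguous_def finite_nlists[OF assms(1)])
  also have "\<dots> \<le> (\<Sum>i<?n. card (ambiguous h vs \<F> B i))"
    by (rule card_UN_le) simp
  finally have "card ?bad * card B \<le> (\<Sum>i<?n. card (ambiguous h vs \<F> B i)) * card B"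
    by (rule mult_le_mono1)
  also have "\<dots> = (\<Sum>i<?n. card (ambiguous h vs \<F> B i) * card B)"
    by (rule sum_distrib_right)
  also have "\<dots> \<le> (\<Sum>i<?n. card ?\<Omega>)"
    using assms(1,3) by (intro sum_mono card_ambiguous) auto
  also have "\<dots> = ?n * card ?\<Omega>" by simp
  finally have "card ?bad * card B \<le> ?n * card ?\<Omega>" .
  moreover have "card ?bad * (2 * ?n) \<le> card ?bad * card B"
    using assms(2) by (rule mult_le_mono2)
  moreover have "card ?bad * (2 * ?n) = ?n * (2 * card ?bad)" by (simp only: mult_ac)
  ultimately have *: "?n * (2 * card ?bad) \<le> ?n * card ?\<Omega>" by linarith
  show ?thesis
  \<comment> \<open>The factor \<open>?n\<close> can be cancelled only if it is positive; without
    positions there is no ambiguous tape at all.\<close>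
  proof (cases "?n = 0")
    case True
    with \<open>?bad \<subseteq> _\<close> have "?bad = {}" by auto
    show ?thesis by (subst \<open>?bad = {}\<close>) simp
  next
    case False
    with * show ?thesis by simp
  qed
qed

section \<open>Connected vertex covers\<close>

definition cover_colorings :: "'v set \<Rightarrow> 'v rel \<Rightarrow> 'v \<Rightarrow> 'v set \<Rightarrow> ('v \<Rightarrow> color) set" where
  "cover_colorings V E r X = {\<phi> \<in> V \<rightarrow>\<^sub>E UNIV. (\<forall>(u, v) \<in> E. compat (\<phi> u) (\<phi> v)) \<and> \<phi> r = Lft \<and>
    {v \<in> V. \<phi> v \<noteq> Out} = X}"

lemma compat_Lft: "compat Lft b \<Longrightarrow> b \<noteq> Out \<Longrightarrow> b = Lft"
  by (auto simp: compat_def)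

lemma odd_cover_colorings:
  assumes V: "finite V" "E \<subseteq> V \<times> V" and "sym E" and X: "X \<subseteq> V" "\<forall>(u, v) \<in> E. u \<in> X \<or> v \<in> X" "r \<in> X"
  shows "odd (card (cover_colorings V E r X)) \<longleftrightarrow> (\<forall>u \<in> X. (r, u) \<in> rtrancl_on X E)"
proof
  assume conn: "\<forall>u \<in> X. (r, u) \<in> rtrancl_on X E"
  let ?\<phi> = "\<lambda>v\<in>V. if v \<in> X then Lft else Out"
  have "cover_colorings V E r X = {?\<phi>}"
  proof (intro equalityI subsetI)
    fix \<phi> assume \<phi>: "\<phi> \<in> cover_colorings V E r X"
    have "\<phi> u = Lft" if "u \<in> X" for u
    proof -
      have "(r, u) \<in> rtrancl_on X E" using conn that by blast
      then show ?thesis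
      proof (induction rule: rtrancl_on_induct)
        case base
        then show ?case using \<phi> by (simp add: cover_colorings_def)
      next
        case (step y z)
        have "compat (\<phi> y) (\<phi> z)" "\<phi> z \<noteq> Out"
          using \<phi> step by (auto simp: cover_colorings_def)
        then show ?case using step compat_Lft by auto
      qed
    qed
    moreover have "\<phi> u = Out" if "u \<in> V" "u \<notin> X" for u
      using \<phi> that by (auto simp: cover_colorings_def)
    moreover have "\<phi> u = undefined" if "u \<notin> V" for u
      using \<phi> that by (auto simp: cover_colorings_def)
    ultimately have "\<phi> = ?\<phi>" using X(1) by (auto simp: fun_eq_iff restrict_def)
    then show "\<phi> \<in> {?\<phi>}" by simp
  next
    fix \<phi> assume "\<phi> \<in> {?\<phi>}"
    then show "\<phi> \<in> cover_colorings V E r X"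
      using V X by (auto simp: cover_colorings_def compat_def split: if_splits)
  qed
  then show "odd (card (cover_colorings V E r X))" by simp
next
  assume odd: "odd (card (cover_colorings V E r X))"
  show "\<forall>u \<in> X. (r, u) \<in> rtrancl_on X E"
  proof (rule ccontr)
    assume "\<not> ?thesis"
    then obtain k where k: "k \<in> X" "(r, k) \<notin> rtrancl_on X E" by blast
    define K where "K = {u \<in> X. (r, u) \<notin> rtrancl_on X E}"
    define flip where "flip \<phi> v = (if v \<in> K then if \<phi> v = Lft then Rgt else Lft else \<phi> v)"
      for \<phi> :: "_ \<Rightarrow> color" and v
    \<comment> \<open>Since \<open>E\<close> is symmetric, no edge inside \<open>X\<close> leaves
      \<open>K\<close>. This is why swapping the sides on \<open>K\<close> keeps all edges
      compatible.\<close>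
    have K: "u \<in> K \<longleftrightarrow> v \<in> K" if "(u, v) \<in> E" "u \<in> X" "v \<in> X" for u v
      using that \<open>sym E\<close> unfolding K_def
      by (auto intro: rtrancl_on_into_rtrancl_on dest: symD)
    have "r \<notin> K" using X(3) by (auto simp: K_def)
    have "K \<subseteq> X" by (auto simp: K_def)
    let ?F = "cover_colorings V E r X"
    have col: "\<phi> v \<noteq> Out \<longleftrightarrow> v \<in> X" if "\<phi> \<in> ?F" "v \<in> V" for \<phi> v
      using that by (auto simp: cover_colorings_def)
    have flip: "flip \<phi> \<in> ?F" if \<phi>: "\<phi> \<in> ?F" for \<phi>
    proof -
      have "compat (flip \<phi> u) (flip \<phi> v)" if uv: "(u, v) \<in> E" for u v
      proof -
        have c: "compat (\<phi> u) (\<phi> v)" and V': "u \<in> V" "v \<in> V" using \<phi> uv V by (auto simp: cover_colorings_def)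
        note cols = col[OF \<phi> V'(1)] col[OF \<phi> V'(2)]
        show ?thesis
          using c cols K[OF uv] \<open>K \<subseteq> X\<close> unfolding flip_def
          by (cases "\<phi> u"; cases "\<phi> v") (auto simp: compat_def)
      qed
      moreover have "flip \<phi> \<in> V \<rightarrow>\<^sub>E UNIV"
        using \<phi> \<open>K \<subseteq> X\<close> X(1) by (auto simp: cover_colorings_def flip_def PiE_def extensional_def)
      moreover have "flip \<phi> r = Lft" using \<phi> \<open>r \<notin> K\<close> by (simp add: cover_colorings_def flip_def)
      moreover have "{v \<in> V. flip \<phi> v \<noteq> Out} = X"
      proof -
        have "flip \<phi> v \<noteq> Out \<longleftrightarrow> v \<in> X" if "v \<in> V" for v
          using col[OF \<phi> that] \<open>K \<subseteq> X\<close> by (auto simp: flip_def)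
        then show ?thesis using X(1) by auto
      qed
      ultimately show ?thesis by (auto simp: cover_colorings_def)
    qed
    have flip2: "flip (flip \<phi>) = \<phi>" if "\<phi> \<in> ?F" for \<phi>
    proof
      fix v
      show "flip (flip \<phi>) v = \<phi> v"
        using col[OF that, of v] \<open>K \<subseteq> X\<close> X(1) by (cases "\<phi> v") (auto simp: flip_def)
    qed
    have fin: "finite ?F"
      by (rule finite_subset[of _ "V \<rightarrow>\<^sub>E UNIV"]) (auto simp: cover_colorings_def finite_PiE V(1))
    have "k \<in> K" "k \<in> V" using k X(1) by (auto simp: K_def)
    \<comment> \<open>\<open>flip\<close> changes the color of \<open>k\<close>, so it has no fixed
      point and exchanges the two halves determined by the side of \<open>k\<close>.\<close>
    let ?L = "{\<phi> \<in> ?F. \<phi> k = Lft}" and ?R = "{\<phi> \<in> ?F. \<phi> k \<noteq> Lft}"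
    have "bij_betw flip ?L ?R"
    proof (rule bij_betwI[where g = flip])
      show "flip \<in> ?L \<rightarrow> ?R" using flip \<open>k \<in> K\<close> by (auto simp: flip_def)
      show "flip \<in> ?R \<rightarrow> ?L" using flip \<open>k \<in> K\<close> by (auto simp: flip_def)
    qed (use flip2 in auto)
    then have "card ?L = card ?R" by (rule bij_betw_same_card)
    moreover have "card ?F = card ?L + card ?R"
      using fin by (subst card_Un_disjoint[symmetric]) (auto intro!: arg_cong[where f = card])
    ultimately show False using odd by simp
  qed
qed

section \<open>Connected covers as odd coefficients\<close>

lemma sym_cedges: "sym (cedges e)"
  by (induction e) (auto simp: sym_def)

text \<open>Connectedness refers to the symmetric closure of the induced arcs and excludes the empty
  graph. The edges of an expression are symmetric already, so the closure disappears while
  \<open>X \<noteq> {}\<close> remains.\<close>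

lemma connected_vertex_cover_iff:
  "connected_vertex_cover (graph_of e) X \<longleftrightarrow> X \<subseteq> cverts e \<and> (\<forall>(u, v) \<in> cedges e. u \<in> X \<or> v \<in> X) \<and>
    X \<noteq> {} \<and> (\<forall>u \<in> X. \<forall>v \<in> X. (u, v) \<in> rtrancl_on X (cedges e))"
proof -
  let ?E = "cedges e"
  have ends: "arcs_ends (induce_subgraph (with_proj (graph_of e)) X) = {(u, v) \<in> ?E. u \<in> X \<and> v \<in> X}"
    by (auto simp: arcs_ends_conv induce_subgraph_def graph_of_def image_iff)
  have "(symcl {(u, v) \<in> ?E. u \<in> X \<and> v \<in> X}) = {(u, v) \<in> ?E. u \<in> X \<and> v \<in> X}"
    using sym_cedges[of e] by (auto simp: symcl_def dest: symD)
  moreover have "rtrancl_on X {(u, v) \<in> ?E. u \<in> X \<and> v \<in> X} = rtrancl_on X ?E"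
  proof (intro equalityI subsetI; clarify)
    fix u v assume "(u, v) \<in> rtrancl_on X {(u, v) \<in> ?E. u \<in> X \<and> v \<in> X}"
    then show "(u, v) \<in> rtrancl_on X ?E"
      by (induction rule: rtrancl_on_induct) (auto intro: rtrancl_on_into_rtrancl_on)
  next
    fix u v assume "(u, v) \<in> rtrancl_on X ?E"
    then show "(u, v) \<in> rtrancl_on X {(u, v) \<in> ?E. u \<in> X \<and> v \<in> X}"
      by (induction rule: rtrancl_on_induct) (auto intro: rtrancl_on_into_rtrancl_on)
  qed
  ultimately have "Digraph_Component.connected (induce_subgraph (with_proj (graph_of e)) X) \<longleftrightarrow>
      X \<noteq> {} \<and> (\<forall>u \<in> X. \<forall>v \<in> X. (u, v) \<in> rtrancl_on X ?E)"
    by (simp add: connected_conv ends)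
  moreover have "arcs (induce_subgraph (with_proj (graph_of e)) (cverts e - X)) = {} \<longleftrightarrow>
      (\<forall>(u, v) \<in> ?E. u \<in> X \<or> v \<in> X)"
    using cedges_subset[of e] by (auto simp: induce_subgraph_def graph_of_def)
  ultimately show ?thesis
    unfolding connected_vertex_cover_def by (simp add: graph_of_def)
qed

text \<open>The colorings are grouped by the set of vertices that are not \<open>Out\<close>. By
  \<open>odd_cover_colorings\<close> the groups of odd size belong to the connected covers through
  \<open>r\<close>, and a sum is odd if and only if it has an odd number of odd summands.\<close>

lemma coeff_cut_poly:
  assumes "r \<in> cverts e"
  shows "coeff (cut_poly w r e (\<lambda>_. UNIV)) n = 1 \<longleftrightarrow>
    odd (card {X. connected_vertex_cover (graph_of e) X \<and> r \<in> X \<and> sum w X = n})"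
proof -
  let ?V = "cverts e" and ?E = "cedges e" and ?C = "colorings r e (\<lambda>_. UNIV)"
  let ?cov = "\<lambda>\<phi>. {v \<in> ?V. \<phi> v \<noteq> Out}"
  have monom: "cut_monom w ?V \<phi> = monom 1 (sum w (?cov \<phi>))" for \<phi>
  proof -
    have "cut_monom w ?V \<phi> = (\<Prod>v\<in>?cov \<phi>. monom 1 (w v))"
      unfolding cut_monom_def by (rule prod.mono_neutral_cong_right) (auto simp: finite_cverts)
    also have "\<dots> = monom 1 (sum w (?cov \<phi>))"
    proof -
      have "(\<Prod>v\<in>A. monom 1 (w v)) = (monom 1 (sum w A) :: bit poly)" if "finite A" for A
        using that by (induction A) (auto simp: mult_monom monom_0 one_pCons)
      then show ?thesis by (simp add: finite_cverts)
    qed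
    finally show ?thesis .
  qed
  have bit: "(of_nat k :: bit) = 1 \<longleftrightarrow> odd k" for k
    by (induction k) auto
  let ?D = "{\<phi> \<in> ?C. sum w (?cov \<phi>) = n}"
  have "coeff (cut_poly w r e (\<lambda>_. UNIV)) n = (\<Sum>\<phi>\<in>?C. if sum w (?cov \<phi>) = n then 1 else 0)"
    by (simp add: cut_poly_def coeff_sum monom)
  also have "\<dots> = of_nat (card ?D)"
    by (simp add: sum.If_cases finite_colorings Int_def)
  finally have 1: "coeff (cut_poly w r e (\<lambda>_. UNIV)) n = 1 \<longleftrightarrow> odd (card ?D)"
    by (simp add: bit)
  have 2: "?D = (\<Union>X \<in> {X \<in> Pow ?V. sum w X = n}. cover_colorings ?V ?E r X)"
  proof (intro equalityI subsetI)
    fix \<phi> assume "\<phi> \<in> ?D"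
    then have "\<phi> \<in> cover_colorings ?V ?E r (?cov \<phi>)" "?cov \<phi> \<in> {X \<in> Pow ?V. sum w X = n}"
      using assms by (simp_all add: colorings_def cover_colorings_def)
    then show "\<phi> \<in> (\<Union>X \<in> {X \<in> Pow ?V. sum w X = n}. cover_colorings ?V ?E r X)" by blast
  next
    fix \<phi> assume "\<phi> \<in> (\<Union>X \<in> {X \<in> Pow ?V. sum w X = n}. cover_colorings ?V ?E r X)"
    then obtain X where "sum w X = n" "\<phi> \<in> cover_colorings ?V ?E r X" by blast
    then show "\<phi> \<in> ?D" by (simp add: colorings_def cover_colorings_def)
  qed
  have 3: "card (\<Union>X \<in> {X \<in> Pow ?V. sum w X = n}. cover_colorings ?V ?E r X) =
      (\<Sum>X \<in> {X \<in> Pow ?V. sum w X = n}. card (cover_colorings ?V ?E r X))"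
  proof (rule card_UN_disjoint)
    show "\<forall>X \<in> {X \<in> Pow ?V. sum w X = n}. finite (cover_colorings ?V ?E r X)"
      by (intro ballI, rule finite_subset[of _ "?V \<rightarrow>\<^sub>E UNIV"]) (auto simp: cover_colorings_def finite_PiE finite_cverts)
    show "\<forall>X \<in> {X \<in> Pow ?V. sum w X = n}. \<forall>Y \<in> {X \<in> Pow ?V. sum w X = n}. X \<noteq> Y \<longrightarrow>
        cover_colorings ?V ?E r X \<inter> cover_colorings ?V ?E r Y = {}"
      unfolding cover_colorings_def by blast
  qed (simp add: finite_cverts)
  have 4: "odd (\<Sum>X \<in> {X \<in> Pow ?V. sum w X = n}. card (cover_colorings ?V ?E r X)) \<longleftrightarrow>
      odd (card {X \<in> {X \<in> Pow ?V. sum w X = n}. odd (card (cover_colorings ?V ?E r X))})"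
    by (subst even_sum_iff) (simp_all add: finite_cverts)
  have 5: "{X \<in> {X \<in> Pow ?V. sum w X = n}. odd (card (cover_colorings ?V ?E r X))} =
      {X. connected_vertex_cover (graph_of e) X \<and> r \<in> X \<and> sum w X = n}"
  proof -
    have "odd (card (cover_colorings ?V ?E r X)) \<longleftrightarrow> connected_vertex_cover (graph_of e) X \<and> r \<in> X"
      if X: "X \<subseteq> ?V" for X
    proof (cases "r \<in> X \<and> (\<forall>(u, v) \<in> ?E. u \<in> X \<or> v \<in> X)")
      case True
      then have "odd (card (cover_colorings ?V ?E r X)) \<longleftrightarrow> (\<forall>u \<in> X. (r, u) \<in> rtrancl_on X ?E)"
        using X by (intro odd_cover_colorings[OF finite_cverts cedges_subset sym_cedges]) auto
      \<comment> \<open>Any two vertices are linked by a walk through \<open>r\<close>, as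
        reachability is symmetric.\<close>
      also have "\<dots> \<longleftrightarrow> (\<forall>u \<in> X. \<forall>v \<in> X. (u, v) \<in> rtrancl_on X ?E)"
      proof (intro iffI ballI)
        fix u v assume *: "\<forall>u \<in> X. (r, u) \<in> rtrancl_on X ?E" "u \<in> X" "v \<in> X"
        then have "(r, u) \<in> rtrancl_on X ?E" "(r, v) \<in> rtrancl_on X ?E" by auto
        then show "(u, v) \<in> rtrancl_on X ?E"
          by (rule rtrancl_on_trans[OF symD[OF rtrancl_on_sym[OF sym_cedges[of e]]]])
      qed (use True in blast)
      finally have "odd (card (cover_colorings ?V ?E r X)) \<longleftrightarrow>
        (\<forall>u \<in> X. \<forall>v \<in> X. (u, v) \<in> rtrancl_on X ?E)" .
      then show ?thesis using True X unfolding connected_vertex_cover_iff by blast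
    next
      case False
      have "cover_colorings ?V ?E r X = {}"
      proof (rule ccontr)
        assume "cover_colorings ?V ?E r X \<noteq> {}"
        then obtain \<phi> where \<phi>: "\<phi> \<in> cover_colorings ?V ?E r X" by blast
        then have X': "v \<in> X \<longleftrightarrow> v \<in> ?V \<and> \<phi> v \<noteq> Out" for v
          unfolding cover_colorings_def by blast
        have "u \<in> X \<or> v \<in> X" if "(u, v) \<in> ?E" for u v
        proof -
          have "compat (\<phi> u) (\<phi> v)" using \<phi> that unfolding cover_colorings_def by blast
          moreover have "u \<in> ?V" "v \<in> ?V" using that cedges_subset[of e] by blast+
          ultimately show ?thesis unfolding X' by (auto simp: compat_def)
        qed
        moreover have "\<phi> r = Lft" using \<phi> unfolding cover_colorings_def by blast
        then have "r \<in> X" using assms X' by simp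
        ultimately show False using False by blast
      qed
      then show ?thesis using False unfolding connected_vertex_cover_iff by auto
    qed
    then have "X \<in> {X \<in> {X \<in> Pow ?V. sum w X = n}. odd (card (cover_colorings ?V ?E r X))} \<longleftrightarrow>
        X \<in> {X. connected_vertex_cover (graph_of e) X \<and> r \<in> X \<and> sum w X = n}" for X
      unfolding connected_vertex_cover_iff by (cases "X \<subseteq> ?V") (simp_all add: conj_ac)
    then show ?thesis by blast
  qed
  show ?thesis unfolding 1 2 3 4 5 ..
qed

section \<open>The algorithm is correct\<close>

lemma val_append: "val (xs @ ys) = val xs + 2 ^ length xs * val ys"
  by (induction xs) (auto simp: algebra_simps)

lemma val_replicate_False [simp]: "val (replicate n False) = 0"
  by (induction n) auto

lemma val_less: "val bs < 2 ^ length bs"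
  by (induction bs) auto

lemma val_inj: "length xs = length ys \<Longrightarrow> val xs = val ys \<Longrightarrow> xs = ys"
proof (induction xs ys rule: list_induct2)
  case (Cons x xs y ys)
  have "x = y"
    using Cons.prems by (cases x; cases y) (simp_all, presburger+)
  with Cons show ?case by simp
qed auto

lemma val_weight_bits:
  "length bs = Suc a \<Longrightarrow> val (weight_bits c a v bs) = val bs + 2 ^ (2 * a + 2) * c v"
  by (simp add: weight_bits_def val_append bits power_add algebra_simps power_mult power2_eq_square)

definition vweight :: "(nat \<Rightarrow> nat) \<Rightarrow> nat \<Rightarrow> nat list \<Rightarrow> bool list list \<Rightarrow> nat \<Rightarrow> nat" where
  "vweight c a vs \<omega> v = val (weight_bits c a v (the (map_of (zip vs \<omega>) v)))"

lemma weight_of_weights: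
  assumes "length \<omega> = length vs" "v \<in> set vs"
  shows "weight_of (weights c a vs \<omega>) v = pmono (weight_bits c a v (the (map_of (zip vs \<omega>) v)))"
proof -
  have "map_of (map (\<lambda>(v, bs). (v, f v bs)) ps) v = map_option (f v) (map_of ps v)"
    for f :: "nat \<Rightarrow> bool list \<Rightarrow> tree" and ps
    by (induction ps) auto
  moreover obtain bs where "map_of (zip vs \<omega>) v = Some bs"
    using assms by (metis map_of_zip_is_Some)
  ultimately show ?thesis by (simp add: weight_of_def weights_def)
qed

lemma map_of_zip_mem:
  assumes "length \<omega> = length vs" "v \<in> set vs"
  shows "the (map_of (zip vs \<omega>) v) \<in> set \<omega>"
proof -
  obtain bs where "map_of (zip vs \<omega>) v = Some bs"
    using assms by (metis map_of_zip_is_Some)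
  then show ?thesis by (auto dest!: map_of_SomeD set_zip_rightD)
qed

text \<open>A cover of cost at most \<open>b\<close> weighs at most this: its at most 2 ^ a random
  parts are each below 2 ^ (a + 1). The second summand is only half of a unit of cost, so conversely
  a cover within the bound has cost at most \<open>b\<close>.\<close>

definition bound :: "nat \<Rightarrow> nat \<Rightarrow> nat" where
  "bound a b = 2 ^ (2 * a + 2) * b + 2 ^ (2 * a + 1)"

definition tapes :: "nat list \<Rightarrow> nat \<Rightarrow> bool list list set" where
  "tapes vs a = nlists (length vs) (nlists (Suc a) UNIV)"

context
  fixes \<mu> :: "nat cexpr" and c :: "nat \<Rightarrow> nat" and b :: nat and vs :: "nat list" and a :: nat
  assumes wf: "wf_cexpr \<mu>" and nice: "nice \<mu>"
    and vs: "set vs = cverts \<mu>" "distinct vs" and a: "a = bitlen (length vs)"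
begin

lemma accepts_iff:
  assumes \<omega>: "\<omega> \<in> tapes vs a"
  shows "accepts \<mu> c b vs \<omega> \<longleftrightarrow> (\<exists>v \<in> cverts \<mu>. \<exists>e \<le> bound a b.
    odd (card {X. connected_vertex_cover (graph_of \<mu>) X \<and> v \<in> X \<and> sum (vweight c a vs \<omega>) X = e}))"
proof -
  have len: "length \<omega> = length vs" using \<omega> by (simp add: tapes_def nlists_def)
  let ?m = "weight_of (weights c a vs \<omega>)"
  have m: "pol (?m v) = monom 1 (vweight c a vs \<omega> v)" if "v \<in> cverts \<mu>" for v
    using that vs by (simp add: weight_of_weights[OF len] pol_pmono vweight_def)
  have "val (replicate a False @ replicate a False @ False # True # bits b) = bound a b"
    by (simp add: val_append bits bound_def power_add algebra_simps power_mult power2_eq_square)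
  moreover have "coeff (pol (solve ?m v \<mu> [])) e = 1 \<longleftrightarrow>
      odd (card {X. connected_vertex_cover (graph_of \<mu>) X \<and> v \<in> X \<and> sum (vweight c a vs \<omega>) X = e})"
    if "v \<in> cverts \<mu>" for v e
    \<comment> \<open>Above the whole expression no label is joined any more, so the table is a
      single polynomial.\<close>
    using pol_look_solve[OF m nice wf, where D = "[]" and S = "\<lambda>_. UNIV" and r = v] coeff_cut_poly[OF that] by simp
  ultimately show ?thesis
    unfolding accepts_def Let_def a[symmetric] pcheck_iff vs(1) by simp
qed

lemma vweight:
  assumes "\<omega> \<in> tapes vs a" "v \<in> cverts \<mu>"
  obtains s where "s < 2 ^ Suc a" "vweight c a vs \<omega> v = s + 2 ^ (2 * a + 2) * c v"
proof -
  let ?bs = "the (map_of (zip vs \<omega>) v)"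
  have "length \<omega> = length vs" using assms by (simp add: tapes_def nlists_def)
  then have "?bs \<in> set \<omega>" using map_of_zip_mem[of \<omega> vs v] vs assms(2) by simp
  then have "length ?bs = Suc a" using assms(1) by (auto simp: tapes_def nlists_def)
  then show thesis
    using that[of "val ?bs"] val_less[of ?bs] by (simp add: vweight_def val_weight_bits)
qed

text \<open>This holds for every tape, so false positives are impossible: an odd count is not zero,
  and dropping the random parts of a cover that it counts bounds the cost of this cover.\<close>

lemma accepts_sound:
  assumes \<omega>: "\<omega> \<in> tapes vs a" and "accepts \<mu> c b vs \<omega>"
  shows "CVC (graph_of \<mu>) c b"
proof -
  obtain v e where e: "e \<le> bound a b" and
    "odd (card {X. connected_vertex_cover (graph_of \<mu>) X \<and> v \<in> X \<and> sum (vweight c a vs \<omega>) X = e})"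
    using assms accepts_iff by blast
  then obtain X where X: "connected_vertex_cover (graph_of \<mu>) X" "sum (vweight c a vs \<omega>) X = e"
    by (metis (mono_tags, lifting) Collect_empty_eq card.empty even_zero)
  have "X \<subseteq> cverts \<mu>" using X(1) by (simp add: connected_vertex_cover_iff)
  have "2 ^ (2 * a + 2) * sum c X = (\<Sum>v\<in>X. 2 ^ (2 * a + 2) * c v)"
    by (simp add: sum_distrib_left)
  also have "\<dots> \<le> e"
    unfolding X(2)[symmetric]
  proof (rule sum_mono)
    fix v assume "v \<in> X"
    then obtain s where "vweight c a vs \<omega> v = s + 2 ^ (2 * a + 2) * c v"
      using vweight[OF \<omega>, of v] \<open>X \<subseteq> cverts \<mu>\<close> by blast
    then show "2 ^ (2 * a + 2) * c v \<le> vweight c a vs \<omega> v" by simp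
  qed
  \<comment> \<open>The allowance for the random parts is less than one unit of scaled cost.\<close>
  also have "\<dots> < 2 ^ (2 * a + 2) * Suc b"
  proof -
    have "e \<le> 4 * 2 ^ (2 * a) * b + 2 * 2 ^ (2 * a)" using e by (simp add: bound_def)
    moreover have "(0 :: nat) < 2 ^ (2 * a)" by simp
    ultimately have "e < 4 * 2 ^ (2 * a) + 4 * 2 ^ (2 * a) * b" by linarith
    then show ?thesis by simp
  qed
  finally have "sum c X < Suc b" by (simp only: mult_less_cancel1)
  then show ?thesis using X(1) by (auto simp: CVC_def)
qed

lemma set_weight_eq:
  assumes "\<omega> \<in> tapes vs a" "X \<subseteq> cverts \<mu>"
  shows "set_weight (\<lambda>v bs. val (weight_bits c a v bs)) vs \<omega> X = sum (vweight c a vs \<omega>) X"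
proof -
  have len: "length \<omega> = length vs" using assms by (simp add: tapes_def nlists_def)
  have "(\<Sum>i | i < length vs \<and> vs ! i \<in> X. val (weight_bits c a (vs ! i) (\<omega> ! i))) =
    (\<Sum>i | i < length vs \<and> vs ! i \<in> X. vweight c a vs \<omega> (vs ! i))"
    using len vs(2) by (intro sum.cong) (auto simp: vweight_def map_of_zip_nth)
  also have "\<dots> = sum (vweight c a vs \<omega>) X"
  proof (rule sum.reindex_bij_betw)
    show "bij_betw ((!) vs) {i. i < length vs \<and> vs ! i \<in> X} X"
      using vs assms(2) unfolding bij_betw_def
      by (auto simp: inj_on_def nth_eq_iff_index_eq image_def) (metis in_set_conv_nth subsetD)
  qed
  finally show ?thesis by (simp add: set_weight_def)
qed

text \<open>A cover \<open>X0\<close> within the budget need not be the lightest, but it bounds the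
  weight of the lightest cover \<open>X\<close>. As \<open>X\<close> is unique among all connected
  covers, the count at its weight is one for every root in \<open>X\<close>, and \<open>X\<close> is
  nonempty.\<close>

lemma accepts_complete:
  assumes \<omega>: "\<omega> \<in> tapes vs a" and "CVC (graph_of \<mu>) c b"
    and iso: "\<exists>!X. min_weight (\<lambda>v bs. val (weight_bits c a v bs)) vs
      {X. connected_vertex_cover (graph_of \<mu>) X} \<omega> X"
  shows "accepts \<mu> c b vs \<omega>"
proof -
  let ?w = "sum (vweight c a vs \<omega>)" and ?\<F> = "{X. connected_vertex_cover (graph_of \<mu>) X}"
  define M where "M = min_weight (\<lambda>v bs. val (weight_bits c a v bs)) vs ?\<F> \<omega>"
  have min: "M X \<longleftrightarrow> X \<in> ?\<F> \<and> (\<forall>Y \<in> ?\<F>. ?w X \<le> ?w Y)" for X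
  proof -
    have "set_weight (\<lambda>v bs. val (weight_bits c a v bs)) vs \<omega> Y = ?w Y" if "Y \<in> ?\<F>" for Y
      using that by (intro set_weight_eq[OF \<omega>]) (simp add: connected_vertex_cover_iff)
    then show ?thesis
      unfolding M_def min_weight_def by (intro conj_cong refl ball_cong) (simp only:)
  qed
  have "\<exists>X. M X \<and> (\<forall>Y. M Y \<longrightarrow> Y = X)"
    unfolding M_def Ex1_def[symmetric] by (rule iso)
  then obtain X where mX: "M X \<and> (\<forall>Y. M Y \<longrightarrow> Y = X)" ..
  then have un: "Y = X" if "M Y" for Y using that by simp
  have mX: "X \<in> ?\<F> \<and> (\<forall>Y \<in> ?\<F>. ?w X \<le> ?w Y)" using mX unfolding min by (rule conjunct1)
  then have X: "X \<in> ?\<F>" "\<And>Y. Y \<in> ?\<F> \<Longrightarrow> ?w X \<le> ?w Y" by simp_all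
  have unique: "Y = X" if "Y \<in> ?\<F>" "?w Y = ?w X" for Y
  proof -
    have "M Y" unfolding min using that X(2) by simp
    then show ?thesis by (rule un)
  qed
  obtain v where v: "v \<in> X" "v \<in> cverts \<mu>" using X(1) by (auto simp: connected_vertex_cover_iff)
  obtain X0 where X0: "X0 \<in> ?\<F>" "sum c X0 \<le> b" using assms(2) by (auto simp: CVC_def)
  then have X0': "X0 \<subseteq> set vs" using vs by (simp add: connected_vertex_cover_iff)
  have "?w X \<le> ?w X0" using X(2) X0(1) .
  also have "\<dots> \<le> (\<Sum>v\<in>X0. 2 ^ Suc a + 2 ^ (2 * a + 2) * c v)"
  proof (rule sum_mono)
    fix u assume "u \<in> X0"
    then obtain s where "s < 2 ^ Suc a" "vweight c a vs \<omega> u = s + 2 ^ (2 * a + 2) * c u"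
      using vweight[OF \<omega>, of u] X0' vs by blast
    then show "vweight c a vs \<omega> u \<le> 2 ^ Suc a + 2 ^ (2 * a + 2) * c u" by simp
  qed
  also have "\<dots> = card X0 * 2 ^ Suc a + 2 ^ (2 * a + 2) * sum c X0"
    by (simp add: sum.distrib sum_distrib_left)
  also have "\<dots> \<le> 2 ^ a * 2 ^ Suc a + 2 ^ (2 * a + 2) * b"
  proof (intro add_mono mult_le_mono)
    have "card X0 \<le> length vs" using X0' by (meson card_length card_mono finite_set le_trans)
    then show "card X0 \<le> 2 ^ a" using bitlen_bounds(1)[of "length vs"] a by simp
  qed (use X0 in auto)
  also have "2 ^ a * 2 ^ Suc a = (2 :: nat) ^ (2 * a + 1)"
    by (simp add: mult_2 power_add distrib_left)
  also have "2 ^ (2 * a + 1) + 2 ^ (2 * a + 2) * b = bound a b"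
    unfolding bound_def by (rule add.commute)
  finally have bound: "?w X \<le> bound a b" .
  have "{Y. connected_vertex_cover (graph_of \<mu>) Y \<and> v \<in> Y \<and> ?w Y = ?w X} = {X}"
    using X v unique by auto
  then have "odd (card {Y. connected_vertex_cover (graph_of \<mu>) Y \<and> v \<in> Y \<and> ?w Y = ?w X})" by simp
  then show ?thesis using accepts_iff[OF \<omega>] bound v(2) by blast
qed

lemma card_tapes_rejected:
  assumes "CVC (graph_of \<mu>) c b"
  shows "2 * card {\<omega> \<in> tapes vs a. \<not> accepts \<mu> c b vs \<omega>} \<le> card (tapes vs a)"
proof -
  let ?\<F> = "{X. connected_vertex_cover (graph_of \<mu>) X}"
  let ?h = "\<lambda>v bs. val (weight_bits c a v bs)"
  let ?B = "nlists (Suc a) (UNIV :: bool set)"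
  have "2 * card {\<omega> \<in> tapes vs a. \<not> (\<exists>!X. min_weight ?h vs ?\<F> \<omega> X)} \<le> card (tapes vs a)"
    unfolding tapes_def
  proof (rule isolation)
    show "finite ?B" by (simp add: finite_nlists)
    show "2 * length vs \<le> card ?B"
      using bitlen_bounds(1)[of "length vs"] a by (simp add: card_nlists)
    show "inj_on (?h v) ?B" for v
      by (rule inj_onI) (auto simp: nlists_def val_weight_bits intro: val_inj)
    show "?\<F> \<subseteq> Pow (set vs)" using vs by (auto simp: connected_vertex_cover_iff)
    then show "finite ?\<F>" by (rule finite_subset) simp
    show "?\<F> \<noteq> {}" using assms by (auto simp: CVC_def)
  qed
  moreover have "card {\<omega> \<in> tapes vs a. \<not> accepts \<mu> c b vs \<omega>} \<le>
      card {\<omega> \<in> tapes vs a. \<not> (\<exists>!X. min_weight ?h vs ?\<F> \<omega> X)}"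
    using accepts_complete[OF _ assms]
    by (intro card_mono) (auto simp: tapes_def finite_nlists)
  ultimately show ?thesis by linarith
qed

end

section \<open>The running time\<close>

lemma length_le_size: "length xs \<le> size (enc_list h xs)"
  by (induction xs) auto

lemma size_labels: "l \<in> clabels e \<Longrightarrow> size (enc_nat l) \<le> size (enc_cexpr e)"
  by (induction e) auto

lemma size_cverts: "v \<in> cverts e \<Longrightarrow> size (enc_nat v) \<le> size (enc_cexpr e)"
  by (induction e) auto

lemma finite_clabels: "finite (clabels e)"
  by (induction e) auto

lemma card_clabels: "card (clabels e) \<le> size (enc_cexpr e)"
proof (induction e)
  case (DUnion e1 e2)
  then show ?case using card_Un_le[of "clabels e1" "clabels e2"] by simp
next
  case (Relabel i j e)
  then show ?case by (simp add: card_insert_if finite_clabels)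
next
  case (Join i j e)
  then show ?case by (simp add: card_insert_if finite_clabels)
qed auto

lemma plen_eq: "wf_cexpr e \<Longrightarrow> plen m e = (\<Sum>v\<in>cverts e. len (m v) + 1)"
  by (induction e) (auto simp: sum.union_disjoint finite_cverts)

lemma bitlen_mono: "0 < m \<Longrightarrow> m \<le> n \<Longrightarrow> bitlen m \<le> bitlen n"
proof -
  assume "0 < m" "m \<le> n"
  then have "2 ^ bitlen m \<le> 2 * m" "m < 2 ^ bitlen n"
    using bitlen_bounds(2)[of m] bitlen_bounds(1)[of n] by auto
  then have "2 ^ bitlen m < (2 :: nat) ^ Suc (bitlen n)" by simp
  then show ?thesis by (simp only: power_strict_increasing_iff less_Suc_eq_le)
qed

text \<open>This is \<open>t_main\<close> without the factor \<open>6 ^ k\<close> and with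
  \<open>Z\<close> in place of \<open>H\<close>, \<open>2 ^ (H + 1)\<close> and \<open>I\<close>;
  thus \<open>160 * Z\<close> replaces \<open>100 * 2 ^ (H + 1) + 60 * H\<close>.\<close>

definition t_total :: "nat \<Rightarrow> nat" where
  "t_total Z = 60 * (Z + 1)^2 + (Z + 1) * (20 * Z + 100) + (Z + 1) * (160 * Z + 300) +
    (Z + 1) * (Z * t_node Z 0 + (Z + 1) * (30 * Z + 80) + 200) + 60 * Z + 1000"

lemma t_main_le:
  assumes "H \<le> Z" "2 ^ (H + 1) \<le> Z" "I \<le> Z"
  shows "t_main H Z k I \<le> 6 ^ k * t_total Z"
proof -
  have one: "x \<le> 6 ^ k * x" for x :: nat by simp
  have node: "t_node Z k \<le> 6 ^ k * t_node Z 0"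
  proof -
    have "3 * t_assoc Z (Z + 1) + 1000 \<le> 6 ^ k * (3 * t_assoc Z (Z + 1) + 1000)" by (rule one)
    then show ?thesis by (simp add: t_node_def algebra_simps)
  qed
  let ?A = "Z * t_node Z 0" and ?B = "(Z + 1) * (30 * Z + 80) + 200"
  have "I * t_node Z k \<le> Z * (6 ^ k * t_node Z 0)"
    using assms(3) node by (rule mult_le_mono)
  also have "\<dots> = 6 ^ k * ?A" by (rule mult.left_commute)
  finally have "I * t_node Z k + ?B \<le> 6 ^ k * ?A + 6 ^ k * ?B"
    using one by (rule add_mono)
  then have "(Z + 1) * (I * t_node Z k + ?B) \<le> (Z + 1) * (6 ^ k * ?A + 6 ^ k * ?B)"
    by (rule mult_le_mono2)
  moreover have "z * (e * x + e * y) = e * (z * (x + y))" for z e x y :: nat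
    by (simp add: algebra_simps)
  ultimately have 1: "(Z + 1) * (I * t_node Z k + (Z + 1) * (30 * Z + 80) + 200) \<le>
      6 ^ k * ((Z + 1) * (Z * t_node Z 0 + (Z + 1) * (30 * Z + 80) + 200))"
    by (simp only: add.assoc)
  have "(Z + 1) * (100 * 2 ^ (H + 1) + 60 * H + 300) \<le> (Z + 1) * (160 * Z + 300)"
    using assms by (intro mult_le_mono) auto
  with 1 have "t_main H Z k I \<le> (60 * (Z + 1)^2 + (Z + 1) * (20 * Z + 100) + (Z + 1) * (160 * Z + 300) + 60 * Z + 1000) +
      6 ^ k * ((Z + 1) * (Z * t_node Z 0 + (Z + 1) * (30 * Z + 80) + 200))"
    unfolding t_main_def by linarith
  also have "\<dots> \<le> 6 ^ k * t_total Z"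
    using one[of "60 * (Z + 1)^2 + (Z + 1) * (20 * Z + 100) + (Z + 1) * (160 * Z + 300) + 60 * Z + 1000"]
    unfolding t_total_def by (simp only: distrib_left)
  finally show ?thesis .
qed

section \<open>Polynomial growth of the bounds\<close>

definition polynomial :: "(nat \<Rightarrow> nat) \<Rightarrow> bool" where
  "polynomial f \<longleftrightarrow> (\<exists>p. \<forall>x. poly p x = f x)"

lemma polynomial_intros:
  "polynomial (\<lambda>x. x)" "polynomial (\<lambda>x. n)"
  "polynomial f \<Longrightarrow> polynomial g \<Longrightarrow> polynomial (\<lambda>x. f x + g x)"
  "polynomial f \<Longrightarrow> polynomial g \<Longrightarrow> polynomial (\<lambda>x. f x * g x)"
  "polynomial f \<Longrightarrow> polynomial (\<lambda>x. f x ^ m)"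
proof -
  show "polynomial (\<lambda>x. x)" unfolding polynomial_def by (intro exI[of _ "[:0, 1:]"]) simp
  show "polynomial (\<lambda>x. n)" unfolding polynomial_def by (intro exI[of _ "[:n:]"]) simp
  show "polynomial f \<Longrightarrow> polynomial g \<Longrightarrow> polynomial (\<lambda>x. f x + g x)"
    unfolding polynomial_def by (metis poly_add)
  show "polynomial f \<Longrightarrow> polynomial g \<Longrightarrow> polynomial (\<lambda>x. f x * g x)"
    unfolding polynomial_def by (metis poly_mult)
  show "polynomial f \<Longrightarrow> polynomial (\<lambda>x. f x ^ m)"
    unfolding polynomial_def by (metis poly_power)
qed

text \<open>All bounds are composed of sums, products and fixed powers, without subtraction or
  maximum. The only exponential term has exponent 0 here.\<close>

lemma polynomial_t_total: "polynomial t_total"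
  unfolding t_total_def t_node_def t_entry_def t_look_def t_assoc_def power_0 mult_1
  by (intro polynomial_intros)

text \<open>The largest quantity to be covered is the number of coefficients. A weight has fewer
  than 8 * 4 ^ a * 2 ^ bitlen Q of them, at most 64 I ^ 2 Q, and there are at most I vertices. The
  added ones absorb all other sizes.\<close>

definition size_bound :: "nat \<Rightarrow> nat \<Rightarrow> nat" where
  "size_bound I Q = 100 * (I + 1) ^ 3 * (Q + 1)"

lemma cverts_nonempty: "cverts e \<noteq> {}"
  by (induction e) auto

lemma run_prog:
  fixes \<mu> :: "nat cexpr" and c :: "nat \<Rightarrow> nat" and b k Q :: nat
  defines "vs \<equiv> sorted_list_of_set (cverts \<mu>)"
  defines "a \<equiv> bitlen (length vs)"
  defines "I \<equiv> size (enc_instance \<mu> c b)"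
  assumes \<mu>: "k_expression k \<mu>" and c: "\<forall>v \<in> cverts \<mu>. 0 < c v \<and> c v \<le> Q"
  shows "\<exists>t. (\<forall>\<omega> \<in> tapes vs a. t \<omega> \<le> 6 ^ k * t_total (size_bound I Q)) \<and>
    run prog (enc_instance \<mu> c b) =
    bind_spmf (spmf_of_set (tapes vs a)) (\<lambda>\<omega>. return_spmf (enc_bool (accepts \<mu> c b vs \<omega>), t \<omega>))"
proof -
  let ?Z = "size_bound I Q" and ?H = "2 * a + 2 + bitlen Q"
  have wf: "wf_cexpr \<mu>" and lab: "clabels \<mu> \<subseteq> {1..k}" using \<mu> by (auto simp: k_expression_def)
  have vs: "set vs = cverts \<mu>" "distinct vs" by (simp_all add: vs_def finite_cverts)
  have inst: "enc_instance \<mu> c b = Node (enc_cexpr \<mu>) (Node (enc_costs c vs) (enc_nat b))"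
    by (simp add: enc_instance_def vs_def)
  have E: "size (enc_cexpr \<mu>) \<le> I" by (simp add: I_def inst)
  have n: "length vs \<le> I"
    using length_le_size[of vs "\<lambda>v. Node (enc_nat v) (enc_nat (c v))"] by (simp add: I_def inst)
  have bI: "bitlen b \<le> I"
    using length_le_size[of "bits b" enc_bool] by (simp add: I_def inst bits)
  have "0 < length vs" using vs cverts_nonempty[of \<mu>] by auto
  then have a: "2 ^ a \<le> 2 * I" using bitlen_bounds(2)[of "length vs"] n by (simp add: a_def)
  have "a < 2 ^ a" by (rule less_exp)
  obtain v0 where "v0 \<in> cverts \<mu>" using cverts_nonempty[of \<mu>] by blast
  \<comment> \<open>Without a positive \<open>Q\<close> the estimate
    \<open>2 ^ bitlen Q \<le> 2 * Q\<close> would fail. A vertex exists and its cost is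
    positive.\<close>
  then have "0 < Q" using c by fastforce
  then have Q: "2 ^ bitlen Q \<le> 2 * Q" by (rule bitlen_bounds(2))
  have "2 ^ (?H + 1) = (2 :: nat) ^ (3 + (a + a) + bitlen Q)"
    by (rule arg_cong[where f = "\<lambda>x. 2 ^ x"]) simp
  also have "\<dots> = 8 * ((2 ^ a * 2 ^ a) * 2 ^ bitlen Q)"
    unfolding power_add by simp
  also have "\<dots> \<le> 8 * ((2 * I * (2 * I)) * (2 * Q))"
    using a Q by (intro mult_le_mono) auto
  also have "\<dots> = 64 * (I * I * Q)" by simp
  finally have H: "2 ^ (?H + 1) \<le> 64 * (I * I * Q)" .
  define K where "K = (I + 1) ^ 3 * (Q + 1)"
  have "I * I * Q \<le> K"
    unfolding K_def power3_eq_cube by (intro mult_le_mono) auto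
  moreover have "I * (I * I * Q) \<le> K"
  proof -
    have "I * I * I * Q \<le> K"
      unfolding K_def power3_eq_cube by (intro mult_le_mono) auto
    then show ?thesis by (simp add: mult.assoc)
  qed
  moreover have "I + 1 \<le> K"
  proof -
    have "(I + 1) * 1 \<le> ((I + 1) * ((I + 1) * (I + 1))) * (Q + 1)"
      by (simp only: mult.assoc) (intro mult_le_mono2, simp)
    then show ?thesis by (simp add: K_def power3_eq_cube mult.assoc)
  qed
  moreover have "?Z = 100 * K"
    unfolding size_bound_def K_def by (rule mult.assoc)
  ultimately have Z: "64 * (I * I * Q) \<le> ?Z" "64 * (I * (I * I * Q)) \<le> ?Z" "100 * (I + 1) \<le> ?Z"
    by simp_all
  have IZ: "I \<le> ?Z" by (rule order_trans[OF _ Z(3)]) simp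
  have plen: "plen (weight_of (weights c a vs \<omega>)) \<mu> \<le> ?Z" if "\<omega> \<in> tapes vs a" for \<omega>
  proof -
    have \<omega>: "length \<omega> = length vs" using that by (simp add: tapes_def nlists_def)
    have "len (weight_of (weights c a vs \<omega>) v) + 1 \<le> 2 ^ (?H + 1)" if v: "v \<in> cverts \<mu>" for v
    proof -
      let ?bs = "the (map_of (zip vs \<omega>) v)"
      have "?bs \<in> set \<omega>" using map_of_zip_mem[OF \<omega>, of v] v vs by simp
      then have "length ?bs = Suc a" using \<open>\<omega> \<in> tapes vs a\<close> by (auto simp: tapes_def nlists_def)
      moreover have "bitlen (c v) \<le> bitlen Q" using c v by (intro bitlen_mono) auto
      ultimately have "length (weight_bits c a v ?bs) \<le> ?H" by (simp add: weight_bits_def bits)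
      then have "(2 :: nat) ^ (length (weight_bits c a v ?bs) + 1) \<le> 2 ^ (?H + 1)"
        by (intro power_increasing) auto
      then show ?thesis
        using len_pmono[of "weight_bits c a v ?bs"] weight_of_weights[OF \<omega>, of v c a] v vs by simp
    qed
    then have "plen (weight_of (weights c a vs \<omega>)) \<mu> \<le> (\<Sum>v\<in>cverts \<mu>. 2 ^ (?H + 1))"
      unfolding plen_eq[OF wf] by (intro sum_mono)
    also have "\<dots> = length vs * 2 ^ (?H + 1)"
      using vs distinct_card[of vs] by simp
    also have "\<dots> \<le> I * (64 * (I * I * Q))" using n H by (rule mult_le_mono)
    also have "\<dots> \<le> ?Z" using Z(2) by (simp add: mult.left_commute)
    finally show ?thesis .
  qed
  have main: "\<exists>t. (\<forall>\<omega> \<in> tapes vs a. t \<omega> \<le> t_main ?H ?Z k (size (enc_cexpr \<mu>))) \<and>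
    eval prog [Node (enc_cexpr \<mu>) (Node (enc_costs c vs) (enc_nat b))] (body prog f_main) =
    bind_spmf (spmf_of_set (tapes vs a)) (\<lambda>\<omega>. return_spmf (enc_bool (accepts \<mu> c b vs \<omega>), t \<omega>))"
    unfolding tapes_def a_def
  proof (rule eval_main[where Lab = "clabels \<mu>"])
    show "card (clabels \<mu>) \<le> k" using card_mono[OF _ lab] by simp
    show "card (clabels \<mu>) \<le> ?Z" using card_clabels[of \<mu>] E IZ by linarith
    show "\<forall>l \<in> clabels \<mu>. size (enc_nat l) \<le> ?Z" using size_labels E IZ by (meson le_trans)
    show "\<forall>v \<in> cverts \<mu>. size (enc_nat v) \<le> ?Z" using size_cverts E IZ by (meson le_trans)
    show "length vs \<le> ?Z" using n IZ by linarith
    show "plen (weight_of (weights c (bitlen (length vs)) vs \<omega>)) \<mu> \<le> ?Z"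
      if "\<omega> \<in> nlists (length vs) (nlists (Suc (bitlen (length vs))) UNIV)" for \<omega>
      using plen[unfolded tapes_def a_def] that .
    show "2 * bitlen (length vs) + 2 + bitlen b \<le> ?Z"
    proof -
      have "2 * a + 2 + bitlen b \<le> 5 * I + 2" using a \<open>a < 2 ^ a\<close> bI by linarith
      also have "\<dots> \<le> ?Z" by (rule order_trans[OF _ Z(3)]) simp
      finally show ?thesis unfolding a_def .
    qed
    show "2 * bitlen (length vs) + 2 + bitlen (c v) \<le> 2 * bitlen (length vs) + 2 + bitlen Q"
      if "v \<in> set vs" for v
      using that vs c bitlen_mono[of "c v" Q] by simp
  qed (auto simp: finite_clabels)
  have le: "t_main ?H ?Z k (size (enc_cexpr \<mu>)) \<le> 6 ^ k * t_total ?Z"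
  proof (rule t_main_le)
    show "2 ^ (?H + 1) \<le> ?Z" using H Z(1) by (rule le_trans)
    moreover have "?H < 2 ^ ?H" by (rule less_exp)
    moreover have "(2 :: nat) ^ (?H + 1) = 2 * 2 ^ ?H" by simp
    ultimately show "?H \<le> ?Z" by linarith
    show "size (enc_cexpr \<mu>) \<le> ?Z" using E IZ by (rule le_trans)
  qed
  from main obtain t where t: "\<forall>\<omega> \<in> tapes vs a. t \<omega> \<le> t_main ?H ?Z k (size (enc_cexpr \<mu>))"
    and run: "eval prog [Node (enc_cexpr \<mu>) (Node (enc_costs c vs) (enc_nat b))] (body prog f_main) =
      bind_spmf (spmf_of_set (tapes vs a)) (\<lambda>\<omega>. return_spmf (enc_bool (accepts \<mu> c b vs \<omega>), t \<omega>))"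
    by (elim exE conjE)
  show ?thesis
  proof (intro exI[of _ t] conjI ballI)
    show "t \<omega> \<le> 6 ^ k * t_total ?Z" if "\<omega> \<in> tapes vs a" for \<omega>
      using bspec[OF t that] le by (rule le_trans)
  qed (use run in \<open>simp only: run_def inst f_main_def\<close>)
qed

section \<open>From counting tapes to probabilities\<close>

lemma prob_output_uniform:
  assumes "run P x = bind_spmf (spmf_of_set \<Omega>) (\<lambda>\<omega>. return_spmf (g \<omega>, t \<omega>))"
  shows "prob_output P x y = card {\<omega> \<in> \<Omega>. g \<omega> = y} / card \<Omega>"
proof -
  have "run P x = map_spmf (\<lambda>\<omega>. (g \<omega>, t \<omega>)) (spmf_of_set \<Omega>)"
    using assms by (simp add: map_spmf_conv_bind_spmf)
  then have 1: "prob_output P x y =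
      measure (measure_spmf (spmf_of_set \<Omega>)) ((\<lambda>\<omega>. (g \<omega>, t \<omega>)) -` {(y', t). y' = y})"
    by (simp add: prob_output_def measure_map_spmf)
  have 2: "(\<lambda>\<omega>. (g \<omega>, t \<omega>)) -` {(y', t). y' = y} = {\<omega>. g \<omega> = y}" by auto
  have 3: "\<Omega> \<inter> {\<omega>. g \<omega> = y} = {\<omega> \<in> \<Omega>. g \<omega> = y}" by blast
  show ?thesis unfolding 1 2 measure_spmf_of_set 3 ..
qed

lemma enc_bool_inj: "enc_bool x = enc_bool y \<longleftrightarrow> x = y"
  by (cases x; cases y) auto

theorem theorem22:
  shows "\<exists>P :: program. \<forall>q :: nat poly. \<exists>p :: nat poly.
    \<forall>(k :: nat) (\<mu> :: nat cexpr) (G :: nat pair_pre_digraph) (c :: nat \<Rightarrow> nat) (b :: nat).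
      k_expression k \<mu> \<and> nice \<mu> \<and> graph_of \<mu> = G \<and>
      Digraph_Component.connected (with_proj G) \<and> 2 \<le> card (pverts G) \<and>
      (\<forall>v \<in> pverts G. 0 < c v \<and> c v \<le> poly q (size (enc_instance \<mu> c b)))
      \<longrightarrow>
      halts_within P (enc_instance \<mu> c b) (6 ^ k * poly p (size (enc_instance \<mu> c b))) \<and>
      prob_output P (enc_instance \<mu> c b) (enc_bool True) +
        prob_output P (enc_instance \<mu> c b) (enc_bool False) = 1 \<and>
      (\<not> CVC G c b \<longrightarrow> prob_output P (enc_instance \<mu> c b) (enc_bool True) = 0) \<and>
      (CVC G c b \<longrightarrow> prob_output P (enc_instance \<mu> c b) (enc_bool False) \<le> 1 / 2)"
proof (intro exI[of _ prog] allI)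
  fix q :: "nat poly"
  obtain p0 where p0: "\<And>x. poly p0 x = t_total x"
    using polynomial_t_total by (auto simp: polynomial_def)
  \<comment> \<open>The program is the same for all \<open>q\<close>; only the time bound depends on
    \<open>q\<close>. The inner polynomial is \<open>size_bound\<close> at the input size and at the
    bound on the costs.\<close>
  define p where "p = pcompose p0 (smult 100 ([:1, 1:] ^ 3 * (q + 1)))"
  have p: "poly p x = t_total (size_bound x (poly q x))" for x
    by (simp add: p_def poly_pcompose p0 size_bound_def mult.assoc add.commute)
  have main: "halts_within prog x (6 ^ k * poly p (size x)) \<and>
      prob_output prog x (enc_bool True) + prob_output prog x (enc_bool False) = 1 \<and>
      (\<not> CVC G c b \<longrightarrow> prob_output prog x (enc_bool True) = 0) \<and>
      (CVC G c b \<longrightarrow> prob_output prog x (enc_bool False) \<le> 1 / 2)"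
    if \<mu>: "k_expression k \<mu>" "nice \<mu>" "graph_of \<mu> = G" and x: "x = enc_instance \<mu> c b" and
      c: "\<forall>v \<in> pverts G. 0 < c v \<and> c v \<le> poly q (size (enc_instance \<mu> c b))"
    for k \<mu> G c b x
  proof -
    let ?vs = "sorted_list_of_set (cverts \<mu>)"
    let ?a = "bitlen (length ?vs)"
    let ?\<Omega> = "tapes ?vs ?a" and ?acc = "accepts \<mu> c b ?vs"
    have "\<forall>v \<in> cverts \<mu>. 0 < c v \<and> c v \<le> poly q (size x)"
      using c \<mu>(3) x by (auto simp: graph_of_def)
    from run_prog[OF \<mu>(1) this[unfolded x]] obtain t where
      t: "\<And>\<omega>. \<omega> \<in> ?\<Omega> \<Longrightarrow> t \<omega> \<le> 6 ^ k * poly p (size x)" and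
      run: "run prog x = bind_spmf (spmf_of_set ?\<Omega>) (\<lambda>\<omega>. return_spmf (enc_bool (?acc \<omega>), t \<omega>))"
      unfolding p x by blast
    have wf: "wf_cexpr \<mu>" using \<mu>(1) by (simp add: k_expression_def)
    have vs: "set ?vs = cverts \<mu>" "distinct ?vs" by (simp_all add: finite_cverts)
    have fin: "finite (tapes vs a)" "tapes vs a \<noteq> {}" for vs a
      by (simp_all add: tapes_def finite_nlists nlists_ne)
    have pos: "0 < card ?\<Omega>" using fin by (simp add: card_gt_0_iff del: length_sorted_list_of_set)
    have True: "prob_output prog x (enc_bool True) = card {\<omega> \<in> ?\<Omega>. ?acc \<omega>} / card ?\<Omega>"
      and False: "prob_output prog x (enc_bool False) = card {\<omega> \<in> ?\<Omega>. \<not> ?acc \<omega>} / card ?\<Omega>"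
      unfolding prob_output_uniform[OF run] enc_bool_inj by simp_all
    have "card {\<omega> \<in> ?\<Omega>. ?acc \<omega>} + card {\<omega> \<in> ?\<Omega>. \<not> ?acc \<omega>} = card ?\<Omega>"
      using fin by (subst card_Un_disjoint[symmetric]) (auto intro!: arg_cong[where f = card])
    then have "real (card {\<omega> \<in> ?\<Omega>. ?acc \<omega>}) + real (card {\<omega> \<in> ?\<Omega>. \<not> ?acc \<omega>}) = real (card ?\<Omega>)"
      by linarith
    then have sum: "prob_output prog x (enc_bool True) + prob_output prog x (enc_bool False) = 1"
      using pos unfolding True False by (simp flip: add_divide_distrib)
    have run': "run prog x = map_spmf (\<lambda>\<omega>. (enc_bool (?acc \<omega>), t \<omega>)) (spmf_of_set ?\<Omega>)"
      unfolding run map_spmf_conv_bind_spmf ..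
    have "halts_within prog x (6 ^ k * poly p (size x))"
      unfolding halts_within_def
    proof (intro conjI ballI)
      show "lossless_spmf (run prog x)"
        unfolding run' lossless_map_spmf lossless_spmf_of_set using fin by (intro conjI)
      show "case yt of (y, s) \<Rightarrow> s \<le> 6 ^ k * poly p (size x)" if "yt \<in> set_spmf (run prog x)" for yt
      proof -
        have "yt \<in> (\<lambda>\<omega>. (enc_bool (?acc \<omega>), t \<omega>)) ` ?\<Omega>"
          using that unfolding run' set_map_spmf set_spmf_of_set_finite[OF fin(1)] .
        then obtain \<omega> where "\<omega> \<in> ?\<Omega>" "yt = (enc_bool (?acc \<omega>), t \<omega>)" by (rule imageE)
        then show ?thesis using t by simp
      qed
    qed
    moreover have "prob_output prog x (enc_bool True) = 0" if "\<not> CVC G c b"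
    proof -
      have none: "{\<omega> \<in> ?\<Omega>. ?acc \<omega>} = {}"
        using accepts_sound[OF wf \<mu>(2) vs refl, of _ c b] that \<mu>(3) by blast
      show ?thesis unfolding True none by simp
    qed
    moreover have "prob_output prog x (enc_bool False) \<le> 1 / 2" if "CVC G c b"
    proof -
      have "2 * card {\<omega> \<in> ?\<Omega>. \<not> ?acc \<omega>} \<le> card ?\<Omega>"
        by (rule card_tapes_rejected[OF wf \<mu>(2) vs refl]) (simp only: that \<mu>(3))
      then show ?thesis unfolding False using pos by (simp add: field_simps)
    qed
    ultimately show ?thesis using sum by blast
  qed
  show "\<exists>p :: nat poly.
    \<forall>(k :: nat) (\<mu> :: nat cexpr) (G :: nat pair_pre_digraph) (c :: nat \<Rightarrow> nat) (b :: nat).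
      k_expression k \<mu> \<and> nice \<mu> \<and> graph_of \<mu> = G \<and>
      Digraph_Component.connected (with_proj G) \<and> 2 \<le> card (pverts G) \<and>
      (\<forall>v \<in> pverts G. 0 < c v \<and> c v \<le> poly q (size (enc_instance \<mu> c b)))
      \<longrightarrow>
      halts_within prog (enc_instance \<mu> c b) (6 ^ k * poly p (size (enc_instance \<mu> c b))) \<and>
      prob_output prog (enc_instance \<mu> c b) (enc_bool True) +
        prob_output prog (enc_instance \<mu> c b) (enc_bool False) = 1 \<and>
      (\<not> CVC G c b \<longrightarrow> prob_output prog (enc_instance \<mu> c b) (enc_bool True) = 0) \<and>
      (CVC G c b \<longrightarrow> prob_output prog (enc_instance \<mu> c b) (enc_bool False) \<le> 1 / 2)"
  proof (rule exI[of _ p], intro allI impI, elim conjE, goal_cases)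
    case (1 k \<mu> G c b)
    show ?case by (rule main[OF 1(1-3) refl 1(6)])
  qed
qed

end
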